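(* Let $f:(A,B)\to(0,\infty)$ be a lower semicontinuous real-valued function on a (finite or infinite) open interval, and let $D=\{(x,y): x\in(A,B),\ 0<y<f(x)\}\subset\mathbb{C}$ be the (simply connected) domain under the graph of $f$, assumed to have finite Euclidean area. Identify the set of prime ends of $D$ with $\mathbb{S}^1$, and let $(a,b,c,d)$ be a quadruple of distinct prime ends in the given cyclic (counterclockwise) order, so that $(a,b)$ and $(c,d)$ are disjoint open arcs of $\mathbb{S}^1$. Let $\Gamma$ be the family of curves in $D$ connecting $(a,b)$ and $(c,d)$. For $\varepsilon>0$ let $T_\varepsilon(x,y)=(x,\varepsilon y)$ and $\Gamma^{\varepsilon}=T_\varepsilon(\Gamma)=\{T_\varepsilon(\gamma):\gamma\in\Gamma\}$, and let $\Gamma_v$ be the family, possibly empty, of vertical line segments in $\Gamma$. Then $$\lim_{\varepsilon\to 0}\varepsilon\cdot \mathrm{mod}(\Gamma^{\varepsilon})=\mathrm{mod}(\Gamma_{v}).$$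
   Context: Prime ends are taken in the sense of Carathéodory. A Riemann map from $D$ onto the unit disk $\mathbb{D}$ induces a one-to-one correspondence between the prime ends of $D$ and the points of the unit circle $\mathbb{S}^1$; through it the set of prime ends inherits the topology and orientation of $\mathbb{S}^1$, and arcs of $\mathbb{S}^1$ are regarded as sets of prime ends. A curve in $D$ connects the arcs $(a,b)$ and $(c,d)$ of prime ends if it is a locally rectifiable curve in $D$ one of whose ends converges to a prime end in $(a,b)$ and the other to a prime end in $(c,d)$. Here a ray $r:[0,1)\to D$ converges to the prime end defined by a system of cross-cuts $\{s_i\}$ if for all large $i$ there is $t_i<1$ such that $r((t_i,1))$ is contained in the component of $D\setminus s_i$ not containing $r(0)$. Conformal modulus: for a family $\Gamma$ of locally rectifiable curves in $\mathbb{C}$, a Borel function $\rho:\mathbb{C}\to[0,\infty]$ is $\Gamma$-admissible if $\int_\gamma\rho\,|dz|\ge 1$ for every $\gamma\in\Gamma$, and $\mathrm{mod}(\Gamma)=\inf_\rho\int_{\mathbb{C}}\rho(z)^2\,dx\,dy$, the infimum being over all $\Gamma$-admissible $\rho$ (so $\mathrm{mod}(\emptyset)=0$). *)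

theory Defs
  imports "HOL-Complex_Analysis.Complex_Analysis"
begin

subsection \<open>The domain under a graph\<close>

definition ereal_interval :: "ereal \<Rightarrow> ereal \<Rightarrow> real set" where
  "ereal_interval A B = {x. A < ereal x \<and> ereal x < B}"

definition lower_semicontinuous_on :: "real set \<Rightarrow> (real \<Rightarrow> real) \<Rightarrow> bool" where
  "lower_semicontinuous_on I f \<longleftrightarrow>
     (\<forall>x\<in>I. \<forall>c. c < f x \<longrightarrow> (\<forall>\<^sub>F t in at x within I. c < f t))"

definition under_graph :: "ereal \<Rightarrow> ereal \<Rightarrow> (real \<Rightarrow> real) \<Rightarrow> complex set" where
  "under_graph A B f = {z. Re z \<in> ereal_interval A B \<and> 0 < Im z \<and> Im z < f (Re z)}"


subsection \<open>Locally rectifiable curves, line integrals and conformal modulus\<close>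

text \<open>
  A curve is a map \<open>\<gamma> :: real \<Rightarrow> complex\<close> considered on the open parameter interval
  \<open>(0,1)\<close> only; its values elsewhere are never used. Thus a curve in a domain may, but need not,
  have limits at its two ends.
\<close>

definition curve_length :: "(real \<Rightarrow> complex) \<Rightarrow> real \<Rightarrow> real \<Rightarrow> ennreal" where
  "curve_length \<gamma> u v =
     (SUP ts \<in> {ts. sorted ts \<and> set ts \<subseteq> {u..v}}.
        ennreal (\<Sum>i<length ts - 1. dist (\<gamma> (ts ! i)) (\<gamma> (ts ! Suc i))))"

definition locally_rectifiable :: "(real \<Rightarrow> complex) \<Rightarrow> bool" where
  "locally_rectifiable \<gamma> \<longleftrightarrow> continuous_on {0<..<1} \<gamma> \<and>
     (\<forall>u v. 0 < u \<and> u < v \<and> v < 1 \<longrightarrow> curve_length \<gamma> u v < \<infinity>)"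

text \<open>
  Parametrization by arc length of the rectifiable curve \<open>\<gamma>\<close> restricted to \<open>[u,v]\<close>: the point
  reached after length \<open>s\<close>. As \<open>\<gamma>\<close> is constant on the intervals where its length function is,
  evaluating at the first parameter of length \<open>s\<close> loses nothing.
\<close>
definition arc_length_param :: "(real \<Rightarrow> complex) \<Rightarrow> real \<Rightarrow> real \<Rightarrow> real \<Rightarrow> complex" where
  "arc_length_param \<gamma> u v s = \<gamma> (Inf {t \<in> {u..v}. ennreal s \<le> curve_length \<gamma> u t})"

definition line_integral :: "(complex \<Rightarrow> ennreal) \<Rightarrow> (real \<Rightarrow> complex) \<Rightarrow> ennreal" where
  "line_integral \<rho> \<gamma> =
     (SUP (u, v) \<in> {(u, v). 0 < u \<and> u < v \<and> v < 1}.
        \<integral>\<^sup>+ s \<in> {0..enn2real (curve_length \<gamma> u v)}. \<rho> (arc_length_param \<gamma> u v s) \<partial>lborel)"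

definition admissible :: "(real \<Rightarrow> complex) set \<Rightarrow> (complex \<Rightarrow> ennreal) set" where
  "admissible \<Gamma> = {\<rho> \<in> borel_measurable borel. \<forall>\<gamma>\<in>\<Gamma>. 1 \<le> line_integral \<rho> \<gamma>}"

definition modulus :: "(real \<Rightarrow> complex) set \<Rightarrow> ennreal" where
  "modulus \<Gamma> = (INF \<rho> \<in> admissible \<Gamma>. \<integral>\<^sup>+ z. (\<rho> z)\<^sup>2 \<partial>lborel)"

definition vertical_scaling :: "real \<Rightarrow> complex \<Rightarrow> complex" where
  "vertical_scaling \<epsilon> z = Complex (Re z) (\<epsilon> * Im z)"

definition scaled_family :: "real \<Rightarrow> (real \<Rightarrow> complex) set \<Rightarrow> (real \<Rightarrow> complex) set" where
  "scaled_family \<epsilon> \<Gamma> = (\<lambda>\<gamma>. vertical_scaling \<epsilon> \<circ> \<gamma>) ` \<Gamma>"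

definition vertical_segment :: "(real \<Rightarrow> complex) \<Rightarrow> bool" where
  "vertical_segment \<gamma> \<longleftrightarrow> inj_on \<gamma> {0<..<1} \<and>
     (\<exists>x y\<^sub>0 y\<^sub>1. y\<^sub>0 < y\<^sub>1 \<and> \<gamma> ` {0<..<1} = {z. Re z = x \<and> y\<^sub>0 < Im z \<and> Im z < y\<^sub>1})"


subsection \<open>Prime ends in the sense of Caratheodory\<close>

text \<open>
  The domain may be unbounded, so cross-cuts may end at infinity and their size is measured in the
  spherical metric. The Riemann sphere is the unit sphere of \<open>complex \<times> real\<close>, and the Euclidean
  distance of \<open>complex \<times> real\<close> restricts to the chordal distance.
\<close>
definition to_sphere :: "complex \<Rightarrow> complex \<times> real" where
  "to_sphere z = ((2 / (1 + (cmod z)\<^sup>2)) *\<^sub>R z, ((cmod z)\<^sup>2 - 1) / ((cmod z)\<^sup>2 + 1))"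

text \<open>
  An open Jordan arc in the open set \<open>D\<close> whose two end points (which may coincide) lie on the
  boundary of \<open>D\<close> in the sphere.
\<close>
definition cross_cut :: "complex set \<Rightarrow> complex set \<Rightarrow> bool" where
  "cross_cut D s \<longleftrightarrow> s \<subseteq> D \<and>
     (\<exists>g. simple_path g \<and> g ` {0<..<1} = to_sphere ` s \<and>
          {pathstart g, pathfinish g} \<subseteq> closure (to_sphere ` D) - to_sphere ` D)"

definition separates_in :: "complex set \<Rightarrow> complex set \<Rightarrow> complex set \<Rightarrow> complex set \<Rightarrow> bool" where
  "separates_in D s X Y \<longleftrightarrow>
     (\<exists>K\<in>components (D - s). \<exists>L\<in>components (D - s). K \<noteq> L \<and> X \<subseteq> K \<and> Y \<subseteq> L)"

definition null_chain :: "complex set \<Rightarrow> (nat \<Rightarrow> complex set) \<Rightarrow> bool" where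
  "null_chain D s \<longleftrightarrow>
     (\<forall>n. cross_cut D (s n)) \<and>
     (\<forall>n. closure (to_sphere ` s n) \<inter> closure (to_sphere ` s (Suc n)) = {}) \<and>
     (\<forall>n\<ge>1. separates_in D (s n) (s 0) (s (Suc n))) \<and>
     (\<lambda>n. diameter (to_sphere ` s n)) \<longlonglongrightarrow> 0"

text \<open>
  The component of \<open>D - s n\<close> that contains \<open>s (n + 1)\<close>. For \<open>n \<ge> 1\<close> this is the component
  that does not contain \<open>s 0\<close>, since a cross-cut divides \<open>D\<close> into exactly two components.
\<close>
definition chain_region :: "complex set \<Rightarrow> (nat \<Rightarrow> complex set) \<Rightarrow> nat \<Rightarrow> complex set" where
  "chain_region D s n = \<Union>{K \<in> components (D - s n). s (Suc n) \<subseteq> K}"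

definition chain_equiv ::
  "complex set \<Rightarrow> ((nat \<Rightarrow> complex set) \<times> (nat \<Rightarrow> complex set)) set" where
  "chain_equiv D = {(s, s'). null_chain D s \<and> null_chain D s' \<and>
     (\<forall>m. \<exists>n. chain_region D s' n \<subseteq> chain_region D s m) \<and>
     (\<forall>m. \<exists>n. chain_region D s n \<subseteq> chain_region D s' m)}"

type_synonym prime_end = "(nat \<Rightarrow> complex set) set"

definition prime_ends :: "complex set \<Rightarrow> prime_end set" where
  "prime_ends D = {s. null_chain D s} // chain_equiv D"

text \<open>A ray is a map considered on \<open>[0,1)\<close>.\<close>
definition converges_to_prime_end :: "complex set \<Rightarrow> (real \<Rightarrow> complex) \<Rightarrow> prime_end \<Rightarrow> bool" where
  "converges_to_prime_end D r p \<longleftrightarrow>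
     (\<exists>s\<in>p. \<forall>\<^sub>F i in sequentially. \<exists>t\<in>{0..<1}. \<exists>K\<in>components (D - s i).
        r 0 \<notin> K \<and> r ` {t<..<1} \<subseteq> K)"


subsection \<open>The circle of prime ends\<close>

definition riemann_map :: "complex set \<Rightarrow> (complex \<Rightarrow> complex) \<Rightarrow> bool" where
  "riemann_map D \<phi> \<longleftrightarrow> \<phi> holomorphic_on D \<and> bij_betw \<phi> D (ball 0 1)"

text \<open>
  The one-to-one correspondence between the prime ends of \<open>D\<close> and the points of the unit circle
  that is induced by the Riemann map \<open>\<phi>\<close>.
\<close>
definition corresponds :: "complex set \<Rightarrow> (complex \<Rightarrow> complex) \<Rightarrow> prime_end \<Rightarrow> complex \<Rightarrow> bool" where
  "corresponds D \<phi> p \<zeta> \<longleftrightarrow> p \<in> prime_ends D \<and>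
     (\<exists>s\<in>p. (\<Inter>n. closure (\<phi> ` chain_region D s n)) = {\<zeta>})"

definition circle_arc :: "complex \<Rightarrow> complex \<Rightarrow> complex set" where
  "circle_arc \<alpha> \<beta> = {cis t | s t u. \<alpha> = cis s \<and> \<beta> = cis u \<and> s < t \<and> t < u \<and> u < s + 2 * pi}"

definition prime_end_arc ::
  "complex set \<Rightarrow> (complex \<Rightarrow> complex) \<Rightarrow> prime_end \<Rightarrow> prime_end \<Rightarrow> prime_end set" where
  "prime_end_arc D \<phi> a b = {p. \<exists>\<alpha> \<beta> \<zeta>. corresponds D \<phi> a \<alpha> \<and> corresponds D \<phi> b \<beta> \<and>
     corresponds D \<phi> p \<zeta> \<and> \<zeta> \<in> circle_arc \<alpha> \<beta>}"

text \<open>The strict inequalities make the four prime ends distinct.\<close>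
definition ccw_prime_ends ::
  "complex set \<Rightarrow> (complex \<Rightarrow> complex) \<Rightarrow> prime_end \<Rightarrow> prime_end \<Rightarrow> prime_end \<Rightarrow> prime_end \<Rightarrow> bool" where
  "ccw_prime_ends D \<phi> a b c d \<longleftrightarrow>
     (\<exists>\<theta>\<^sub>1 \<theta>\<^sub>2 \<theta>\<^sub>3 \<theta>\<^sub>4. \<theta>\<^sub>1 < \<theta>\<^sub>2 \<and> \<theta>\<^sub>2 < \<theta>\<^sub>3 \<and> \<theta>\<^sub>3 < \<theta>\<^sub>4 \<and> \<theta>\<^sub>4 < \<theta>\<^sub>1 + 2 * pi \<and>
        corresponds D \<phi> a (cis \<theta>\<^sub>1) \<and> corresponds D \<phi> b (cis \<theta>\<^sub>2) \<and>
        corresponds D \<phi> c (cis \<theta>\<^sub>3) \<and> corresponds D \<phi> d (cis \<theta>\<^sub>4))"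

text \<open>
  The two ends of \<open>\<gamma>\<close> are the rays that start at \<open>\<gamma> (1/2)\<close> and run towards the parameters 0 and 1.
  The curve is unoriented: either end may be the one that converges into \<open>P\<close>.
\<close>
definition connecting_curves ::
  "complex set \<Rightarrow> prime_end set \<Rightarrow> prime_end set \<Rightarrow> (real \<Rightarrow> complex) set" where
  "connecting_curves D P Q = {\<gamma>. locally_rectifiable \<gamma> \<and> \<gamma> ` {0<..<1} \<subseteq> D \<and>
     (\<exists>p\<in>P. \<exists>q\<in>Q.
        converges_to_prime_end D (\<lambda>t. \<gamma> ((1 - t) / 2)) p \<and>
        converges_to_prime_end D (\<lambda>t. \<gamma> ((1 + t) / 2)) q \<or>
        converges_to_prime_end D (\<lambda>t. \<gamma> ((1 - t) / 2)) q \<and>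
        converges_to_prime_end D (\<lambda>t. \<gamma> ((1 + t) / 2)) p)}"

end

theory Submission
  imports Defs
begin

text \<open>
  The lower bound holds for every \<open>\<epsilon>\<close>: the modulus of a family of vertical segments scales exactly.
  For the upper bound, pull the scaled problem back to \<open>D\<close>. The gradient of a function \<open>u\<close> on \<open>D\<close> that
  vanishes near \<open>(a,b)\<close> and is \<open>1\<close> near \<open>(c,d)\<close> yields an admissible density whose energy is
  \<open>\<epsilon>\<^sup>2 \<integral> u\<^sub>x\<^sup>2 + \<integral> u\<^sub>y\<^sup>2\<close>, so it suffices to make \<open>\<integral> u\<^sub>y\<^sup>2\<close> close to \<open>mod(\<Gamma>\<^sub>v)\<close>. Such functions
  may be glued with weights depending on \<open>x\<close> only, at no cost in \<open>u\<^sub>y\<close>, so \<open>\<integral> u\<^sub>y\<^sup>2\<close> can be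
  minimised separately on each vertical fibre, over a countable family of competitors built from
  cut-offs composed with the Riemann map. Since the Riemann map has finite area, its image of almost
  every fibre is an arc with end points on the circle, none of them one of the four given points. If
  one end point lies in each of the two arcs, then the minimum is \<open>1 / f x\<close> and, as small
  cross-cuts around the ends of the fibre show, the fibre belongs to \<open>\<Gamma>\<^sub>v\<close>; otherwise the minimum is \<open>0\<close>.
\<close>

subsection \<open>Area integrals in the plane\<close>

text \<open>Since \<open>f\<close> is only lower semicontinuous, the end of a fibre is not under
  control at every \<open>x\<close>. Three kinds of \<open>x\<close> are discarded, each null: those
  of infinite fibre energy, by Fubini; those without neighbours on both sides having nearly the same
  value of \<open>f\<close> and nearly the same energy, a countable set; those whose fibre ends at
  one of the four points, because points have capacity zero. The value
  \<open>mod(\<Gamma>\<^sub>v)\<close> is never computed: the fibrewise infimum is compared with an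
  arbitrary density admissible for \<open>\<Gamma>\<^sub>v\<close>, whose square has integral at
  least \<open>1 / f x\<close> on each fibre of the family. Countability of the competitors makes
  this infimum measurable, and monotone convergence passes to it from finite minima. Competitors are
  continuously differentiable because the gradient has to bound differences along every locally
  rectifiable curve, not just almost every one. Gluing in \<open>x\<close> creates a bounded
  horizontal derivative; it is square integrable since \<open>D\<close> has finite area, and the
  factor \<epsilon> squared removes it in the limit.\<close>

lemma box_complex_eq: "box l u = {z. Re l < Re z \<and> Re z < Re u \<and> Im l < Im z \<and> Im z < Im u}"
  by (auto simp: box_def Basis_complex_def)

lemma Complex_measurable [measurable (raw)]:
  assumes "f \<in> borel_measurable M" "g \<in> borel_measurable M"
  shows "(\<lambda>x. Complex (f x) (g x)) \<in> borel_measurable M"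
proof -
  have "(\<lambda>x. complex_of_real (f x) + \<i> * complex_of_real (g x)) \<in> borel_measurable M"
    using assms by measurable
  then show ?thesis by (simp add: Complex_eq)
qed

text \<open>Lebesgue measure is determined by the volumes of boxes, and a box in the plane is a
  product of two intervals. Fubini over vertical lines rests on this identity.\<close>

lemma lborel_complex_eq_distr_pair:
  "(lborel :: complex measure) = distr (lborel \<Otimes>\<^sub>M lborel) borel (\<lambda>(x, y). Complex x y)"
proof (rule lborel_eqI)
  fix l u :: complex
  assume lu: "\<And>b. b \<in> Basis \<Longrightarrow> l \<bullet> b \<le> u \<bullet> b"
  have le: "Re l \<le> Re u" "Im l \<le> Im u"
    using lu[of 1] lu[of \<i>] by (auto simp: Basis_complex_def)
  have "emeasure (distr (lborel \<Otimes>\<^sub>M lborel) borel (\<lambda>(x, y). Complex x y)) (box l u)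
      = emeasure (lborel \<Otimes>\<^sub>M lborel) ({Re l<..<Re u} \<times> {Im l<..<Im u})"
    by (subst emeasure_distr) (auto simp: box_complex_eq space_pair_measure intro!: arg_cong2[where f=emeasure])
  also have "\<dots> = ennreal ((Re u - Re l) * (Im u - Im l))"
    using le by (simp add: lborel.emeasure_pair_measure_Times ennreal_mult)
  also have "\<dots> = (\<Prod>b\<in>Basis. (u - l) \<bullet> b)"
    by (simp add: Basis_complex_def)
  finally show "emeasure (distr (lborel \<Otimes>\<^sub>M lborel) borel (\<lambda>(x, y). Complex x y)) (box l u) = (\<Prod>b\<in>Basis. (u - l) \<bullet> b)" .
qed simp

lemma nn_integral_complex_iterated:
  assumes [measurable]: "h \<in> borel_measurable borel"
  shows "(\<integral>\<^sup>+ z. h z \<partial>lborel) = (\<integral>\<^sup>+ x. \<integral>\<^sup>+ y. h (Complex x y) \<partial>lborel \<partial>lborel)"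
proof -
  have "(\<integral>\<^sup>+ z. h z \<partial>lborel) = (\<integral>\<^sup>+ p. h (case p of (x, y) \<Rightarrow> Complex x y) \<partial>(lborel \<Otimes>\<^sub>M lborel))"
    by (subst lborel_complex_eq_distr_pair, subst nn_integral_distr) auto
  also have "\<dots> = (\<integral>\<^sup>+ x. \<integral>\<^sup>+ y. h (Complex x y) \<partial>lborel \<partial>lborel)"
    by (subst lborel.nn_integral_fst[symmetric]) auto
  finally show ?thesis .
qed

lemma borel_measurable_fibre_integral [measurable (raw)]:
  assumes [measurable]: "h \<in> borel_measurable borel"
  shows "(\<lambda>x. \<integral>\<^sup>+ y. h (Complex x y) \<partial>lborel) \<in> borel_measurable borel"
proof -
  have "(\<lambda>x. \<integral>\<^sup>+ y. h (Complex x y) \<partial>lborel) \<in> borel_measurable (lborel :: real measure)"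
    by measurable
  then show ?thesis by simp
qed

section \<open>The area formula for injective holomorphic maps\<close>

lemma Basis_real2: "(Basis :: (real^2) set) = {axis 1 1, axis 2 1}"
proof -
  have "(Basis :: (real^2) set) = range (\<lambda>i. axis i 1)"
    unfolding Basis_vec_def by auto
  also have "\<dots> = {axis 1 1, axis 2 1}"
    by (simp add: UNIV_2)
  finally show ?thesis .
qed

text \<open>The change of variables theorem speaks of determinants on Cartesian powers of the reals,
  so areas are carried from the complex plane to \<open>real^2\<close> and back.\<close>

definition complex_of_vec2 :: "real^2 \<Rightarrow> complex" where
  "complex_of_vec2 v = Complex (v $ 1) (v $ 2)"

definition vec2_of_complex :: "complex \<Rightarrow> real^2" where
  "vec2_of_complex z = (\<chi> i. if i = 1 then Re z else Im z)"

lemma vec2_of_complex_nth [simp]: "vec2_of_complex z $ 1 = Re z" "vec2_of_complex z $ 2 = Im z"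
  by (auto simp: vec2_of_complex_def)

lemma complex_vec2_inverse [simp]:
  "complex_of_vec2 (vec2_of_complex z) = z" "vec2_of_complex (complex_of_vec2 v) = v"
  by (auto simp: complex_of_vec2_def vec2_of_complex_def vec_eq_iff forall_2)

lemma vec2_of_complex_image: "vec2_of_complex ` S = complex_of_vec2 -` S"
proof (intro equalityI subsetI)
  fix v assume "v \<in> complex_of_vec2 -` S"
  then show "v \<in> vec2_of_complex ` S"
    by (intro image_eqI[of _ _ "complex_of_vec2 v"]) auto
qed auto

lemma bounded_linear_complex_of_vec2: "bounded_linear complex_of_vec2"
  by (rule linear_conv_bounded_linear[THEN iffD1])
     (auto intro!: linearI simp: complex_of_vec2_def complex_eq_iff)

lemma bounded_linear_vec2_of_complex: "bounded_linear vec2_of_complex"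
  by (rule linear_conv_bounded_linear[THEN iffD1])
     (auto intro!: linearI simp: vec_eq_iff forall_2)

lemma borel_measurable_complex_of_vec2 [measurable]: "complex_of_vec2 \<in> borel_measurable borel"
  by (intro borel_measurable_continuous_onI linear_continuous_on bounded_linear_complex_of_vec2)

lemma lborel_complex_eq_distr_vec2:
  "(lborel :: complex measure) = distr lborel borel complex_of_vec2"
proof (rule lborel_eqI)
  fix l u :: complex
  assume lu: "\<And>b. b \<in> Basis \<Longrightarrow> l \<bullet> b \<le> u \<bullet> b"
  have le: "Re l \<le> Re u" "Im l \<le> Im u"
    using lu[of 1] lu[of \<i>] by (auto simp: Basis_complex_def)
  have "emeasure (distr lborel borel complex_of_vec2) (box l u)
      = emeasure lborel (box (vec2_of_complex l) (vec2_of_complex u))"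
    by (subst emeasure_distr)
       (auto simp: box_complex_eq mem_box_cart forall_2 complex_of_vec2_def intro!: arg_cong2[where f=emeasure])
  also have "\<dots> = ennreal ((Re u - Re l) * (Im u - Im l))"
    using le
    by (simp add: emeasure_lborel_box_eq Basis_real2 axis_eq_axis inner_axis mult.commute)
  also have "\<dots> = (\<Prod>b\<in>Basis. (u - l) \<bullet> b)"
    by (simp add: Basis_complex_def)
  finally show "emeasure (distr lborel borel complex_of_vec2) (box l u) = (\<Prod>b\<in>Basis. (u - l) \<bullet> b)" .
qed simp

lemma emeasure_complex_eq_vec2:
  assumes "S \<in> sets borel"
  shows "emeasure lborel S = emeasure lborel (vec2_of_complex ` S)"
  using assms
  by (subst lborel_complex_eq_distr_vec2, subst emeasure_distr) (auto simp: vec2_of_complex_image)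

lemma nn_integral_complex_vec2:
  assumes [measurable]: "h \<in> borel_measurable borel"
  shows "(\<integral>\<^sup>+ z. h z \<partial>lborel) = (\<integral>\<^sup>+ v. h (complex_of_vec2 v) \<partial>lborel)"
  by (subst lborel_complex_eq_distr_vec2, subst nn_integral_distr) auto

text \<open>By the Cauchy-Riemann equations a complex derivative acts as a rotation times a dilation
  by \<open>cmod c\<close>, which multiplies areas by the square.\<close>

lemma abs_det_complex_mult:
  "\<bar>det (matrix (\<lambda>v. vec2_of_complex (c * complex_of_vec2 v)))\<bar> = (cmod c)\<^sup>2"
proof -
  have "det (matrix (\<lambda>v. vec2_of_complex (c * complex_of_vec2 v))) = (Re c)\<^sup>2 + (Im c)\<^sup>2"
    by (simp add: det_2 matrix_def complex_of_vec2_def axis_def power2_eq_square)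
  then show ?thesis by (simp add: cmod_power2)
qed

text \<open>The Jacobian of a holomorphic map is the squared modulus of its derivative. This is the
  source of the conformal invariance of Dirichlet integrals: energies of functions composed with the
  Riemann map are estimated by areas in the disk.\<close>

lemma nn_integral_norm_deriv_sq:
  assumes S: "S \<in> sets borel"
    and der: "\<And>z. z \<in> S \<Longrightarrow> (\<phi> has_field_derivative \<phi>' z) (at z)"
    and inj: "inj_on \<phi> S"
    and meas: "\<phi> ` S \<in> sets borel" and bdd: "bounded (\<phi> ` S)"
    and phi'_meas: "(\<lambda>z. indicator S z * (cmod (\<phi>' z))\<^sup>2) \<in> borel_measurable borel"
  shows "(\<integral>\<^sup>+ z. indicator S z * ennreal ((cmod (\<phi>' z))\<^sup>2) \<partial>lborel) = emeasure lborel (\<phi> ` S)"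
proof -
  define T where "T = vec2_of_complex ` S"
  define F where "F = (\<lambda>v. vec2_of_complex (\<phi> (complex_of_vec2 v)))"
  define F' where "F' = (\<lambda>v h. vec2_of_complex (\<phi>' (complex_of_vec2 v) * complex_of_vec2 h))"
  have T_sets: "T \<in> sets borel"
    using measurable_sets[OF borel_measurable_complex_of_vec2 S] by (simp add: T_def vec2_of_complex_image)
  have FT: "F ` T = vec2_of_complex ` \<phi> ` S"
    by (auto simp: F_def T_def image_image)
  have FT_sets: "F ` T \<in> sets borel"
    using measurable_sets[OF borel_measurable_complex_of_vec2 meas] by (simp add: FT vec2_of_complex_image)
  have em: "emeasure lborel (F ` T) = emeasure lborel (\<phi> ` S)"
    using emeasure_complex_eq_vec2[OF meas] by (simp add: FT)
  \<comment> \<open>A bounded image has finite area, so the real-valued change of variables theorem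
    applies.\<close>
  have fin: "emeasure lborel (\<phi> ` S) < \<infinity>"
    by (rule emeasure_bounded_finite[OF bdd])
  have derF: "(F has_derivative F' v) (at v within T)" if "v \<in> T" for v
  proof -
    have "complex_of_vec2 v \<in> S" using that by (auto simp: T_def)
    then have "(\<phi> has_derivative (\<lambda>h. \<phi>' (complex_of_vec2 v) * h)) (at (complex_of_vec2 v))"
      using der[of "complex_of_vec2 v"] by (simp add: has_field_derivative_def)
    then have "(\<phi> has_derivative (\<lambda>h. \<phi>' (complex_of_vec2 v) * h)) (at (complex_of_vec2 v) within complex_of_vec2 ` T)"
      by (rule has_derivative_at_withinI)
    with bounded_linear_imp_has_derivative[OF bounded_linear_complex_of_vec2, of "at v within T"]
    have "((\<phi> \<circ> complex_of_vec2) has_derivative ((\<lambda>h. \<phi>' (complex_of_vec2 v) * h) \<circ> complex_of_vec2)) (at v within T)"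
      by (rule diff_chain_within)
    from bounded_linear.has_derivative[OF bounded_linear_vec2_of_complex this]
    show ?thesis by (simp add: F_def F'_def o_def)
  qed
  have injF: "inj_on F T"
  proof (rule inj_onI)
    fix v w assume vw: "v \<in> T" "w \<in> T" "F v = F w"
    then have "\<phi> (complex_of_vec2 v) = \<phi> (complex_of_vec2 w)"
      unfolding F_def by (metis complex_vec2_inverse(1))
    moreover have "complex_of_vec2 v \<in> S" "complex_of_vec2 w \<in> S"
      using vw by (auto simp: T_def)
    ultimately have "complex_of_vec2 v = complex_of_vec2 w"
      using inj by (auto dest: inj_onD)
    then show "v = w" by (metis complex_vec2_inverse(2))
  qed
  have "F ` T \<in> lmeasurable"
    using FT_sets em fin by (auto simp: fmeasurable_def)
  then have "((\<lambda>v. \<bar>det (matrix (F' v))\<bar>) has_integral measure lebesgue (F ` T)) T"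
    using has_measure_differentiable_image[of T F F' "measure lebesgue (F ` T)"] T_sets derF injF
    by (auto simp: sets_completionI_sets)
  then have "((\<lambda>v. (cmod (\<phi>' (complex_of_vec2 v)))\<^sup>2) has_integral measure lebesgue (F ` T)) T"
    by (simp add: F'_def abs_det_complex_mult)
  from nn_integral_has_integral_lebesgue[OF _ this]
  have "(\<integral>\<^sup>+ v. ennreal (indicator T v * (cmod (\<phi>' (complex_of_vec2 v)))\<^sup>2) \<partial>lborel) = ennreal (measure lebesgue (F ` T))"
    by simp
  moreover have "ennreal (measure lebesgue (F ` T)) = emeasure lborel (F ` T)"
  proof -
    have "emeasure lborel (F ` T) \<noteq> top" using em fin by simp
    then show ?thesis using FT_sets by (simp add: emeasure_eq_ennreal_measure)
  qed
  moreover have "(\<integral>\<^sup>+ z. indicator S z * ennreal ((cmod (\<phi>' z))\<^sup>2) \<partial>lborel)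
     = (\<integral>\<^sup>+ v. ennreal (indicator T v * (cmod (\<phi>' (complex_of_vec2 v)))\<^sup>2) \<partial>lborel)"
  proof -
    have "(\<integral>\<^sup>+ z. indicator S z * ennreal ((cmod (\<phi>' z))\<^sup>2) \<partial>lborel)
      = (\<integral>\<^sup>+ z. ennreal (indicator S z * (cmod (\<phi>' z))\<^sup>2) \<partial>lborel)"
      by (intro nn_integral_cong) (auto simp: indicator_def)
    also have "\<dots> = (\<integral>\<^sup>+ v. ennreal (indicator S (complex_of_vec2 v) * (cmod (\<phi>' (complex_of_vec2 v)))\<^sup>2) \<partial>lborel)"
      by (rule nn_integral_complex_vec2) (use phi'_meas in measurable)
    also have "(\<lambda>v. indicator S (complex_of_vec2 v) :: real) = indicator T"
      by (auto simp: fun_eq_iff T_def vec2_of_complex_image indicator_def)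
    finally show ?thesis by (simp add: fun_eq_iff)
  qed
  ultimately show ?thesis using em by simp
qed

subsection \<open>Line integrals and upper gradients\<close>

definition chord_sum :: "(real \<Rightarrow> complex) \<Rightarrow> real list \<Rightarrow> real" where
  "chord_sum \<gamma> ts = (\<Sum>i<length ts - 1. dist (\<gamma> (ts ! i)) (\<gamma> (ts ! Suc i)))"

lemma curve_length_chord_sum:
  "curve_length \<gamma> u v = (SUP ts \<in> {ts. sorted ts \<and> set ts \<subseteq> {u..v}}. ennreal (chord_sum \<gamma> ts))"
  by (simp add: curve_length_def chord_sum_def)

lemma chord_sum_snoc:
  assumes "ts \<noteq> []"
  shows "chord_sum \<gamma> (ts @ [x]) = chord_sum \<gamma> ts + dist (\<gamma> (last ts)) (\<gamma> x)"
proof -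
  obtain n where n: "length ts = Suc n" using assms by (cases ts) auto
  have "chord_sum \<gamma> (ts @ [x]) = (\<Sum>i<Suc n. dist (\<gamma> ((ts @ [x]) ! i)) (\<gamma> ((ts @ [x]) ! Suc i)))"
    by (simp add: chord_sum_def n)
  also have "\<dots> = (\<Sum>i<n. dist (\<gamma> (ts ! i)) (\<gamma> (ts ! Suc i))) + dist (\<gamma> (ts ! n)) (\<gamma> x)"
    by (simp add: n nth_append)
  finally show ?thesis using assms n by (simp add: chord_sum_def last_conv_nth)
qed

lemma chord_sum_nonneg: "0 \<le> chord_sum \<gamma> ts"
  by (simp add: chord_sum_def sum_nonneg)

lemma chord_sum_le_curve_length:
  "sorted ts \<Longrightarrow> set ts \<subseteq> {u..v} \<Longrightarrow> ennreal (chord_sum \<gamma> ts) \<le> curve_length \<gamma> u v"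
  unfolding curve_length_chord_sum by (rule SUP_upper) auto

lemma curve_length_mono:
  "v \<le> v' \<Longrightarrow> curve_length \<gamma> u v \<le> curve_length \<gamma> u v'"
  unfolding curve_length_chord_sum by (rule SUP_subset_mono) auto

text \<open>Append \<open>s\<close> and then \<open>t\<close> to a partition of
  \<open>{u..s}\<close>: inserting \<open>s\<close> does not shorten the polygon, and the new last
  chord is the one from \<open>s\<close> to \<open>t\<close>.\<close>

lemma curve_length_add_dist:
  assumes "u \<le> s" "s \<le> t"
  shows "curve_length \<gamma> u s + ennreal (dist (\<gamma> s) (\<gamma> t)) \<le> curve_length \<gamma> u t"
proof -
  have "ennreal (chord_sum \<gamma> ts) + ennreal (dist (\<gamma> s) (\<gamma> t)) \<le> curve_length \<gamma> u t"
    if ts: "sorted ts" "set ts \<subseteq> {u..s}" for ts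
  proof -
    have "chord_sum \<gamma> ts \<le> chord_sum \<gamma> (ts @ [s])"
    proof (cases "ts = []")
      case True then show ?thesis by (simp add: chord_sum_def)
    qed (simp add: chord_sum_snoc)
    moreover have "chord_sum \<gamma> ((ts @ [s]) @ [t]) = chord_sum \<gamma> (ts @ [s]) + dist (\<gamma> s) (\<gamma> t)"
      by (subst chord_sum_snoc) auto
    ultimately have "ennreal (chord_sum \<gamma> ts) + ennreal (dist (\<gamma> s) (\<gamma> t)) \<le> ennreal (chord_sum \<gamma> ((ts @ [s]) @ [t]))"
      by (simp add: chord_sum_nonneg flip: ennreal_plus)
    also have "\<dots> \<le> curve_length \<gamma> u t"
      using ts assms by (intro chord_sum_le_curve_length) (auto simp: sorted_append)
    finally show ?thesis .
  qed
  then have "(SUP ts \<in> {ts. sorted ts \<and> set ts \<subseteq> {u..s}}. ennreal (chord_sum \<gamma> ts) + ennreal (dist (\<gamma> s) (\<gamma> t)))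
      \<le> curve_length \<gamma> u t"
    by (intro SUP_least) auto
  moreover have "{ts. sorted ts \<and> set ts \<subseteq> {u..s}} \<noteq> {}"
    by (auto intro: exI[of _ "[]"])
  ultimately show ?thesis
    unfolding curve_length_chord_sum[of \<gamma> u s] by (subst (asm) ennreal_SUP_add_left) auto
qed

text \<open>The increments of \<open>h\<close> dominate the chords, so each chord sum
  telescopes.\<close>

lemma curve_length_le:
  assumes "u \<le> v" and h: "\<And>s t. u \<le> s \<Longrightarrow> s \<le> t \<Longrightarrow> t \<le> v \<Longrightarrow> dist (\<gamma> s) (\<gamma> t) \<le> h t - h s"
  shows "curve_length \<gamma> u v \<le> ennreal (h v - h u)"
proof -
  have mono: "h s \<le> h t" if "u \<le> s" "s \<le> t" "t \<le> v" for s t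
    using h[OF that] zero_le_dist[of "\<gamma> s" "\<gamma> t"] by linarith
  have *: "ts \<noteq> [] \<longrightarrow> chord_sum \<gamma> ts \<le> h (last ts) - h u" if "sorted ts" "set ts \<subseteq> {u..v}" for ts
    using that
  proof (induction ts rule: rev_induct)
    case (snoc x ts)
    show ?case
    proof (cases "ts = []")
      case True
      then show ?thesis using snoc.prems mono[of u x] by (auto simp: chord_sum_def)
    next
      case False
      then have "last ts \<in> set ts" by simp
      then have "u \<le> last ts" "last ts \<le> x" "x \<le> v"
        using snoc.prems by (auto simp: sorted_append)
      from h[OF this] show ?thesis
        using snoc False by (auto simp: chord_sum_snoc sorted_append)
    qed
  qed simp
  show ?thesis
    unfolding curve_length_chord_sum
  proof (intro SUP_least ennreal_leI)
    fix ts assume ts: "ts \<in> {ts. sorted ts \<and> set ts \<subseteq> {u..v}}"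
    show "chord_sum \<gamma> ts \<le> h v - h u"
    proof (cases "ts = []")
      case True
      then show ?thesis using mono[of u v] assms(1) by (simp add: chord_sum_def)
    next
      case False
      then have "last ts \<in> {u..v}" using ts last_in_set by blast
      then have "h (last ts) \<le> h v" by (intro mono) auto
      then show ?thesis using *[of ts] ts False by auto
    qed
  qed
qed

lemma curve_length_lipschitz_le:
  assumes "0 \<le> C" "\<And>s t. u \<le> s \<Longrightarrow> s \<le> t \<Longrightarrow> t \<le> v \<Longrightarrow> dist (\<gamma>' s) (\<gamma>' t) \<le> C * dist (\<gamma> s) (\<gamma> t)"
  shows "curve_length \<gamma>' u v \<le> ennreal C * curve_length \<gamma> u v"
  unfolding curve_length_chord_sum[of \<gamma>']
proof (rule SUP_least)
  fix ts assume ts: "ts \<in> {ts. sorted ts \<and> set ts \<subseteq> {u..v}}"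
  have "chord_sum \<gamma>' ts \<le> C * chord_sum \<gamma> ts"
    unfolding chord_sum_def sum_distrib_left
  proof (rule sum_mono)
    fix i assume "i \<in> {..<length ts - 1}"
    then have i: "Suc i < length ts" by auto
    then have "ts ! i \<le> ts ! Suc i" using ts by (auto intro: sorted_nth_mono)
    moreover have "ts ! i \<in> set ts" "ts ! Suc i \<in> set ts" using i by auto
    then have "ts ! i \<in> {u..v}" "ts ! Suc i \<in> {u..v}" using ts by blast+
    ultimately show "dist (\<gamma>' (ts ! i)) (\<gamma>' (ts ! Suc i)) \<le> C * dist (\<gamma> (ts ! i)) (\<gamma> (ts ! Suc i))"
      by (intro assms) auto
  qed
  then have "ennreal (chord_sum \<gamma>' ts) \<le> ennreal C * ennreal (chord_sum \<gamma> ts)"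
    using assms(1) by (simp add: ennreal_leI flip: ennreal_mult')
  also have "\<dots> \<le> ennreal C * curve_length \<gamma> u v"
    using ts by (intro mult_left_mono chord_sum_le_curve_length) auto
  finally show "ennreal (chord_sum \<gamma>' ts) \<le> ennreal C * curve_length \<gamma> u v" .
qed

text \<open>Inequalities for arc times hold only strictly between the end points; continuity of the
  curve carries the resulting bound to the closed interval.\<close>

lemma dist_endpoints_le:
  fixes \<gamma> :: "real \<Rightarrow> complex"
  assumes cont: "continuous_on {a..b} \<gamma>" and "a < b"
    and le: "\<And>s t. a < s \<Longrightarrow> s < t \<Longrightarrow> t < b \<Longrightarrow> dist (\<gamma> s) (\<gamma> t) \<le> K"
  shows "dist (\<gamma> a) (\<gamma> b) \<le> K"
proof -
  \<comment> \<open>The 3 in the denominator keeps \<open>s n < t n\<close> already for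
    \<open>n = 0\<close>.\<close>
  define r where "r n = (b - a) / (3 + real n)" for n
  define s where "s n = a + r n" for n
  define t where "t n = b - r n" for n
  have r: "0 < r n" "2 * r n < b - a" for n
  proof -
    show "0 < r n" using \<open>a < b\<close> by (simp add: r_def)
    have "r n \<le> (b - a) / 3"
      unfolding r_def using \<open>a < b\<close> by (intro divide_left_mono) auto
    then show "2 * r n < b - a" using \<open>a < b\<close> by simp
  qed
  have "r \<longlonglongrightarrow> 0" unfolding r_def by real_asymp
  then have lim: "s \<longlonglongrightarrow> a" "t \<longlonglongrightarrow> b"
    unfolding s_def t_def using tendsto_add[OF tendsto_const, of r 0 _ a] tendsto_diff[OF tendsto_const, of r 0 _ b] by auto
  have st: "a < s n" "s n < t n" "t n < b" for n
    using r[of n] by (auto simp: s_def t_def)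
  then have "s n \<in> {a..b}" "t n \<in> {a..b}" for n
    by (meson atLeastAtMost_iff less_imp_le less_trans)+
  with lim have "(\<lambda>n. dist (\<gamma> (s n)) (\<gamma> (t n))) \<longlonglongrightarrow> dist (\<gamma> a) (\<gamma> b)"
    using \<open>a < b\<close> by (intro tendsto_dist continuous_on_tendsto_compose[OF cont]) auto
  then show ?thesis
    by (rule LIMSEQ_le_const2) (use le st in blast)
qed

section \<open>Parametrization by arc length\<close>

context
  fixes \<gamma> :: "real \<Rightarrow> complex" and u v :: real
  assumes cont: "continuous_on {u..v} \<gamma>" and uv: "u < v" and fin: "curve_length \<gamma> u v < \<infinity>"
begin

lemma dist_le_diff_curve_length:
  assumes "u \<le> s" "s \<le> t" "t \<le> v"
  shows "dist (\<gamma> s) (\<gamma> t) \<le> enn2real (curve_length \<gamma> u t) - enn2real (curve_length \<gamma> u s)"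
proof -
  have f: "curve_length \<gamma> u t < \<infinity>"  "curve_length \<gamma> u s < \<infinity>"
    using fin curve_length_mono[of t v \<gamma> u] curve_length_mono[of s v \<gamma> u] assms by (auto simp: le_less_trans)
  then have "curve_length \<gamma> u s + ennreal (dist (\<gamma> s) (\<gamma> t)) \<le> curve_length \<gamma> u t"
    using curve_length_add_dist assms by blast
  with f show ?thesis
    by (cases "curve_length \<gamma> u s"; cases "curve_length \<gamma> u t") (auto simp flip: ennreal_plus)
qed

definition arc_time :: "real \<Rightarrow> real" where
  "arc_time s = Inf {t \<in> {u..v}. ennreal s \<le> curve_length \<gamma> u t}"

lemma arc_length_param_eq: "arc_length_param \<gamma> u v s = \<gamma> (arc_time s)"
  by (simp add: arc_length_param_def arc_time_def)

text \<open>The length at the infimum itself is left open, so the information is one-sided: below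
  \<open>s\<close> strictly before \<open>arc_time s\<close>, at least \<open>s\<close> strictly
  after it.\<close>

lemma arc_time_props:
  assumes "s \<le> enn2real (curve_length \<gamma> u v)"
  shows "u \<le> arc_time s" "arc_time s \<le> v"
    and "\<And>t. u \<le> t \<Longrightarrow> t < arc_time s \<Longrightarrow> enn2real (curve_length \<gamma> u t) < s"
    and "\<And>t. arc_time s < t \<Longrightarrow> t \<le> v \<Longrightarrow> s \<le> enn2real (curve_length \<gamma> u t)"
proof -
  let ?A = "{t \<in> {u..v}. ennreal s \<le> curve_length \<gamma> u t}"
  have fin': "curve_length \<gamma> u t < \<infinity>" if "t \<le> v" for t
    using fin curve_length_mono[OF that, of \<gamma> u] by (simp add: le_less_trans)
  have v: "v \<in> ?A"
    using uv assms fin by (cases "curve_length \<gamma> u v") (auto simp: ennreal_leI)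
  have bdd: "bdd_below ?A" by (rule bdd_belowI[of _ u]) simp
  have "?A \<noteq> {}" using v by blast
  then have "u \<le> Inf ?A" by (rule cInf_greatest) simp
  moreover have "Inf ?A \<le> v" by (rule cInf_lower[OF v bdd])
  ultimately show 1: "u \<le> arc_time s" "arc_time s \<le> v"
    by (simp_all add: arc_time_def)
  show "enn2real (curve_length \<gamma> u t) < s" if "u \<le> t" "t < arc_time s" for t
  proof (rule ccontr)
    assume "\<not> ?thesis"
    then have "t \<in> ?A"
      using that 1 fin'[of t] by (cases "curve_length \<gamma> u t") (auto simp: ennreal_leI)
    then have "arc_time s \<le> t"
      unfolding arc_time_def by (rule cInf_lower[OF _ bdd])
    then show False using that by simp
  qed
  show "s \<le> enn2real (curve_length \<gamma> u t)" if "arc_time s < t" "t \<le> v" for t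
  proof -
    have "Inf ?A < t" using that by (simp add: arc_time_def)
    from cInf_lessD[OF \<open>?A \<noteq> {}\<close> this] obtain t' where t': "t' \<in> ?A" "t' < t" by blast
    then have "ennreal s \<le> curve_length \<gamma> u t'" "curve_length \<gamma> u t' \<le> curve_length \<gamma> u t"
      by (auto intro: curve_length_mono)
    then have "ennreal s \<le> curve_length \<gamma> u t" by (rule order_trans)
    then show ?thesis
      using fin'[OF that(2)] by (cases "curve_length \<gamma> u t") (auto simp: ennreal_le_iff2)
  qed
qed

text \<open>Strictly between the two arc times the length function stays between \<open>s1\<close>
  and \<open>s2\<close>, which bounds the chords of interior points; continuity gives the end
  points.\<close>

lemma arc_length_param_lipschitz:
  assumes "s1 \<le> s2" "s2 \<le> enn2real (curve_length \<gamma> u v)"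
  shows "dist (arc_length_param \<gamma> u v s1) (arc_length_param \<gamma> u v s2) \<le> s2 - s1"
proof -
  have s1: "s1 \<le> enn2real (curve_length \<gamma> u v)" using assms by simp
  note p1 = arc_time_props[OF s1] and p2 = arc_time_props[OF assms(2)]
  consider "arc_time s1 = arc_time s2" | "arc_time s1 < arc_time s2" | "arc_time s2 < arc_time s1"
    by linarith
  then show ?thesis
  proof cases
    case 1
    then show ?thesis using assms by (simp add: arc_length_param_eq)
  next
    case 2
    show ?thesis
      unfolding arc_length_param_eq
    proof (rule dist_endpoints_le[OF _ 2])
      show "continuous_on {arc_time s1..arc_time s2} \<gamma>"
        using p1 p2 by (intro continuous_on_subset[OF cont]) auto
      fix a b assume ab: "arc_time s1 < a" "a < b" "b < arc_time s2"
      have "dist (\<gamma> a) (\<gamma> b) \<le> enn2real (curve_length \<gamma> u b) - enn2real (curve_length \<gamma> u a)"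
        using ab p1 p2 by (intro dist_le_diff_curve_length) auto
      moreover have "s1 \<le> enn2real (curve_length \<gamma> u a)" using ab p1(4)[of a] p2 by auto
      moreover have "enn2real (curve_length \<gamma> u b) < s2" using ab p2(3)[of b] p1 by auto
      ultimately show "dist (\<gamma> a) (\<gamma> b) \<le> s2 - s1" by linarith
    qed
  next
    case 3
    \<comment> \<open>Impossible order of the arc times: at the midpoint the length would be below
      \<open>s1\<close> and at least \<open>s2\<close>.\<close>
    define t where "t = (arc_time s1 + arc_time s2) / 2"
    have "enn2real (curve_length \<gamma> u t) < s1" using 3 p1(3)[of t] p2 by (auto simp: t_def)
    moreover have "s2 \<le> enn2real (curve_length \<gamma> u t)" using 3 p2(4)[of t] p1 by (auto simp: t_def)
    ultimately show ?thesis using assms by linarith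
  qed
qed

lemma arc_length_param_continuous:
  "continuous_on {0..enn2real (curve_length \<gamma> u v)} (arc_length_param \<gamma> u v)"
proof (rule continuous_onI)
  fix x e :: real assume x: "x \<in> {0..enn2real (curve_length \<gamma> u v)}" "0 < e"
  have "dist (arc_length_param \<gamma> u v x') (arc_length_param \<gamma> u v x) \<le> e"
    if "x' \<in> {0..enn2real (curve_length \<gamma> u v)}" "dist x' x < e" for x'
    using arc_length_param_lipschitz[of x x'] arc_length_param_lipschitz[of x' x] that x
    by (cases "x \<le> x'") (auto simp: dist_commute dist_real_def)
  then show "\<exists>d>0. \<forall>x'\<in>{0..enn2real (curve_length \<gamma> u v)}. dist x' x < d \<longrightarrow>
      dist (arc_length_param \<gamma> u v x') (arc_length_param \<gamma> u v x) \<le> e"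
    using x by blast
qed

lemma arc_length_param_0: "arc_length_param \<gamma> u v 0 = \<gamma> u"
proof -
  have "arc_time 0 = u"
    unfolding arc_time_def using uv by (intro cInf_eq_minimum) auto
  then show ?thesis by (simp add: arc_length_param_eq)
qed

text \<open>The full length may be reached before \<open>v\<close>. Then no length is left, and the
  curve is constant from there on.\<close>

lemma arc_length_param_end: "arc_length_param \<gamma> u v (enn2real (curve_length \<gamma> u v)) = \<gamma> v"
proof -
  let ?L = "enn2real (curve_length \<gamma> u v)"
  note p = arc_time_props[OF order_refl]
  show ?thesis
  proof (cases "arc_time ?L = v")
    case False
    then have lt: "arc_time ?L < v" using p by simp
    have "dist (\<gamma> (arc_time ?L)) (\<gamma> v) \<le> 0"
    proof (rule dist_endpoints_le[OF _ lt])
      show "continuous_on {arc_time ?L..v} \<gamma>"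
        using p by (intro continuous_on_subset[OF cont]) auto
      fix a b assume ab: "arc_time ?L < a" "a < b" "b < v"
      have "dist (\<gamma> a) (\<gamma> b) \<le> enn2real (curve_length \<gamma> u b) - enn2real (curve_length \<gamma> u a)"
        using ab p by (intro dist_le_diff_curve_length) auto
      moreover have "?L \<le> enn2real (curve_length \<gamma> u a)" using ab p by auto
      moreover have "enn2real (curve_length \<gamma> u b) \<le> ?L"
        using ab fin by (intro enn2real_mono curve_length_mono) auto
      ultimately show "dist (\<gamma> a) (\<gamma> b) \<le> 0" by linarith
    qed
    then show ?thesis by (simp add: arc_length_param_eq)
  qed (simp add: arc_length_param_eq)
qed

lemma arc_length_param_in:
  "s \<le> enn2real (curve_length \<gamma> u v) \<Longrightarrow> arc_length_param \<gamma> u v s \<in> \<gamma> ` {u..v}"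
  using arc_time_props(1,2)[of s] by (auto simp: arc_length_param_eq)

end

text \<open>The path \<sigma> is merely 1-Lipschitz, so its composition with \<open>w\<close> may
  fail to be differentiable. The bound with an additional error \<open>e * (b - a)\<close> is
  additive over adjacent intervals and holds on short intervals by differentiability of
  \<open>w\<close>; bisection extends it to \<open>{0..L}\<close>.\<close>

lemma upper_gradient_lipschitz:
  fixes \<sigma> :: "real \<Rightarrow> complex" and w :: "complex \<Rightarrow> real" and g :: "complex \<Rightarrow> complex"
  assumes L: "0 \<le> L"
    and lip: "\<And>s t. 0 \<le> s \<Longrightarrow> s \<le> t \<Longrightarrow> t \<le> L \<Longrightarrow> dist (\<sigma> s) (\<sigma> t) \<le> t - s"
    and contg: "continuous_on {0..L} (\<lambda>s. g (\<sigma> s))"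
    and der: "\<And>s. s \<in> {0..L} \<Longrightarrow> (w has_derivative (\<lambda>h. g (\<sigma> s) \<bullet> h)) (at (\<sigma> s))"
  shows "ennreal \<bar>w (\<sigma> L) - w (\<sigma> 0)\<bar> \<le> (\<integral>\<^sup>+ s \<in> {0..L}. ennreal (norm (g (\<sigma> s))) \<partial>lborel)"
proof -
  define h where "h s = norm (g (\<sigma> s))" for s
  have conth: "continuous_on {0..L} h"
    unfolding h_def by (intro continuous_intros contg)
  have int: "h integrable_on {a..b}" if "0 \<le> a" "b \<le> L" for a b
    using that by (intro integrable_continuous_real continuous_on_subset[OF conth]) auto
  have main: "\<bar>w (\<sigma> L) - w (\<sigma> 0)\<bar> \<le> integral {0..L} h + e * L" if e: "e > 0" for e
  proof -
    define P where "P a b \<longleftrightarrow> (0 \<le> a \<longrightarrow> a \<le> b \<longrightarrow> b \<le> L \<longrightarrow>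
        \<bar>w (\<sigma> b) - w (\<sigma> a)\<bar> \<le> integral {a..b} h + e * (b - a))" for a b
    have "P 0 L"
      using L
    proof (induction rule: Bolzano)
      case (trans a b c)
      show ?case
        unfolding P_def
      proof (intro impI)
        assume *: "0 \<le> a" "a \<le> c" "c \<le> L"
        have "integral {a..b} h + integral {b..c} h = integral {a..c} h"
          using trans * by (intro Henstock_Kurzweil_Integration.integral_combine int) auto
        then show "\<bar>w (\<sigma> c) - w (\<sigma> a)\<bar> \<le> integral {a..c} h + e * (c - a)"
          using trans * unfolding P_def by (auto simp: algebra_simps)
      qed
    next
      case (local x)
      then have x: "x \<in> {0..L}" by auto
      obtain d1 where d1: "d1 > 0" "\<And>y. norm (y - \<sigma> x) < d1 \<Longrightarrow>
           norm (w y - w (\<sigma> x) - g (\<sigma> x) \<bullet> (y - \<sigma> x)) \<le> (e/2) * norm (y - \<sigma> x)"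
        using der[OF x] e unfolding has_derivative_at_alt by (meson half_gt_zero)
      obtain d2 where d2: "d2 > 0" "\<And>y. y \<in> {0..L} \<Longrightarrow> dist y x < d2 \<Longrightarrow> dist (h y) (h x) < e/2"
        using conth x e unfolding continuous_on_iff by (meson half_gt_zero)
      have est: "\<bar>w (\<sigma> s) - w (\<sigma> x)\<bar> \<le> (h x + e/2) * \<bar>s - x\<bar>"
        if "s \<in> {0..L}" "\<bar>s - x\<bar> < d1" for s
      proof -
        have n: "norm (\<sigma> s - \<sigma> x) \<le> \<bar>s - x\<bar>"
          using lip[of s x] lip[of x s] that x by (cases "s \<le> x") (auto simp: dist_norm norm_minus_commute)
        have "norm (w (\<sigma> s) - w (\<sigma> x) - g (\<sigma> x) \<bullet> (\<sigma> s - \<sigma> x)) \<le> (e/2) * norm (\<sigma> s - \<sigma> x)"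
          using n that by (intro d1) auto
        moreover have "\<bar>g (\<sigma> x) \<bullet> (\<sigma> s - \<sigma> x)\<bar> \<le> h x * norm (\<sigma> s - \<sigma> x)"
          unfolding h_def by (rule Cauchy_Schwarz_ineq2)
        ultimately have "\<bar>w (\<sigma> s) - w (\<sigma> x)\<bar> \<le> h x * norm (\<sigma> s - \<sigma> x) + (e/2) * norm (\<sigma> s - \<sigma> x)"
          unfolding real_norm_def by linarith
        then have "\<bar>w (\<sigma> s) - w (\<sigma> x)\<bar> \<le> (h x + e/2) * norm (\<sigma> s - \<sigma> x)"
          by (simp only: distrib_right)
        also have "\<dots> \<le> (h x + e/2) * \<bar>s - x\<bar>"
          using n e by (intro mult_left_mono) (auto simp: h_def)
        finally show ?thesis .
      qed
      show ?case
      proof (intro exI[of _ "min d1 d2"] conjI allI impI)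
        fix a b assume ab: "a \<le> x \<and> x \<le> b \<and> b - a < min d1 d2"
        show "P a b"
          unfolding P_def
        proof (intro impI)
          assume *: "0 \<le> a" "a \<le> b" "b \<le> L"
          have "\<bar>w (\<sigma> b) - w (\<sigma> a)\<bar> \<le> \<bar>w (\<sigma> b) - w (\<sigma> x)\<bar> + \<bar>w (\<sigma> a) - w (\<sigma> x)\<bar>" by linarith
          also have "\<dots> \<le> (h x + e/2) * \<bar>b - x\<bar> + (h x + e/2) * \<bar>a - x\<bar>"
            using ab * by (intro add_mono est) auto
          also have "\<dots> = (h x + e/2) * (b - a)"
          proof -
            have "\<bar>b - x\<bar> = b - x" "\<bar>a - x\<bar> = x - a" using ab by auto
            then show ?thesis by (simp only: distrib_left[symmetric]) simp
          qed
          \<comment> \<open>The error \<open>e\<close> is split evenly: one half pays for the linear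
            approximation of \<open>w\<close>, the other for replacing \<open>h x\<close> by nearby
            values of \<open>h\<close>.\<close>
          also have "\<dots> = (h x - e/2) * (b - a) + e * (b - a)" by (simp add: field_simps)
          also have "(h x - e/2) * (b - a) = integral {a..b} (\<lambda>_. h x - e/2)" using * by simp
          also have "\<dots> \<le> integral {a..b} h"
          proof (rule integral_le)
            fix y assume "y \<in> {a..b}"
            then have "dist (h y) (h x) < e/2" using ab * by (intro d2) (auto simp: dist_real_def)
            then show "h x - e/2 \<le> h y" unfolding dist_real_def by linarith
          qed (use int * in auto)
          finally show "\<bar>w (\<sigma> b) - w (\<sigma> a)\<bar> \<le> integral {a..b} h + e * (b - a)" by simp
        qed
      qed (use d1 d2 in auto)
    qed
    then show ?thesis using L by (simp add: P_def)
  qed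
  have "\<bar>w (\<sigma> L) - w (\<sigma> 0)\<bar> \<le> integral {0..L} h"
  proof (rule field_le_epsilon)
    fix e :: real assume "e > 0"
    \<comment> \<open>The error in \<open>main\<close> is proportional to \<open>L\<close>; dividing
      by \<open>L + 1\<close> also covers \<open>L = 0\<close>.\<close>
    moreover have "e / (L + 1) * L \<le> e" using L \<open>e > 0\<close> by (simp add: field_simps)
    ultimately show "\<bar>w (\<sigma> L) - w (\<sigma> 0)\<bar> \<le> integral {0..L} h + e"
      using main[of "e / (L + 1)"] L by fastforce
  qed
  moreover have "(\<integral>\<^sup>+ s \<in> {0..L}. ennreal (h s) \<partial>lborel) = ennreal (integral {0..L} h)"
  proof -
    have "(h has_integral integral {0..L} h) {0..L}" using int[of 0 L] by auto
    from nn_integral_has_integral_lebesgue[OF _ this]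
    have "ennreal (integral {0..L} h) = (\<integral>\<^sup>+ s. ennreal (indicator {0..L} s * h s) \<partial>lborel)"
      by (simp add: h_def)
    also have "(\<integral>\<^sup>+ s. ennreal (indicator {0..L} s * h s) \<partial>lborel) = (\<integral>\<^sup>+ s \<in> {0..L}. ennreal (h s) \<partial>lborel)"
      by (intro nn_integral_cong) (simp add: indicator_def)
    finally show ?thesis by (rule sym)
  qed
  ultimately show ?thesis by (simp add: h_def ennreal_leI)
qed

text \<open>The line integral is a supremum over compact parameter intervals; on
  \<open>[u,v]\<close> the gradient estimate applies to the arc length parametrization, whose ends
  are the points at \<open>u\<close> and \<open>v\<close>.\<close>

lemma line_integral_ge_diff:
  assumes rect: "locally_rectifiable \<gamma>" and im: "\<gamma> ` {0<..<1} \<subseteq> D"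
    and der: "\<And>z. z \<in> D \<Longrightarrow> (w has_derivative (\<lambda>h. g z \<bullet> h)) (at z)"
    and contg: "continuous_on D g"
    and \<rho>: "\<And>z. z \<in> D \<Longrightarrow> ennreal (norm (g z)) \<le> \<rho> z"
    and uv: "0 < u" "u < v" "v < 1"
  shows "ennreal \<bar>w (\<gamma> v) - w (\<gamma> u)\<bar> \<le> line_integral \<rho> \<gamma>"
proof -
  have cont: "continuous_on {u..v} \<gamma>"
    using rect uv unfolding locally_rectifiable_def by (auto intro: continuous_on_subset)
  have fin: "curve_length \<gamma> u v < \<infinity>"
    using rect uv unfolding locally_rectifiable_def by auto
  define L where "L = enn2real (curve_length \<gamma> u v)"
  define \<sigma> where "\<sigma> = arc_length_param \<gamma> u v"
  have inD: "\<sigma> s \<in> D" if "s \<in> {0..L}" for s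
    using arc_length_param_in[OF cont uv(2) fin, of s] that im uv unfolding \<sigma>_def L_def by force
  have cs: "continuous_on {0..L} \<sigma>"
    unfolding \<sigma>_def L_def by (rule arc_length_param_continuous[OF cont uv(2) fin])
  have "ennreal \<bar>w (\<sigma> L) - w (\<sigma> 0)\<bar> \<le> (\<integral>\<^sup>+ s \<in> {0..L}. ennreal (norm (g (\<sigma> s))) \<partial>lborel)"
  proof (rule upper_gradient_lipschitz)
    show "0 \<le> L" by (simp add: L_def)
    show "dist (\<sigma> s) (\<sigma> t) \<le> t - s" if "0 \<le> s" "s \<le> t" "t \<le> L" for s t
      using arc_length_param_lipschitz[OF cont uv(2) fin, of s t] that unfolding \<sigma>_def L_def by simp
    show "continuous_on {0..L} (\<lambda>s. g (\<sigma> s))"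
      by (rule continuous_on_compose2[OF contg cs]) (use inD in auto)
  qed (use inD der in auto)
  also have "\<dots> \<le> (\<integral>\<^sup>+ s \<in> {0..L}. \<rho> (\<sigma> s) \<partial>lborel)"
    by (intro nn_integral_mono) (auto simp: indicator_def intro!: \<rho> inD)
  also have "\<dots> \<le> line_integral \<rho> \<gamma>"
    unfolding line_integral_def \<sigma>_def L_def
    by (rule SUP_upper2[where i="(u, v)"]) (use uv in auto)
  finally show ?thesis
    using arc_length_param_0[OF cont uv(2) fin] arc_length_param_end[OF cont uv(2) fin]
    by (simp add: \<sigma>_def L_def)
qed

section \<open>Vertical scaling of curves and densities\<close>

lemma vertical_scaling_simps [simp]:
  "Re (vertical_scaling e z) = Re z" "Im (vertical_scaling e z) = e * Im z"
  by (simp_all add: vertical_scaling_def)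

lemma vertical_scaling_inverse:
  "e \<noteq> 0 \<Longrightarrow> vertical_scaling (1 / e) (vertical_scaling e z) = z"
  "e \<noteq> 0 \<Longrightarrow> vertical_scaling e (vertical_scaling (1 / e) z) = z"
  by (simp_all add: complex_eq_iff)

lemma bounded_linear_vertical_scaling: "bounded_linear (vertical_scaling e)"
  by (rule linear_conv_bounded_linear[THEN iffD1])
     (auto intro!: linearI simp: complex_eq_iff algebra_simps)

lemma borel_measurable_vertical_scaling [measurable]: "vertical_scaling e \<in> borel_measurable borel"
  by (intro borel_measurable_continuous_onI linear_continuous_on bounded_linear_vertical_scaling)

lemma nn_integral_vertical_scaling:
  assumes [measurable]: "h \<in> borel_measurable borel" and e: "0 < e"
  shows "(\<integral>\<^sup>+ z. h z \<partial>lborel) = ennreal e * (\<integral>\<^sup>+ z. h (vertical_scaling e z) \<partial>lborel)"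
proof -
  have "(\<integral>\<^sup>+ z. h z \<partial>lborel) = (\<integral>\<^sup>+ x. \<integral>\<^sup>+ y. h (Complex x y) \<partial>lborel \<partial>lborel)"
    by (rule nn_integral_complex_iterated) measurable
  also have "\<dots> = (\<integral>\<^sup>+ x. ennreal e * (\<integral>\<^sup>+ y. h (Complex x (e * y)) \<partial>lborel) \<partial>lborel)"
  proof (rule nn_integral_cong)
    fix x :: real
    show "(\<integral>\<^sup>+ y. h (Complex x y) \<partial>lborel) = ennreal e * (\<integral>\<^sup>+ y. h (Complex x (e * y)) \<partial>lborel)"
      using e by (subst nn_integral_real_affine[where c=e and t=0]) auto
  qed
  also have "\<dots> = ennreal e * (\<integral>\<^sup>+ x. \<integral>\<^sup>+ y. h (vertical_scaling e (Complex x y)) \<partial>lborel \<partial>lborel)"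
    by (subst nn_integral_cmult[symmetric]) (auto simp: vertical_scaling_def)
  also have "\<dots> = ennreal e * (\<integral>\<^sup>+ z. h (vertical_scaling e z) \<partial>lborel)"
    by (subst nn_integral_complex_iterated) auto
  finally show ?thesis .
qed

lemma dist_vertical_scaling_le:
  assumes "0 < e" "e \<le> 1"
  shows "dist (vertical_scaling e z) (vertical_scaling e w) \<le> dist z w"
proof -
  have "(e * (Im z - Im w))\<^sup>2 \<le> (Im z - Im w)\<^sup>2"
    using assms by (simp add: power_mult_distrib mult_left_le_one_le power_le_one)
  then show ?thesis
    by (simp add: dist_norm cmod_def flip: right_diff_distrib)
qed

lemma locally_rectifiable_vertical_scaling:
  assumes \<gamma>: "locally_rectifiable \<gamma>" and e: "0 < e" "e \<le> 1"
  shows "locally_rectifiable (vertical_scaling e \<circ> \<gamma>)"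
  unfolding locally_rectifiable_def
proof (intro conjI allI impI)
  show "continuous_on {0<..<1} (vertical_scaling e \<circ> \<gamma>)"
    using \<gamma> unfolding locally_rectifiable_def
    by (intro continuous_on_compose linear_continuous_on[OF bounded_linear_vertical_scaling]) auto
  fix u v :: real assume "0 < u \<and> u < v \<and> v < 1"
  then have fin: "curve_length \<gamma> u v < \<infinity>" using \<gamma> by (auto simp: locally_rectifiable_def)
  have "curve_length (vertical_scaling e \<circ> \<gamma>) u v \<le> ennreal 1 * curve_length \<gamma> u v"
    using dist_vertical_scaling_le[OF e] by (intro curve_length_lipschitz_le) auto
  with fin show "curve_length (vertical_scaling e \<circ> \<gamma>) u v < \<infinity>" by (auto intro: le_less_trans)
qed

text \<open>The function \<open>w\<close>, transplanted to the scaled domain, still changes by at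
  least 1 along each scaled curve, so the length of its gradient is admissible there. Its energy is
  then computed on \<open>D\<close>.\<close>

lemma modulus_scaled_family_le:
  assumes e: "0 < e" "e \<le> 1" and D: "open D"
    and der: "\<And>z. z \<in> D \<Longrightarrow> (w has_derivative (\<lambda>h. g z \<bullet> h)) (at z)"
    and contg: "continuous_on D g"
    and \<Gamma>: "\<And>\<gamma>. \<gamma> \<in> \<Gamma> \<Longrightarrow> locally_rectifiable \<gamma> \<and> \<gamma> ` {0<..<1} \<subseteq> D \<and>
        (\<exists>s t. 0 < s \<and> s < t \<and> t < 1 \<and> 1 \<le> \<bar>w (\<gamma> t) - w (\<gamma> s)\<bar>)"
  shows "ennreal e * modulus (scaled_family e \<Gamma>)
     \<le> ennreal (e\<^sup>2) * (\<integral>\<^sup>+ z \<in> D. ennreal ((Re (g z))\<^sup>2) \<partial>lborel) + (\<integral>\<^sup>+ z \<in> D. ennreal ((Im (g z))\<^sup>2) \<partial>lborel)"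
proof -
  define T where "T = vertical_scaling e"
  define S where "S = vertical_scaling (1 / e)"
  define D' where "D' = S -` D"
  \<comment> \<open>The chain rule for \<open>w\<close> composed with \<open>S\<close>: only the
    vertical component changes.\<close>
  define g' where "g' z = Complex (Re (g (S z))) (Im (g (S z)) / e)" for z
  define \<rho> where "\<rho> z = indicator D' z * ennreal (norm (g' z))" for z
  have ST: "S (T z) = z" "T (S z) = z" for z
    using e vertical_scaling_inverse[of e] by (auto simp: S_def T_def)
  have contS: "continuous_on A S" for A
    unfolding S_def by (intro linear_continuous_on bounded_linear_vertical_scaling)
  have openD': "open D'"
    unfolding D'_def using D contS[of UNIV] by (rule open_vimage)
  have contg': "continuous_on D' g'"
  proof -
    have "continuous_on D' (\<lambda>z. g (S z))"
      by (rule continuous_on_compose2[OF contg contS]) (auto simp: D'_def)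
    then show ?thesis unfolding g'_def Complex_eq by (intro continuous_intros) (use e in auto)
  qed
  have der': "((\<lambda>z. w (S z)) has_derivative (\<lambda>h. g' z \<bullet> h)) (at z)" if "z \<in> D'" for z
  proof -
    have "((\<lambda>z. w (S z)) has_derivative (\<lambda>h. g (S z) \<bullet> S h)) (at z)"
      using that
      by (intro has_derivative_compose[OF _ der, of S S, unfolded o_def])
         (auto simp: D'_def S_def intro: bounded_linear_imp_has_derivative bounded_linear_vertical_scaling)
    moreover have "(\<lambda>h. g (S z) \<bullet> S h) = (\<lambda>h. g' z \<bullet> h)"
      by (auto simp: fun_eq_iff inner_complex_def g'_def S_def)
    ultimately show ?thesis by simp
  qed
  have \<rho>_meas: "\<rho> \<in> borel_measurable borel"
  proof -
    have "(\<lambda>z. indicator D' z *\<^sub>R norm (g' z)) \<in> borel_measurable borel"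
      using openD' contg' by (intro borel_measurable_continuous_on_indicator continuous_intros) auto
    then have "(\<lambda>z. ennreal (indicator D' z *\<^sub>R norm (g' z))) \<in> borel_measurable borel" by measurable
    also have "(\<lambda>z. ennreal (indicator D' z *\<^sub>R norm (g' z))) = \<rho>"
      by (auto simp: \<rho>_def indicator_def fun_eq_iff)
    finally show ?thesis .
  qed
  have "\<rho> \<in> admissible (scaled_family e \<Gamma>)"
    unfolding admissible_def scaled_family_def
  proof (safe intro!: \<rho>_meas)
    fix \<gamma> assume "\<gamma> \<in> \<Gamma>"
    from \<Gamma>[OF this] obtain s t where rect: "locally_rectifiable \<gamma>" and im: "\<gamma> ` {0<..<1} \<subseteq> D"
      and st: "0 < s" "s < t" "t < 1" and diff: "1 \<le> \<bar>w (\<gamma> t) - w (\<gamma> s)\<bar>" by blast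
    have "1 \<le> ennreal \<bar>w (\<gamma> t) - w (\<gamma> s)\<bar>" using diff by (metis ennreal_1 ennreal_leI)
    also have "\<dots> = ennreal \<bar>w (S ((vertical_scaling e \<circ> \<gamma>) t)) - w (S ((vertical_scaling e \<circ> \<gamma>) s))\<bar>"
      using ST by (simp add: T_def)
    also have "\<dots> \<le> line_integral \<rho> (vertical_scaling e \<circ> \<gamma>)"
    proof (rule line_integral_ge_diff[where D=D' and g=g'])
      show "locally_rectifiable (vertical_scaling e \<circ> \<gamma>)"
        by (rule locally_rectifiable_vertical_scaling[OF rect e])
      show "(vertical_scaling e \<circ> \<gamma>) ` {0<..<1} \<subseteq> D'"
        using im ST by (auto simp: D'_def T_def)
    qed (use der' contg' st in \<open>auto simp: \<rho>_def\<close>)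
    finally show "1 \<le> line_integral \<rho> (vertical_scaling e \<circ> \<gamma>)" .
  qed
  then have "modulus (scaled_family e \<Gamma>) \<le> (\<integral>\<^sup>+ z. (\<rho> z)\<^sup>2 \<partial>lborel)"
    unfolding modulus_def by (rule INF_lower)
  then have "ennreal e * modulus (scaled_family e \<Gamma>) \<le> ennreal e * (\<integral>\<^sup>+ z. (\<rho> z)\<^sup>2 \<partial>lborel)"
    by (rule mult_left_mono) simp
  \<comment> \<open>One factor \<open>e\<close> comes from the claim, the other is the Jacobian of
    the scaling. Their product cancels the \<open>1 / e\<^sup>2\<close> of the squared vertical
    component.\<close>
  also have "\<dots> = ennreal e * (ennreal e * (\<integral>\<^sup>+ z. (\<rho> (T z))\<^sup>2 \<partial>lborel))"
    unfolding T_def by (subst nn_integral_vertical_scaling[OF _ e(1)]) (use \<rho>_meas in auto)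
  also have "\<dots> = ennreal (e\<^sup>2) * (\<integral>\<^sup>+ z. (\<rho> (T z))\<^sup>2 \<partial>lborel)"
    using e by (simp add: ennreal_mult power2_eq_square mult.assoc)
  also have "\<dots> = (\<integral>\<^sup>+ z. ennreal (e\<^sup>2) * (\<rho> (T z))\<^sup>2 \<partial>lborel)"
    unfolding T_def by (subst nn_integral_cmult) (use \<rho>_meas in auto)
  also have "\<dots> = (\<integral>\<^sup>+ z. ennreal (e\<^sup>2) * (ennreal ((Re (g z))\<^sup>2) * indicator D z) + ennreal ((Im (g z))\<^sup>2) * indicator D z \<partial>lborel)"
  proof (rule nn_integral_cong)
    fix z
    have "norm (g' (T z)) ^ 2 = (Re (g z))\<^sup>2 + (Im (g z))\<^sup>2 / e\<^sup>2"
      using ST by (simp add: g'_def cmod_power2 power_divide)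
    then have "e\<^sup>2 * norm (g' (T z)) ^ 2 = e\<^sup>2 * (Re (g z))\<^sup>2 + (Im (g z))\<^sup>2"
      using e by (simp add: field_simps)
    then have "ennreal (e\<^sup>2) * (ennreal (norm (g' (T z))))\<^sup>2 = ennreal (e\<^sup>2) * ennreal ((Re (g z))\<^sup>2) + ennreal ((Im (g z))\<^sup>2)"
      by (simp add: ennreal_power flip: ennreal_mult ennreal_plus)
    moreover have "T z \<in> D' \<longleftrightarrow> z \<in> D" using ST by (simp add: D'_def)
    ultimately show "ennreal (e\<^sup>2) * (\<rho> (T z))\<^sup>2 = ennreal (e\<^sup>2) * (ennreal ((Re (g z))\<^sup>2) * indicator D z) + ennreal ((Im (g z))\<^sup>2) * indicator D z"
      by (simp add: \<rho>_def indicator_def)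
  qed
  also have "\<dots> = ennreal (e\<^sup>2) * (\<integral>\<^sup>+ z \<in> D. ennreal ((Re (g z))\<^sup>2) \<partial>lborel) + (\<integral>\<^sup>+ z \<in> D. ennreal ((Im (g z))\<^sup>2) \<partial>lborel)"
  proof -
    have gm: "(\<lambda>z. indicator D z *\<^sub>R g z) \<in> borel_measurable borel"
      using D contg by (intro borel_measurable_continuous_on_indicator) auto
    have m1: "(\<lambda>z. ennreal ((Re (g z))\<^sup>2) * indicator D z) \<in> borel_measurable borel"
    proof -
      have "(\<lambda>z. ennreal ((Re (indicator D z *\<^sub>R g z))\<^sup>2)) \<in> borel_measurable borel"
        using gm by measurable
      also have "(\<lambda>z. ennreal ((Re (indicator D z *\<^sub>R g z))\<^sup>2)) = (\<lambda>z. ennreal ((Re (g z))\<^sup>2) * indicator D z)"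
        by (auto simp: fun_eq_iff indicator_def)
      finally show ?thesis .
    qed
    have m2: "(\<lambda>z. ennreal ((Im (g z))\<^sup>2) * indicator D z) \<in> borel_measurable borel"
    proof -
      have "(\<lambda>z. ennreal ((Im (indicator D z *\<^sub>R g z))\<^sup>2)) \<in> borel_measurable borel"
        using gm by measurable
      also have "(\<lambda>z. ennreal ((Im (indicator D z *\<^sub>R g z))\<^sup>2)) = (\<lambda>z. ennreal ((Im (g z))\<^sup>2) * indicator D z)"
        by (auto simp: fun_eq_iff indicator_def)
      finally show ?thesis .
    qed
    show ?thesis using m1 m2 by (simp add: nn_integral_add nn_integral_cmult)
  qed
  finally show ?thesis .
qed

text \<open>On a vertical curve the scaling multiplies every distance by exactly \<open>e\<close>.
  Lengths and arc length parameters are multiplied by \<open>e\<close> as well, and the substitution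
  \<open>s\<close> to \<open>e * s\<close> produces the factor in front of the density.\<close>

lemma line_integral_vertical_scaling:
  assumes rect: "locally_rectifiable \<gamma>" and vert: "\<And>t. t \<in> {0<..<1} \<Longrightarrow> Re (\<gamma> t) = x"
    and e: "0 < e" and \<rho>: "\<rho> \<in> borel_measurable borel"
  shows "line_integral \<rho> (vertical_scaling e \<circ> \<gamma>) = line_integral (\<lambda>z. ennreal e * \<rho> (vertical_scaling e z)) \<gamma>"
  unfolding line_integral_def
proof (rule SUP_cong[OF refl], clarify)
  fix u v :: real assume uv: "0 < u" "u < v" "v < 1"
  let ?T = "vertical_scaling e"
  have cont: "continuous_on {u..v} \<gamma>"
    using rect uv unfolding locally_rectifiable_def by (auto intro: continuous_on_subset)
  have fin: "curve_length \<gamma> u v < \<infinity>"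
    using rect uv unfolding locally_rectifiable_def by auto
  have d: "dist ((?T \<circ> \<gamma>) s) ((?T \<circ> \<gamma>) t) = e * dist (\<gamma> s) (\<gamma> t)" if "u \<le> s" "s \<le> t" "t \<le> v" for s t
  proof -
    have "Re (\<gamma> s) = x" "Re (\<gamma> t) = x" using that uv vert by auto
    then show ?thesis using e
      by (simp add: dist_norm cmod_def real_sqrt_abs flip: right_diff_distrib) (simp add: abs_mult)
  qed
  have len: "curve_length (?T \<circ> \<gamma>) u t = ennreal e * curve_length \<gamma> u t" if t: "t \<le> v" for t
  proof (rule antisym)
    show "curve_length (?T \<circ> \<gamma>) u t \<le> ennreal e * curve_length \<gamma> u t"
      using d e t by (intro curve_length_lipschitz_le) auto
    \<comment> \<open>The reverse inequality is the Lipschitz bound for the inverse scaling.\<close>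
    have "curve_length \<gamma> u t \<le> ennreal (1/e) * curve_length (?T \<circ> \<gamma>) u t"
    proof (rule curve_length_lipschitz_le)
      fix s r assume "u \<le> s" "s \<le> r" "r \<le> t"
      with d[of s r] t e show "dist (\<gamma> s) (\<gamma> r) \<le> 1 / e * dist ((?T \<circ> \<gamma>) s) ((?T \<circ> \<gamma>) r)"
        by simp
    qed (use e in simp)
    then have "ennreal e * curve_length \<gamma> u t \<le> ennreal e * (ennreal (1/e) * curve_length (?T \<circ> \<gamma>) u t)"
      by (rule mult_left_mono) simp
    also have "\<dots> = curve_length (?T \<circ> \<gamma>) u t"
      using e by (simp add: mult.assoc[symmetric] flip: ennreal_mult)
    finally show "ennreal e * curve_length \<gamma> u t \<le> curve_length (?T \<circ> \<gamma>) u t" .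
  qed
  define L where "L = enn2real (curve_length \<gamma> u v)"
  have L': "enn2real (curve_length (?T \<circ> \<gamma>) u v) = e * L"
    using e by (simp add: len L_def enn2real_mult)
  have cont': "continuous_on {u..v} (?T \<circ> \<gamma>)"
    using cont by (intro continuous_on_compose linear_continuous_on[OF bounded_linear_vertical_scaling])
  have fin': "curve_length (?T \<circ> \<gamma>) u v < \<infinity>"
    using fin by (simp add: len ennreal_mult_less_top)
  have contp: "continuous_on {0..e * L} (arc_length_param (?T \<circ> \<gamma>) u v)"
    using arc_length_param_continuous[OF cont' uv(2) fin'] by (simp add: L')
  have param: "arc_length_param (?T \<circ> \<gamma>) u v (e * s) = ?T (arc_length_param \<gamma> u v s)" if "0 \<le> s" for s
  proof -
    have iff: "ennreal (e * s) \<le> ennreal e * c \<longleftrightarrow> ennreal s \<le> c" for c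
    proof -
      have "ennreal (e * s) = ennreal e * ennreal s" using e that by (intro ennreal_mult) auto
      moreover have "ennreal e \<noteq> 0" using e by (simp add: ennreal_eq_0_iff)
      ultimately show ?thesis by (simp only: ennreal_mult_le_mult_iff ennreal_neq_top not_False_eq_True)
    qed
    have "t \<in> {u..v} \<and> ennreal (e * s) \<le> curve_length (?T \<circ> \<gamma>) u t \<longleftrightarrow> t \<in> {u..v} \<and> ennreal s \<le> curve_length \<gamma> u t" for t
      using len[of t] iff[of "curve_length \<gamma> u t"] by (metis atLeastAtMost_iff)
    then have "{t \<in> {u..v}. ennreal (e * s) \<le> curve_length (?T \<circ> \<gamma>) u t} = {t \<in> {u..v}. ennreal s \<le> curve_length \<gamma> u t}"
      by (simp only:)
    then show ?thesis by (simp add: arc_length_param_def)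
  qed
  define f where "f s = \<rho> (arc_length_param (?T \<circ> \<gamma>) u v s) * indicator {0..e * L} s" for s
  \<comment> \<open>The parametrization is known to be continuous only on \<open>{0..e * L}\<close>,
    so it is cut off by the indicator before it is inserted into the density.\<close>
  have f_meas: "f \<in> borel_measurable borel"
  proof -
    have "(\<lambda>s. indicator {0..e * L} s *\<^sub>R arc_length_param (?T \<circ> \<gamma>) u v s) \<in> borel_measurable borel"
      using contp by (intro borel_measurable_continuous_on_indicator) auto
    then have "(\<lambda>s. \<rho> (indicator {0..e * L} s *\<^sub>R arc_length_param (?T \<circ> \<gamma>) u v s) * indicator {0..e * L} s) \<in> borel_measurable borel"
      using \<rho> by measurable
    also have "(\<lambda>s. \<rho> (indicator {0..e * L} s *\<^sub>R arc_length_param (?T \<circ> \<gamma>) u v s) * indicator {0..e * L} s) = f"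
      by (auto simp: f_def fun_eq_iff indicator_def)
    finally show ?thesis .
  qed
  have "(\<integral>\<^sup>+ s. f s \<partial>lborel) = ennreal e * (\<integral>\<^sup>+ s. f (e * s) \<partial>lborel)"
    using e f_meas by (subst nn_integral_real_affine[where c=e and t=0]) auto
  also have "\<dots> = (\<integral>\<^sup>+ s. ennreal e * f (e * s) \<partial>lborel)"
    using f_meas by (subst nn_integral_cmult) auto
  also have "\<dots> = (\<integral>\<^sup>+ s. (ennreal e * \<rho> (?T (arc_length_param \<gamma> u v s))) * indicator {0..L} s \<partial>lborel)"
    using e by (intro nn_integral_cong) (auto simp: f_def indicator_def param zero_le_mult_iff)
  finally show "(\<integral>\<^sup>+ s\<in>{0..enn2real (curve_length (?T \<circ> \<gamma>) u v)}. \<rho> (arc_length_param (?T \<circ> \<gamma>) u v s) \<partial>lborel)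
      = (\<integral>\<^sup>+ s\<in>{0..enn2real (curve_length \<gamma> u v)}. ennreal e * \<rho> (?T (arc_length_param \<gamma> u v s)) \<partial>lborel)"
    by (simp add: L' f_def) (simp add: L_def)
qed

text \<open>Pulling an admissible density back with the factor \<open>e\<close> gives a density
  admissible for the vertical curves. The factor contributes \<open>e\<close> squared to the energy,
  and the Jacobian takes one \<open>e\<close> back.\<close>

lemma modulus_vertical_le_scaled:
  assumes e: "0 < e" and sub: "\<Gamma>\<^sub>v \<subseteq> \<Gamma>"
    and vert: "\<And>\<gamma>. \<gamma> \<in> \<Gamma>\<^sub>v \<Longrightarrow> locally_rectifiable \<gamma> \<and> (\<exists>x. \<forall>t\<in>{0<..<1}. Re (\<gamma> t) = x)"
  shows "modulus \<Gamma>\<^sub>v \<le> ennreal e * modulus (scaled_family e \<Gamma>)"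
proof -
  have le: "modulus \<Gamma>\<^sub>v \<le> ennreal e * (\<integral>\<^sup>+ z. (\<rho> z)\<^sup>2 \<partial>lborel)" if "\<rho> \<in> admissible (scaled_family e \<Gamma>)" for \<rho>
  proof -
    have [measurable]: "\<rho> \<in> borel_measurable borel" using that by (simp add: admissible_def)
    define \<rho>' where "\<rho>' z = ennreal e * \<rho> (vertical_scaling e z)" for z
    have "\<rho>' \<in> admissible \<Gamma>\<^sub>v"
      unfolding admissible_def
    proof safe
      show "\<rho>' \<in> borel_measurable borel" unfolding \<rho>'_def by measurable
      fix \<gamma> assume \<gamma>: "\<gamma> \<in> \<Gamma>\<^sub>v"
      then have "1 \<le> line_integral \<rho> (vertical_scaling e \<circ> \<gamma>)"
        using that sub by (auto simp: admissible_def scaled_family_def)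
      also have "\<dots> = line_integral \<rho>' \<gamma>"
        unfolding \<rho>'_def using vert[OF \<gamma>] e by (auto intro: line_integral_vertical_scaling)
      finally show "1 \<le> line_integral \<rho>' \<gamma>" .
    qed
    then have "modulus \<Gamma>\<^sub>v \<le> (\<integral>\<^sup>+ z. (\<rho>' z)\<^sup>2 \<partial>lborel)"
      unfolding modulus_def by (rule INF_lower)
    also have "\<dots> = ennreal e * (ennreal e * (\<integral>\<^sup>+ z. (\<rho> (vertical_scaling e z))\<^sup>2 \<partial>lborel))"
      unfolding \<rho>'_def power_mult_distrib
      by (subst nn_integral_cmult) (auto simp: power2_eq_square mult.assoc)
    also have "\<dots> = ennreal e * (\<integral>\<^sup>+ z. (\<rho> z)\<^sup>2 \<partial>lborel)"
      by (subst nn_integral_vertical_scaling[OF _ e, of "\<lambda>z. (\<rho> z)\<^sup>2"]) auto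
    finally show ?thesis .
  qed
  have "ennreal (1 / e) * modulus \<Gamma>\<^sub>v \<le> (\<integral>\<^sup>+ z. (\<rho> z)\<^sup>2 \<partial>lborel)"
    if "\<rho> \<in> admissible (scaled_family e \<Gamma>)" for \<rho>
  proof -
    have "ennreal (1 / e) * modulus \<Gamma>\<^sub>v \<le> ennreal (1 / e) * (ennreal e * (\<integral>\<^sup>+ z. (\<rho> z)\<^sup>2 \<partial>lborel))"
      using le[OF that] by (rule mult_left_mono) simp
    then show ?thesis using e by (simp add: mult.assoc[symmetric] flip: ennreal_mult)
  qed
  then have "ennreal (1 / e) * modulus \<Gamma>\<^sub>v \<le> modulus (scaled_family e \<Gamma>)"
    unfolding modulus_def[of "scaled_family e \<Gamma>"] by (rule INF_greatest)
  then have "ennreal e * (ennreal (1 / e) * modulus \<Gamma>\<^sub>v) \<le> ennreal e * modulus (scaled_family e \<Gamma>)"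
    by (rule mult_left_mono) simp
  then show ?thesis using e by (simp add: mult.assoc[symmetric] flip: ennreal_mult)
qed

section \<open>Vertical fibres as curves\<close>

definition vertical_fibre :: "real \<Rightarrow> real \<Rightarrow> real \<Rightarrow> complex" where
  "vertical_fibre x m t = Complex x (t * m)"

lemma dist_vertical_fibre: "0 \<le> m \<Longrightarrow> dist (vertical_fibre x m s) (vertical_fibre x m t) = m * \<bar>t - s\<bar>"
  by (simp add: vertical_fibre_def dist_norm cmod_def abs_mult abs_minus_commute flip: left_diff_distrib)

lemma curve_length_vertical_fibre:
  assumes "0 \<le> m" "u \<le> t"
  shows "curve_length (vertical_fibre x m) u t = ennreal ((t - u) * m)"
proof (rule antisym)
  show "curve_length (vertical_fibre x m) u t \<le> ennreal ((t - u) * m)"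
    using curve_length_le[of u t "vertical_fibre x m" "\<lambda>t. t * m"] assms
    by (simp add: dist_vertical_fibre algebra_simps)
  have "ennreal ((t - u) * m) = ennreal (dist (vertical_fibre x m u) (vertical_fibre x m t))"
    using assms by (simp add: dist_vertical_fibre mult.commute)
  also have "\<dots> \<le> curve_length (vertical_fibre x m) u u + ennreal (dist (vertical_fibre x m u) (vertical_fibre x m t))"
    by (rule add_increasing) auto
  also have "\<dots> \<le> curve_length (vertical_fibre x m) u t"
    using assms by (intro curve_length_add_dist) auto
  finally show "ennreal ((t - u) * m) \<le> curve_length (vertical_fibre x m) u t" .
qed

lemma locally_rectifiable_vertical_fibre:
  assumes "0 \<le> m"
  shows "locally_rectifiable (vertical_fibre x m)"
  unfolding locally_rectifiable_def
proof (intro conjI allI impI)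
  show "continuous_on {0<..<1} (vertical_fibre x m)"
    unfolding vertical_fibre_def Complex_eq by (intro continuous_intros)
qed (use assms in \<open>simp add: curve_length_vertical_fibre\<close>)

text \<open>The arc length parameter \<open>s\<close> on \<open>[u,v]\<close> marks the height
  \<open>u * m + s\<close>, so every integral in the supremum is taken over a compact part of the
  open fibre.\<close>

lemma line_integral_vertical_fibre_le:
  assumes m: "0 < m" and [measurable]: "\<rho> \<in> borel_measurable borel"
  shows "line_integral \<rho> (vertical_fibre x m) \<le> (\<integral>\<^sup>+ y \<in> {0<..<m}. \<rho> (Complex x y) \<partial>lborel)"
  unfolding line_integral_def
proof (rule SUP_least, clarify)
  fix u v :: real assume uv: "0 < u" "u < v" "v < 1"
  have param: "arc_length_param (vertical_fibre x m) u v s = Complex x (u * m + s)"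
    if s: "0 \<le> s" "s \<le> (v - u) * m" for s
  proof -
    have "Inf {t \<in> {u..v}. ennreal s \<le> curve_length (vertical_fibre x m) u t} = u + s / m"
    proof (rule cInf_eq_minimum)
      show "u + s / m \<in> {t \<in> {u..v}. ennreal s \<le> curve_length (vertical_fibre x m) u t}"
        using s m by (simp add: curve_length_vertical_fibre field_simps)
      fix t assume "t \<in> {t \<in> {u..v}. ennreal s \<le> curve_length (vertical_fibre x m) u t}"
      then have "u \<le> t" "s \<le> (t - u) * m"
        using m by (auto simp: curve_length_vertical_fibre ennreal_le_iff)
      then show "u + s / m \<le> t" using m by (simp add: field_simps)
    qed
    then show ?thesis using m by (simp add: arc_length_param_def vertical_fibre_def field_simps)
  qed
  have L: "enn2real (curve_length (vertical_fibre x m) u v) = (v - u) * m"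
    using m uv by (simp add: curve_length_vertical_fibre)
  have "(\<integral>\<^sup>+ s\<in>{0..(v - u) * m}. \<rho> (arc_length_param (vertical_fibre x m) u v s) \<partial>lborel)
      = (\<integral>\<^sup>+ s. \<rho> (Complex x (u * m + s)) * indicator {u * m..v * m} (u * m + s) \<partial>lborel)"
    by (intro nn_integral_cong) (auto simp: indicator_def param algebra_simps)
  also have "\<dots> = (\<integral>\<^sup>+ y. \<rho> (Complex x y) * indicator {u * m..v * m} y \<partial>lborel)"
    by (subst nn_integral_real_affine[where c=1 and t="u * m" and f="\<lambda>y. \<rho> (Complex x y) * indicator {u * m..v * m} y"]) auto
  also have "\<dots> \<le> (\<integral>\<^sup>+ y \<in> {0<..<m}. \<rho> (Complex x y) \<partial>lborel)"
  proof (intro nn_integral_mono mult_left_mono)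
    fix y
    have "0 < u * m" "v * m < m" using uv m by auto
    then show "indicator {u * m..v * m} y \<le> (indicator {0<..<m} y :: ennreal)"
      by (auto simp: indicator_def)
  qed auto
  finally show "(\<integral>\<^sup>+ s\<in>{0..enn2real (curve_length (vertical_fibre x m) u v)}.
       \<rho> (arc_length_param (vertical_fibre x m) u v s) \<partial>lborel) \<le> (\<integral>\<^sup>+ y \<in> {0<..<m}. \<rho> (Complex x y) \<partial>lborel)"
    by (simp add: L)
qed

subsection \<open>Convergence to prime ends\<close>

lemma to_sphere_inj: "inj to_sphere"
  and continuous_on_to_sphere: "continuous_on S to_sphere"
proof -
  have pos: "1 + (cmod z)\<^sup>2 \<noteq> 0" for z :: complex
    by (metis add_pos_nonneg less_irrefl zero_le_power2 zero_less_one)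
  show "inj to_sphere"
  proof (rule injI)
    fix z w assume eq: "to_sphere z = to_sphere w"
    have snd_eq: "snd (to_sphere z) = 1 - 2 / (1 + (cmod z)\<^sup>2)" for z
      using pos[of z] by (simp add: to_sphere_def field_simps)
    have "2 / (1 + (cmod z)\<^sup>2) = 2 / (1 + (cmod w)\<^sup>2)"
      using snd_eq[of z] snd_eq[of w] eq by simp
    moreover have "(2 / (1 + (cmod z)\<^sup>2)) *\<^sub>R z = (2 / (1 + (cmod w)\<^sup>2)) *\<^sub>R w"
      using eq by (simp add: to_sphere_def)
    moreover have "2 / (1 + (cmod w)\<^sup>2) \<noteq> 0" using pos[of w] by simp
    ultimately show "z = w" by simp
  qed
  show "continuous_on S to_sphere"
    unfolding to_sphere_def using pos by (intro continuous_intros) (auto simp: add.commute)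
qed

text \<open>Stereographic projection from the north pole, which is the point where the last
  coordinate is 1. Being continuous, it carries connectedness back to the plane.\<close>

lemma to_sphere_left_inverse: "fst (to_sphere z) /\<^sub>R (1 - snd (to_sphere z)) = z" "snd (to_sphere z) \<noteq> 1"
proof -
  have pos: "1 + (cmod z)\<^sup>2 > 0"
    by (simp add: add_pos_nonneg)
  have eq: "1 - snd (to_sphere z) = 2 / (1 + (cmod z)\<^sup>2)"
    using pos by (simp add: to_sphere_def field_simps)
  then show "snd (to_sphere z) \<noteq> 1" using pos by (metis diff_self divide_eq_0_iff less_irrefl zero_neq_numeral)
  have "fst (to_sphere z) = (2 / (1 + (cmod z)\<^sup>2)) *\<^sub>R z" by (simp add: to_sphere_def)
  then show "fst (to_sphere z) /\<^sub>R (1 - snd (to_sphere z)) = z"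
    unfolding eq using pos by (simp add: field_simps)
qed

text \<open>On the sphere the closure of the arc adds only its two end points. These avoid the image
  of \<open>D\<close>, so \<open>s\<close> is relatively closed in \<open>D\<close>.\<close>

lemma cross_cut_props:
  assumes "cross_cut D s"
  shows "s \<subseteq> D" "s \<noteq> {}" "connected s" "D \<inter> closure s \<subseteq> s"
proof -
  obtain g where sD: "s \<subseteq> D" and g: "simple_path g" and im: "g ` {0<..<1} = to_sphere ` s"
    and ends: "{pathstart g, pathfinish g} \<subseteq> closure (to_sphere ` D) - to_sphere ` D"
    using assms unfolding cross_cut_def by blast
  show "s \<subseteq> D" by fact
  have "(1/2::real) \<in> {0<..<1}" by simp
  then show "s \<noteq> {}" using im by blast
  have "continuous_on {0<..<1} g"
    using simple_path_imp_path[OF g] by (auto simp: path_def intro: continuous_on_subset)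
  then have conn: "connected (to_sphere ` s)"
    using im connected_continuous_image[of "{0<..<1}" g] by auto
  define h where "h p = fst p /\<^sub>R (1 - snd p)" for p :: "complex \<times> real"
  have "continuous_on (to_sphere ` s) h"
    unfolding h_def by (intro continuous_intros) (use to_sphere_left_inverse in auto)
  then have "connected (h ` to_sphere ` s)" using conn by (rule connected_continuous_image)
  moreover have "h ` to_sphere ` s = s" using to_sphere_left_inverse by (auto simp: image_image h_def)
  ultimately show "connected s" by simp
  have pim: "path_image g = to_sphere ` s \<union> {pathstart g, pathfinish g}"
    using simple_path_endless[OF g] im by (auto simp: pathstart_in_path_image pathfinish_in_path_image)
  show "D \<inter> closure s \<subseteq> s"
  proof
    fix z assume z: "z \<in> D \<inter> closure s"
    have "to_sphere ` closure s \<subseteq> closure (to_sphere ` s)"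
      by (intro image_closure_subset continuous_on_to_sphere closure_subset) auto
    also have "\<dots> \<subseteq> path_image g"
      using pim compact_simple_path_image[OF g] by (intro closure_minimal compact_imp_closed) auto
    finally have "to_sphere z \<in> to_sphere ` s"
    proof -
      assume *: "to_sphere ` closure s \<subseteq> path_image g"
      have "to_sphere z \<in> path_image g" using * z by blast
      moreover have "to_sphere z \<in> to_sphere ` D" using z by blast
      ultimately show ?thesis using ends unfolding pim by auto
    qed
    then show "z \<in> s" using to_sphere_inj by (simp add: inj_image_mem_iff)
  qed
qed

section \<open>Nested regions of a null chain\<close>

locale null_chain_in =
  fixes D :: "complex set" and s :: "nat \<Rightarrow> complex set"
  assumes D: "open D" "connected D" and chain: "null_chain D s"
begin

lemma cut: "s n \<subseteq> D" "s n \<noteq> {}" "connected (s n)" "D \<inter> closure (s n) \<subseteq> s n"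
  using chain cross_cut_props unfolding null_chain_def by blast+

lemma disjoint_Suc: "s n \<inter> s (Suc n) = {}"
proof -
  have "closure (to_sphere ` s n) \<inter> closure (to_sphere ` s (Suc n)) = {}"
    using chain unfolding null_chain_def by blast
  then have "to_sphere ` s n \<inter> to_sphere ` s (Suc n) = {}"
    using closure_subset[of "to_sphere ` s n"] closure_subset[of "to_sphere ` s (Suc n)"] by blast
  then show ?thesis by blast
qed

text \<open>The next cut is nonempty, connected and disjoint from the present one, so the union
  defining \<open>chain_region\<close> has exactly one member.\<close>

lemma chain_region_component: "chain_region D s n \<in> components (D - s n)" "s (Suc n) \<subseteq> chain_region D s n"
proof -
  have "s (Suc n) \<subseteq> D - s n" "D - s n \<noteq> {}"
    using cut(1)[of "Suc n"] cut(2)[of "Suc n"] disjoint_Suc[of n] by blast+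
  then obtain C where C: "C \<in> components (D - s n)" "s (Suc n) \<subseteq> C"
    using exists_component_superset cut(3) by blast
  have "K = C" if "K \<in> components (D - s n)" "s (Suc n) \<subseteq> K" for K
    using that C cut(2)[of "Suc n"] components_eq[of K "D - s n" C] by blast
  then have "chain_region D s n = C" using C unfolding chain_region_def by blast
  then show "chain_region D s n \<in> components (D - s n)" "s (Suc n) \<subseteq> chain_region D s n"
    using C by auto
qed

lemma chain_region_subset: "chain_region D s n \<subseteq> D - s n"
  using chain_region_component(1) by (rule in_components_subset)

lemma chain_region_connected: "connected (chain_region D s n)"
  using chain_region_component(1) by (rule in_components_connected)

lemma start_disjoint: "1 \<le> n \<Longrightarrow> s 0 \<inter> chain_region D s n = {}"
proof -
  assume "1 \<le> n"
  then obtain K L where KL: "K \<in> components (D - s n)" "L \<in> components (D - s n)" "K \<noteq> L" "s 0 \<subseteq> K" "s (Suc n) \<subseteq> L"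
    using chain unfolding null_chain_def separates_in_def by blast
  then have "chain_region D s n = L"
    using chain_region_component[of n] components_eq[of L "D - s n" "chain_region D s n"] cut(2)[of "Suc n"] by blast
  moreover have "K \<inter> L = {}" using KL components_nonoverlap by blast
  ultimately show ?thesis using KL by blast
qed

text \<open>A general fact on connected spaces with a connected subset removed: the complement of
  one remaining component is connected. It allows the other components, together with the cut, to be
  handled as one piece.\<close>

lemma complement_connected: "connected (D - chain_region D s n)"
  using component_diff_connected[OF cut(3) D(2) cut(1) chain_region_component(1)] .

text \<open>If the next region met the complement of the present one, it would absorb this connected
  complement and with it \<open>s 0\<close>, which the separation clause forbids.\<close>

lemma chain_region_Suc: "chain_region D s (Suc n) \<subseteq> chain_region D s n"
proof -
  let ?E = "D - chain_region D s n" and ?R = "chain_region D s (Suc n)"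
  have E: "?E \<subseteq> D - s (Suc n)"
    using chain_region_component(2)[of n] by blast
  have "s 0 \<inter> chain_region D s n = {}"
    using start_disjoint[of n] chain_region_subset[of n] by (cases "n = 0") auto
  then have E0: "s 0 \<subseteq> ?E"
    using cut(1)[of 0] by blast
  have "?R \<inter> ?E = {}"
  proof (rule ccontr)
    assume "?R \<inter> ?E \<noteq> {}"
    then have "?E \<subseteq> ?R"
      by (rule components_maximal[OF chain_region_component(1) complement_connected E])
    then have "s 0 \<subseteq> ?R" using E0 by blast
    then show False using start_disjoint[of "Suc n"] cut(2)[of 0] by auto
  qed
  then show ?thesis using chain_region_subset[of "Suc n"] by blast
qed

lemma chain_region_antimono: "m \<le> n \<Longrightarrow> chain_region D s n \<subseteq> chain_region D s m"
  using chain_region_Suc lift_Suc_antimono_le[of "chain_region D s"] by auto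

text \<open>A component of \<open>D - s i\<close> other than the chain region is swallowed by one component of
  \<open>D - s j\<close> for each \<open>j > i\<close>, together with all of \<open>D\<close> outside the chain region; hence a curve
  that stays in such components would have to start in the chain region.\<close>
lemma tail_in_chain_region:
  assumes KL: "K \<in> components (D - s i)" "L \<in> components (D - s j)" "i < j"
    and K: "K \<noteq> chain_region D s i" and meet: "K \<inter> L \<noteq> {}" and z: "z \<in> D" "z \<notin> L"
  shows "z \<in> chain_region D s i"
proof (rule ccontr)
  assume nz: "z \<notin> chain_region D s i"
  let ?E = "D - chain_region D s i"
  have "s j \<subseteq> chain_region D s i"
  proof -
    obtain k where k: "j = Suc k" "i \<le> k" using KL(3) by (cases j) auto
    then show ?thesis using chain_region_component(2)[of k] chain_region_antimono[OF k(2)] by blast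
  qed
  then have E: "?E \<subseteq> D - s j" by blast
  have "K \<inter> chain_region D s i = {}"
    using KL(1) K chain_region_component(1) components_nonoverlap by blast
  then have "K \<subseteq> ?E" using in_components_subset[OF KL(1)] by blast
  then have "?E \<subseteq> L"
    using meet by (intro components_maximal[OF KL(2) complement_connected E]) blast
  then show False using z nz by blast
qed

end

text \<open>Regions of equivalent chains are cofinal in one another, so the intersection of closed
  images, given for one representative, is the same for every representative.\<close>

lemma corresponds_chain_inter:
  assumes c: "corresponds D \<phi> p \<zeta>" and s: "s \<in> p"
  shows "null_chain D s" "(\<Inter>n. closure (\<phi> ` chain_region D s n)) = {\<zeta>}"
proof -
  obtain s0 where s0: "p = chain_equiv D `` {s0}"
    using c unfolding corresponds_def prime_ends_def quotient_def by blast
  obtain s1 where s1: "s1 \<in> p" "(\<Inter>n. closure (\<phi> ` chain_region D s1 n)) = {\<zeta>}"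
    using c unfolding corresponds_def by blast
  have e: "(s0, s) \<in> chain_equiv D" "(s0, s1) \<in> chain_equiv D"
    using s s1 s0 by auto
  then show "null_chain D s" by (simp add: chain_equiv_def)
  have sub: "\<forall>m. \<exists>n. chain_region D s n \<subseteq> chain_region D s1 m" "\<forall>m. \<exists>n. chain_region D s1 n \<subseteq> chain_region D s m"
    using e unfolding chain_equiv_def by (clarsimp, meson order_trans)+
  have *: "(\<Inter>n. closure (\<phi> ` chain_region D a n)) \<subseteq> (\<Inter>n. closure (\<phi> ` chain_region D b n))"
    if ab: "\<forall>m. \<exists>n. chain_region D a n \<subseteq> chain_region D b m" for a b
  proof (rule INF_greatest)
    fix m
    obtain n where "chain_region D a n \<subseteq> chain_region D b m" using ab by blast
    then have "closure (\<phi> ` chain_region D a n) \<subseteq> closure (\<phi> ` chain_region D b m)"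
      by (intro closure_mono image_mono)
    then show "(\<Inter>n. closure (\<phi> ` chain_region D a n)) \<subseteq> closure (\<phi> ` chain_region D b m)" by blast
  qed
  show "(\<Inter>n. closure (\<phi> ` chain_region D s n)) = {\<zeta>}"
    using *[OF sub(1)] *[OF sub(2)] s1(2) by auto
qed

lemma corresponds_unique: "corresponds D \<phi> p \<zeta> \<Longrightarrow> corresponds D \<phi> p \<zeta>' \<Longrightarrow> \<zeta> = \<zeta>'"
  by (metis corresponds_chain_inter(2) corresponds_def singleton_inject)

text \<open>The definition of convergence supplies, for each late cut, only some component that
  contains a tail of the ray and omits \<open>r 0\<close>. It has to be identified with the chain
  region. The closed images of the chain regions are compact and shrink to \<zeta>, so they
  eventually lie in \<open>N\<close> and avoid the interior point
  \<open>\<phi> (r 0)\<close>.\<close>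

lemma converges_to_prime_end_image:
  assumes D: "open D" "connected D" and \<phi>: "\<phi> ` D \<subseteq> ball 0 1"
    and c: "corresponds D \<phi> p \<zeta>" and \<zeta>: "norm \<zeta> = 1"
    and r: "converges_to_prime_end D r p" and r0: "r 0 \<in> D"
    and N: "open N" "\<zeta> \<in> N"
  shows "\<exists>t\<in>{0..<1}. \<forall>\<tau>\<in>{t<..<1}. \<phi> (r \<tau>) \<in> N"
proof -
  obtain s where s: "s \<in> p" and ev: "\<forall>\<^sub>F i in sequentially. \<exists>t\<in>{0..<1}. \<exists>K\<in>components (D - s i).
        r 0 \<notin> K \<and> r ` {t<..<1} \<subseteq> K"
    using r unfolding converges_to_prime_end_def by blast
  note ci = corresponds_chain_inter[OF c s]
  interpret null_chain_in D s by unfold_locales (use D ci in auto)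
  let ?C = "\<lambda>n. closure (\<phi> ` chain_region D s n)"
  have cpt: "compact (?C n)" for n
  proof -
    have "?C n \<subseteq> cball 0 1"
      using \<phi> chain_region_subset[of n] ball_subset_cball[of 0 "1::real"] by (intro closure_minimal) blast+
    then show ?thesis by (simp add: compact_eq_bounded_closed bounded_subset[OF bounded_cball])
  qed
  have anti: "?C n \<subseteq> ?C m" if "m \<le> n" for m n
    using chain_region_antimono[OF that] by (intro closure_mono image_mono)
  have small: "\<exists>n. ?C n \<subseteq> M" if M: "open M" "\<zeta> \<in> M" for M
  proof (rule ccontr)
    assume "\<not> ?thesis"
    then have "(\<Inter>n. ?C n - M) \<noteq> {}"
      using anti M by (intro compact_nest compact_diff cpt) blast+
    then show False using ci(2) M(2) by auto
  qed
  obtain n1 where n1: "?C n1 \<subseteq> N" using small N by blast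
  have "\<phi> (r 0) \<noteq> \<zeta>" using \<phi> r0 \<zeta> by fastforce
  then obtain n2 where n2: "?C n2 \<subseteq> - {\<phi> (r 0)}"
    using small[of "- {\<phi> (r 0)}"] by auto
  obtain n3 where n3: "\<And>i. i \<ge> n3 \<Longrightarrow> \<exists>t\<in>{0..<1}. \<exists>K\<in>components (D - s i). r 0 \<notin> K \<and> r ` {t<..<1} \<subseteq> K"
    using ev unfolding eventually_sequentially by blast
  obtain i where i: "n1 \<le> i" "n2 \<le> i" "n3 \<le> i" by (meson max.cobounded1 max.cobounded2 order_trans)
  obtain t K where tK: "t \<in> {0..<1}" "K \<in> components (D - s i)" "r ` {t<..<1} \<subseteq> K"
    using n3[OF i(3)] by blast
  obtain t' L where tL: "t' \<in> {0..<1}" "L \<in> components (D - s (Suc i))" "r 0 \<notin> L" "r ` {t'<..<1} \<subseteq> L"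
    using n3[of "Suc i"] i(3) le_SucI by blast
  \<comment> \<open>Two consecutive cuts are compared. If \<open>K\<close> were another component,
    the component \<open>L\<close> of the next cut, which shares a tail with \<open>K\<close> and
    omits \<open>r 0\<close>, would place \<open>r 0\<close> in the chain region; its image closure
    was chosen to avoid \<open>\<phi> (r 0)\<close>.\<close>
  have "K = chain_region D s i"
  proof (rule ccontr)
    assume ne: "K \<noteq> chain_region D s i"
    have "(max t t' + 1) / 2 \<in> {t<..<1} \<inter> {t'<..<1}" using tK tL by auto
    then have "K \<inter> L \<noteq> {}" using tK tL by blast
    from tail_in_chain_region[OF tK(2) tL(2) _ ne this r0 tL(3)]
    have "r 0 \<in> chain_region D s i" by simp
    then have "\<phi> (r 0) \<in> ?C i" using closure_subset[of "\<phi> ` chain_region D s i"] by auto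
    then show False using n2 anti[OF i(2)] by blast
  qed
  then have "\<phi> (r \<tau>) \<in> N" if "\<tau> \<in> {t<..<1}" for \<tau>
  proof -
    have "r \<tau> \<in> chain_region D s i" using that tK(3) \<open>K = _\<close> by blast
    then have "\<phi> (r \<tau>) \<in> ?C i" using closure_subset[of "\<phi> ` chain_region D s i"] by auto
    then show ?thesis using n1 anti[OF i(1)] by blast
  qed
  then show ?thesis using tK(1) by blast
qed

text \<open>Angles are determined only up to full turns, but both ends are shifted by the same
  number of turns since both angular gaps lie strictly between 0 and a full turn.\<close>

lemma circle_arc_cis:
  assumes "a < b" "b < a + 2 * pi"
  shows "circle_arc (cis a) (cis b) = cis ` {a<..<b}"
proof (intro equalityI subsetI)
  fix z assume "z \<in> circle_arc (cis a) (cis b)"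
  then obtain s t u where z: "z = cis t" and eq: "cis a = cis s" "cis b = cis u" and stu: "s < t" "t < u" "u < s + 2 * pi"
    unfolding circle_arc_def by blast
  obtain k where k: "a = s + 2 * pi * of_int k"
    using eq(1) sin_cos_eq_iff[of a s] by (auto simp: cis.ctr)
  obtain m where m: "b = u + 2 * pi * of_int m"
    using eq(2) sin_cos_eq_iff[of b u] by (auto simp: cis.ctr)
  have "2 * pi * (of_int m - of_int k) < 2 * pi * 1" "2 * pi * (of_int k - of_int m) < 2 * pi * (1::real)"
    using k m stu assms by (auto simp: algebra_simps)
  then have "m = k" by auto
  then have "t + 2 * pi * of_int k \<in> {a<..<b}" using k m stu by auto
  moreover have "cis (t + 2 * pi * of_int k) = cis t"
    using sin_cos_eq_iff[of "t + 2 * pi * of_int k" t] by (auto simp: cis.ctr)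
  ultimately show "z \<in> cis ` {a<..<b}" using z by (metis image_eqI)
next
  fix z assume "z \<in> cis ` {a<..<b}"
  then obtain t where "z = cis t" "a < t" "t < b" by auto
  then show "z \<in> circle_arc (cis a) (cis b)"
    unfolding circle_arc_def using assms by blast
qed

lemma prime_end_arc_cis:
  assumes "corresponds D \<phi> a (cis \<alpha>)" "corresponds D \<phi> b (cis \<beta>)" "\<alpha> < \<beta>" "\<beta> < \<alpha> + 2 * pi"
  shows "p \<in> prime_end_arc D \<phi> a b \<longleftrightarrow> (\<exists>\<zeta>\<in>cis ` {\<alpha><..<\<beta>}. corresponds D \<phi> p \<zeta>)"
proof
  assume "p \<in> prime_end_arc D \<phi> a b"
  then obtain \<alpha>' \<beta>' \<zeta> where *: "corresponds D \<phi> a \<alpha>'" "corresponds D \<phi> b \<beta>'" "corresponds D \<phi> p \<zeta>" "\<zeta> \<in> circle_arc \<alpha>' \<beta>'"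
    unfolding prime_end_arc_def by blast
  have "\<alpha>' = cis \<alpha>" "\<beta>' = cis \<beta>"
    using corresponds_unique *(1,2) assms(1,2) by blast+
  then show "\<exists>\<zeta>\<in>cis ` {\<alpha><..<\<beta>}. corresponds D \<phi> p \<zeta>"
    using * circle_arc_cis[OF assms(3,4)] by auto
next
  assume "\<exists>\<zeta>\<in>cis ` {\<alpha><..<\<beta>}. corresponds D \<phi> p \<zeta>"
  then obtain \<zeta> where "\<zeta> \<in> circle_arc (cis \<alpha>) (cis \<beta>)" "corresponds D \<phi> p \<zeta>"
    using circle_arc_cis[OF assms(3,4)] by auto
  then show "p \<in> prime_end_arc D \<phi> a b"
    unfolding prime_end_arc_def using assms(1,2) by blast
qed

text \<open>The two ends are looked at from the parameter 1/2, so the left end yields a parameter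
  below 1/2 and the right end one above it. The order of the two parameters is thus independent of
  which arc each end approaches.\<close>

lemma connecting_curves_image:
  assumes D: "open D" "connected D" and \<phi>: "\<phi> ` D \<subseteq> ball 0 1"
    and \<gamma>: "\<gamma> \<in> connecting_curves D P Q"
    and P: "\<And>p. p \<in> P \<Longrightarrow> \<exists>\<zeta>\<in>I. corresponds D \<phi> p \<zeta>" and Q: "\<And>q. q \<in> Q \<Longrightarrow> \<exists>\<zeta>\<in>J. corresponds D \<phi> q \<zeta>"
    and IJ: "I \<subseteq> sphere 0 1" "J \<subseteq> sphere 0 1" and N: "open N" "I \<subseteq> N" "open M" "J \<subseteq> M"
  shows "\<exists>s t. 0 < s \<and> s < t \<and> t < 1 \<and>
      (\<phi> (\<gamma> s) \<in> N \<and> \<phi> (\<gamma> t) \<in> M \<or> \<phi> (\<gamma> s) \<in> M \<and> \<phi> (\<gamma> t) \<in> N)"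
proof -
  have \<gamma>D: "\<gamma> (1/2) \<in> D" using \<gamma> by (auto simp: connecting_curves_def)
  have left: "\<exists>s\<in>{0<..<1/2}. \<phi> (\<gamma> s) \<in> U"
    if h: "converges_to_prime_end D (\<lambda>t. \<gamma> ((1 - t) / 2)) p" "\<exists>\<zeta>\<in>S. corresponds D \<phi> p \<zeta>" "S \<subseteq> sphere 0 1" "open U" "S \<subseteq> U" for p S U
  proof -
    obtain \<zeta> where \<zeta>: "corresponds D \<phi> p \<zeta>" "\<zeta> \<in> S" using h(2) by blast
    have n: "norm \<zeta> = 1" using \<zeta>(2) h(3) by auto
    then obtain t where t: "t \<in> {0..<1}" "\<And>\<tau>. \<tau> \<in> {t<..<1} \<Longrightarrow> \<phi> (\<gamma> ((1 - \<tau>) / 2)) \<in> U"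
      using converges_to_prime_end_image[OF D \<phi> \<zeta>(1) n h(1) _ h(4)] \<zeta>(2) h(5) \<gamma>D by fastforce
    show ?thesis
      using t(1) t(2)[of "(t + 1) / 2"] by (intro bexI[of _ "(1 - (t + 1) / 2) / 2"]) auto
  qed
  have right: "\<exists>s\<in>{1/2<..<1}. \<phi> (\<gamma> s) \<in> U"
    if h: "converges_to_prime_end D (\<lambda>t. \<gamma> ((1 + t) / 2)) p" "\<exists>\<zeta>\<in>S. corresponds D \<phi> p \<zeta>" "S \<subseteq> sphere 0 1" "open U" "S \<subseteq> U" for p S U
  proof -
    obtain \<zeta> where \<zeta>: "corresponds D \<phi> p \<zeta>" "\<zeta> \<in> S" using h(2) by blast
    have n: "norm \<zeta> = 1" using \<zeta>(2) h(3) by auto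
    then obtain t where t: "t \<in> {0..<1}" "\<And>\<tau>. \<tau> \<in> {t<..<1} \<Longrightarrow> \<phi> (\<gamma> ((1 + \<tau>) / 2)) \<in> U"
      using converges_to_prime_end_image[OF D \<phi> \<zeta>(1) n h(1) _ h(4)] \<zeta>(2) h(5) \<gamma>D by fastforce
    show ?thesis
      using t(1) t(2)[of "(t + 1) / 2"] by (intro bexI[of _ "(1 + (t + 1) / 2) / 2"]) auto
  qed
  obtain p q where pq: "p \<in> P" "q \<in> Q"
    and conv: "converges_to_prime_end D (\<lambda>t. \<gamma> ((1 - t) / 2)) p \<and> converges_to_prime_end D (\<lambda>t. \<gamma> ((1 + t) / 2)) q \<or>
       converges_to_prime_end D (\<lambda>t. \<gamma> ((1 - t) / 2)) q \<and> converges_to_prime_end D (\<lambda>t. \<gamma> ((1 + t) / 2)) p"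
    using \<gamma> unfolding connecting_curves_def by blast
  from conv show ?thesis
  proof (elim disjE conjE)
    assume c: "converges_to_prime_end D (\<lambda>t. \<gamma> ((1 - t) / 2)) p" "converges_to_prime_end D (\<lambda>t. \<gamma> ((1 + t) / 2)) q"
    obtain s t where "s \<in> {0<..<1/2}" "\<phi> (\<gamma> s) \<in> N" "t \<in> {1/2<..<1}" "\<phi> (\<gamma> t) \<in> M"
      using left[OF c(1) P[OF pq(1)] IJ(1) N(1,2)] right[OF c(2) Q[OF pq(2)] IJ(2) N(3,4)] by blast
    then show ?thesis by (intro exI[of _ s] exI[of _ t]) auto
  next
    assume c: "converges_to_prime_end D (\<lambda>t. \<gamma> ((1 - t) / 2)) q" "converges_to_prime_end D (\<lambda>t. \<gamma> ((1 + t) / 2)) p"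
    obtain s t where "s \<in> {0<..<1/2}" "\<phi> (\<gamma> s) \<in> M" "t \<in> {1/2<..<1}" "\<phi> (\<gamma> t) \<in> N"
      using left[OF c(1) Q[OF pq(2)] IJ(2) N(3,4)] right[OF c(2) P[OF pq(1)] IJ(1) N(1,2)] by blast
    then show ?thesis by (intro exI[of _ s] exI[of _ t]) auto
  qed
qed

subsection \<open>Prime ends from small cross-cuts\<close>

lemma norm_diff_sq:
  fixes a b :: "'a::real_inner"
  shows "(norm (a - b))\<^sup>2 = (norm a)\<^sup>2 - 2 * (a \<bullet> b) + (norm b)\<^sup>2"
  by (simp add: power2_norm_eq_inner inner_diff_left inner_diff_right inner_commute)

text \<open>The connecting set runs straight towards the antipode of \<open>\<zeta>\<close> first.\<close>
lemma unit_disk_minus_ball_joins_0: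
  fixes \<zeta> w :: complex
  assumes \<zeta>: "norm \<zeta> = 1" and w: "norm w < 1" "d \<le> dist w \<zeta>" and d: "d \<le> 1"
  obtains S where "connected S" "0 \<in> S" "w \<in> S" "S \<subseteq> ball 0 1" "S \<inter> ball \<zeta> d = {}"
proof -
  \<comment> \<open>With this value \<open>(norm w)\<^sup>2 - c = - (1 - c)\<close>, so the inner
    product below is at most \<open>(1 - c) * (norm w - 1)\<close>. Moving from \<open>w\<close>
    towards \<open>- c * \<zeta>\<close>, that is in direction \<open>- q\<close>, therefore never
    decreases the distance from \<zeta>.\<close>
  define c where "c = (1 + (norm w)\<^sup>2) / 2"
  have w2: "(norm w)\<^sup>2 < 1" using w by (simp add: power_less_one_iff)
  then have c: "0 < c" "c < 1" by (auto simp: c_def add_pos_nonneg)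
  define q where "q = w + complex_of_real c * \<zeta>"
  have wz: "\<bar>w \<bullet> \<zeta>\<bar> \<le> norm w" using Cauchy_Schwarz_ineq2[of w \<zeta>] \<zeta> by simp
  have zz: "\<zeta> \<bullet> \<zeta> = 1" using \<zeta> by (simp add: dot_square_norm)
  have ww: "w \<bullet> w = (norm w)\<^sup>2" by (simp add: dot_square_norm)
  have key: "dist w \<zeta> \<le> dist ((1 - t) *\<^sub>R w + t *\<^sub>R (- (complex_of_real c * \<zeta>))) \<zeta>" if t: "0 \<le> t" "t \<le> 1" for t
  proof -
    let ?p = "(1 - t) *\<^sub>R w + t *\<^sub>R (- (complex_of_real c * \<zeta>))"
    have p: "?p - \<zeta> = (w - \<zeta>) - t *\<^sub>R q" by (simp add: q_def algebra_simps)
    have "(dist ?p \<zeta>)\<^sup>2 = (dist w \<zeta>)\<^sup>2 - 2 * t * ((w - \<zeta>) \<bullet> q) + t\<^sup>2 * (norm q)\<^sup>2"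
      unfolding dist_norm p norm_diff_sq[of "w - \<zeta>" "t *\<^sub>R q"] by (simp add: power_mult_distrib)
    moreover have "(w - \<zeta>) \<bullet> q \<le> 0"
    proof -
      have q': "q = w + c *\<^sub>R \<zeta>" by (simp add: q_def scaleR_conv_of_real)
      have "(w - \<zeta>) \<bullet> q = (norm w)\<^sup>2 - c - (1 - c) * (w \<bullet> \<zeta>)"
        unfolding q' using zz ww by (simp add: inner_diff_left inner_add_right inner_commute algebra_simps)
      also have "\<dots> \<le> (norm w)\<^sup>2 - c + (1 - c) * norm w"
        using wz c by (intro diff_mono[of _ _ "- ((1 - c) * norm w)" _, simplified]) (auto simp: abs_le_iff intro: mult_left_mono[of "- norm w" _ "1 - c", simplified])
      also have "\<dots> = (1 - c) * (norm w - 1)" by (simp add: c_def field_simps)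
      also have "\<dots> \<le> 0" using c w by (simp add: mult_le_0_iff)
      finally show ?thesis .
    qed
    then have "2 * t * ((w - \<zeta>) \<bullet> q) \<le> 0" using t by (simp add: mult_nonneg_nonpos)
    moreover have "0 \<le> t\<^sup>2 * (norm q)\<^sup>2" by simp
    ultimately have "(dist w \<zeta>)\<^sup>2 \<le> (dist ?p \<zeta>)\<^sup>2" by linarith
    then show ?thesis by (rule power2_le_imp_le) simp
  qed
  let ?m = "- (complex_of_real c * \<zeta>)"
  have m: "norm ?m < 1" using c \<zeta> by (simp add: norm_mult)
  define S where "S = closed_segment w ?m \<union> closed_segment ?m 0"
  have "connected S"
    unfolding S_def by (intro connected_Un connected_segment) auto
  moreover have "0 \<in> S" "w \<in> S" by (auto simp: S_def)
  moreover have "S \<subseteq> ball 0 1"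
    unfolding S_def using w m by (intro Un_least closed_segment_subset convex_ball) auto
  moreover have "z \<notin> ball \<zeta> d" if z: "z \<in> S" for z
  proof (cases "z \<in> closed_segment w ?m")
    case True
    then obtain t where "z = (1 - t) *\<^sub>R w + t *\<^sub>R ?m" "0 \<le> t" "t \<le> 1"
      by (auto simp: in_segment)
    then have "dist w \<zeta> \<le> dist z \<zeta>" using key by blast
    then show ?thesis using w by (simp add: dist_commute)
  next
    case False
    then obtain t where t: "z = (1 - t) *\<^sub>R ?m" "0 \<le> t" "t \<le> 1"
      using z by (auto simp: S_def in_segment)
    \<comment> \<open>On the second leg the points are nonpositive multiples of \<zeta>, hence at
      distance at least 1 from it.\<close>
    have "\<zeta> - z = (1 + (1 - t) * c) *\<^sub>R \<zeta>" by (simp add: t scaleR_conv_of_real algebra_simps)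
    then have "dist \<zeta> z = \<bar>1 + (1 - t) * c\<bar>" using \<zeta> by (simp add: dist_norm del: scaleR_left_distrib)
    moreover have "0 \<le> (1 - t) * c" using t c by simp
    ultimately show ?thesis using d by simp
  qed
  ultimately show thesis using that by blast
qed

text \<open>The set \<open>W n\<close> is the side of the cut towards the tip, open with open
  complement in \<open>D - s n\<close>, so it contains the chain region. The image of that region is
  small: a point of it with image outside a disk about \<zeta> that contains the image of the cut
  could be joined, within the unit disk and off this small disk, to 0. Then \<open>\<psi> 0\<close>
  would lie in \<open>W n\<close>, which \<open>avoid\<close> excludes for late
  \<open>n\<close>.\<close>

lemma prime_end_of_cross_cuts:
  assumes D: "open D" "connected D" and hom: "homeomorphism D (ball 0 1) \<phi> \<psi>"
    and cut: "\<And>n. cross_cut D (s n)"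
    and clos: "\<And>n. closure (to_sphere ` s n) \<inter> closure (to_sphere ` s (Suc n)) = {}"
    and diam: "(\<lambda>n. diameter (to_sphere ` s n)) \<longlonglongrightarrow> 0"
    and W: "\<And>n. open (W n)" "\<And>n. W n \<subseteq> D - s n" "\<And>n. open (D - s n - W n)"
    and sW: "\<And>n. s (Suc n) \<subseteq> W n" "\<And>n. 1 \<le> n \<Longrightarrow> s 0 \<inter> (W n \<union> s n) = {}"
    and \<zeta>: "norm \<zeta> = 1" and small: "\<And>d. 0 < d \<Longrightarrow> \<forall>\<^sub>F n in sequentially. \<phi> ` s n \<subseteq> ball \<zeta> d"
    and avoid: "\<And>z. z \<in> D \<Longrightarrow> \<forall>\<^sub>F n in sequentially. z \<notin> W n"
    and ray: "continuous_on {0..<1} r" "r 0 \<in> D"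
      "\<And>n. \<exists>t\<in>{0..<1}. r ` {t<..<1} \<subseteq> W n \<and> r ` {t<..<1} \<inter> s (Suc n) \<noteq> {}"
  obtains p where "corresponds D \<phi> p \<zeta>" "converges_to_prime_end D r p"
proof -
  have sne: "s n \<noteq> {}" for n using cross_cut_props(2)[OF cut] .
  have sD: "s n \<subseteq> D" for n using cross_cut_props(1)[OF cut] .
  have sconn: "connected (s n)" for n using cross_cut_props(3)[OF cut] .
  \<comment> \<open>\<open>W n\<close> and the rest of \<open>D - s n\<close> are both open, so a
    connected set cannot meet both.\<close>
  have inW: "K \<subseteq> W n" if "connected K" "K \<subseteq> D - s n" "K \<inter> W n \<noteq> {}" for K n
    using connectedD[OF that(1) W(1)[of n] W(3)[of n]] that(2,3) by blast
  have chain: "null_chain D s"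
    unfolding null_chain_def
  proof (intro conjI allI impI cut clos diam)
    fix n :: nat assume n: "n \<ge> 1"
    have "s (Suc n) \<subseteq> D - s n" using sW(1) W(2) by blast
    moreover have "D - s n \<noteq> {}" using calculation sne[of "Suc n"] by blast
    ultimately obtain L where L: "L \<in> components (D - s n)" "s (Suc n) \<subseteq> L"
      using exists_component_superset sconn by blast
    have s0: "s 0 \<subseteq> D - s n" using sW(2)[OF n] sD by blast
    then obtain K where K: "K \<in> components (D - s n)" "s 0 \<subseteq> K"
      using exists_component_superset sconn \<open>D - s n \<noteq> {}\<close> by blast
    have "L \<subseteq> W n"
      using sW(1)[of n] L sne[of "Suc n"]
      by (intro inW in_components_connected[OF L(1)] in_components_subset[OF L(1)]) blast
    then have "K \<noteq> L" using K(2) sW(2)[OF n] sne[of 0] by blast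
    then show "separates_in D (s n) (s 0) (s (Suc n))"
      unfolding separates_in_def using K L by blast
  qed
  interpret null_chain_in D s by unfold_locales (use D chain in auto)
  have RW: "chain_region D s n \<subseteq> W n" for n
    using sW(1)[of n] chain_region_component(2)[of n] sne[of "Suc n"]
    by (intro inW chain_region_connected chain_region_subset) blast
  have \<phi>0: "\<psi> 0 \<in> D" "\<phi> (\<psi> 0) = 0"
    using hom by (auto simp: homeomorphism_def)
  have Rsmall: "\<forall>\<^sub>F n in sequentially. \<phi> ` chain_region D s n \<subseteq> ball \<zeta> d" if d: "0 < d" "d \<le> 1" for d
    using small[OF d(1)] avoid[OF \<phi>0(1)]
  proof eventually_elim
    case (elim n)
    show ?case
    proof (rule ccontr)
      assume "\<not> ?thesis"
      then obtain z where "z \<in> chain_region D s n" "\<phi> z \<notin> ball \<zeta> d" by blast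
      then have z: "z \<in> chain_region D s n" "d \<le> dist (\<phi> z) \<zeta>"
        by (auto simp: dist_commute)
      have zD: "z \<in> D" using z chain_region_subset by blast
      then have "norm (\<phi> z) < 1" using hom by (auto simp: homeomorphism_def)
      from unit_disk_minus_ball_joins_0[OF \<zeta> this z(2) d(2)]
      obtain S where S: "connected S" "0 \<in> S" "\<phi> z \<in> S" "S \<subseteq> ball 0 1" "S \<inter> ball \<zeta> d = {}" by blast
      have "connected (\<psi> ` S)"
        using hom S(1,4) by (intro connected_continuous_image) (auto simp: homeomorphism_def intro: continuous_on_subset)
      moreover have "\<psi> ` S \<subseteq> D - s n"
      proof
        fix x assume "x \<in> \<psi> ` S"
        then obtain y where y: "y \<in> S" "x = \<psi> y" by blast
        then have "\<phi> x = y" "x \<in> D" using S(4) hom by (auto simp: homeomorphism_def)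
        then show "x \<in> D - s n" using elim(1) S(5) y by blast
      qed
      moreover have "z \<in> \<psi> ` S"
        using S(3) zD hom by (auto simp: homeomorphism_def intro!: image_eqI[of _ _ "\<phi> z"])
      ultimately have "\<psi> ` S \<subseteq> chain_region D s n"
        using z(1) by (intro components_maximal[OF chain_region_component(1)]) auto
      then show False using S(2) RW elim(2) by blast
    qed
  qed
  have inter: "(\<Inter>n. closure (\<phi> ` chain_region D s n)) = {\<zeta>}"
  proof (rule antisym)
    show "(\<Inter>n. closure (\<phi> ` chain_region D s n)) \<subseteq> {\<zeta>}"
    proof
      fix w assume w: "w \<in> (\<Inter>n. closure (\<phi> ` chain_region D s n))"
      show "w \<in> {\<zeta>}"
      proof (rule ccontr)
        assume "w \<notin> {\<zeta>}"
        define d where "d = min 1 (dist \<zeta> w / 2)"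
        have d: "0 < d" "d \<le> 1" "d < dist \<zeta> w" using zero_less_dist_iff[of \<zeta> w] \<open>w \<notin> {\<zeta>}\<close> unfolding d_def min_def by auto
        obtain n where "\<phi> ` chain_region D s n \<subseteq> ball \<zeta> d"
          using Rsmall[OF d(1,2)] by (auto simp: eventually_sequentially)
        then have "closure (\<phi> ` chain_region D s n) \<subseteq> cball \<zeta> d"
          by (meson ball_subset_cball closed_cball closure_minimal order_trans)
        then show False using w d by auto
      qed
    qed
    \<comment> \<open>Later cuts lie inside every earlier region, and their images tend to
      \<zeta>.\<close>
    show "{\<zeta>} \<subseteq> (\<Inter>n. closure (\<phi> ` chain_region D s n))"
    proof (clarsimp simp: closure_approachable)
      fix n e :: real assume e: "e > 0"
      fix n :: nat
      obtain m where m: "m \<ge> Suc n" "\<phi> ` s m \<subseteq> ball \<zeta> e"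
        using small[OF e] unfolding eventually_sequentially by (meson le_cases)
      then obtain k where k: "m = Suc k" "n \<le> k" by (cases m) auto
      obtain z where z: "z \<in> s m" using sne by blast
      then have "z \<in> chain_region D s n"
        using k chain_region_component(2)[of k] chain_region_antimono[of n k] by blast
      moreover have "dist (\<phi> z) \<zeta> < e" using m(2) z by (auto simp: dist_commute)
      ultimately show "\<exists>x\<in>chain_region D s n. dist (\<phi> x) \<zeta> < e" by blast
    qed
  qed
  define p where "p = chain_equiv D `` {s}"
  have sp: "s \<in> p"
    unfolding p_def chain_equiv_def using chain by auto
  have "p \<in> prime_ends D"
    unfolding p_def prime_ends_def quotient_def using chain by auto
  then have "corresponds D \<phi> p \<zeta>"
    unfolding corresponds_def using sp inter by blast
  moreover have "converges_to_prime_end D r p"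
    unfolding converges_to_prime_end_def
  proof (intro bexI[OF _ sp])
    show "\<forall>\<^sub>F i in sequentially. \<exists>t\<in>{0..<1}. \<exists>K\<in>components (D - s i). r 0 \<notin> K \<and> r ` {t<..<1} \<subseteq> K"
      using avoid[OF ray(2)]
    proof eventually_elim
      case (elim n)
      obtain t where t: "t \<in> {0..<1}" "r ` {t<..<1} \<subseteq> W n" "r ` {t<..<1} \<inter> s (Suc n) \<noteq> {}"
        using ray(3) by blast
      \<comment> \<open>A tail of the ray is connected, misses the cut and meets the next cut, which
        lies in the chain region.\<close>
      have "connected (r ` {t<..<1})"
        using t(1) by (intro connected_continuous_image continuous_on_subset[OF ray(1)]) auto
      then have "r ` {t<..<1} \<subseteq> chain_region D s n"
        using t W(2)[of n] chain_region_component(2)[of n]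
        by (intro components_maximal[OF chain_region_component(1)]) blast+
      moreover have "r 0 \<notin> chain_region D s n" using elim RW by blast
      ultimately show ?case using t(1) chain_region_component(1) by blast
    qed
  qed
  ultimately show thesis using that by blast
qed

text \<open>A three-sided cut: two vertical walls from the level \<open>y\<close> to the boundary values \<open>e l\<close> and \<open>e r\<close>,
  joined at level \<open>y\<close>. The sign \<open>\<sigma>\<close> is \<open>1\<close> for cuts at the graph and \<open>-1\<close> for cuts at the
  real axis.\<close>
definition u_cut :: "real \<Rightarrow> (real \<Rightarrow> real) \<Rightarrow> real \<Rightarrow> real \<Rightarrow> real \<Rightarrow> complex set" where
  "u_cut \<sigma> e l r y = {z. (Re z = l \<or> Re z = r) \<and> \<sigma> * y \<le> \<sigma> * Im z \<and> \<sigma> * Im z < \<sigma> * e (Re z) \<or>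
     l \<le> Re z \<and> Re z \<le> r \<and> Im z = y}"

text \<open>The cut is a polygonal arc of three segments without its two ends. The ends sit at the
  boundary values \<open>e l\<close> and \<open>e r\<close>, where the description of
  \<open>D\<close> fails by equality, and they are limits of the walls.\<close>

lemma cross_cut_u_cut:
  assumes \<sigma>: "\<sigma> = 1 \<or> \<sigma> = - 1" and lr: "l < r"
    and D: "\<And>z. l \<le> Re z \<Longrightarrow> Re z \<le> r \<Longrightarrow> \<sigma> * y \<le> \<sigma> * Im z \<Longrightarrow> z \<in> D \<longleftrightarrow> \<sigma> * Im z < \<sigma> * e (Re z)"
    and e: "\<And>t. l \<le> t \<Longrightarrow> t \<le> r \<Longrightarrow> \<sigma> * y < \<sigma> * e t"
  shows "cross_cut D (u_cut \<sigma> e l r y)"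
proof -
  define a where "a = Complex l (e l)"
  define b where "b = Complex l y"
  define c where "c = Complex r y"
  define d where "d = Complex r (e r)"
  have el: "\<sigma> * y < \<sigma> * e l" and er: "\<sigma> * y < \<sigma> * e r" using e lr by auto
  have ne: "a \<noteq> b" "b \<noteq> c" "c \<noteq> d" using el er lr by (auto simp: a_def b_def c_def d_def)
  have ab: "closed_segment a b = {z. Re z = l \<and> \<sigma> * y \<le> \<sigma> * Im z \<and> \<sigma> * Im z \<le> \<sigma> * e l}"
    using \<sigma> el unfolding a_def b_def
    by (subst closed_segment_same_Re) (auto simp: closed_segment_eq_real_ivl)
  have bc: "closed_segment b c = {z. l \<le> Re z \<and> Re z \<le> r \<and> Im z = y}"
    using lr unfolding b_def c_def
    by (subst closed_segment_same_Im) (auto simp: closed_segment_eq_real_ivl)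
  have cd: "closed_segment c d = {z. Re z = r \<and> \<sigma> * y \<le> \<sigma> * Im z \<and> \<sigma> * Im z \<le> \<sigma> * e r}"
    using \<sigma> er unfolding c_def d_def
    by (subst closed_segment_same_Re) (auto simp: closed_segment_eq_real_ivl)
  define g where "g = linepath a b +++ (linepath b c +++ linepath c d)"
  have arc_g: "arc g"
    unfolding g_def
  proof (intro arc_join arc_linepath ne)
    show "path_image (linepath b c) \<inter> path_image (linepath c d) \<subseteq> {pathstart (linepath c d)}"
      unfolding path_image_linepath bc cd by (auto simp: c_def complex_eq_iff)
    show "path_image (linepath a b) \<inter> path_image (linepath b c +++ linepath c d) \<subseteq> {pathstart (linepath b c +++ linepath c d)}"
    proof -
      have "path_image (linepath b c +++ linepath c d) = closed_segment b c \<union> closed_segment c d"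
        by (simp add: path_image_join)
      then show ?thesis
        using lr unfolding path_image_linepath ab bc cd by (auto simp: b_def complex_eq_iff)
    qed
  qed auto
  have im_g: "path_image g = closed_segment a b \<union> closed_segment b c \<union> closed_segment c d"
    unfolding g_def by (simp add: path_image_join Un_assoc)
  have ends: "pathstart g = a" "pathfinish g = d" by (simp_all add: g_def)
  have eq: "path_image g - {a, d} = u_cut \<sigma> e l r y"
    unfolding im_g ab bc cd u_cut_def using \<sigma> el er lr
    by (auto simp: a_def d_def complex_eq_iff)
  let ?s = "u_cut \<sigma> e l r y"
  have sD: "?s \<subseteq> D"
    using D e lr unfolding u_cut_def by auto
  have inj: "inj_on to_sphere A" for A using to_sphere_inj inj_on_subset by blast
  have "arc (to_sphere \<circ> g)"
    using arc_g inj unfolding arc_def by (auto intro: path_continuous_image continuous_on_to_sphere comp_inj_on)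
  then have simp: "simple_path (to_sphere \<circ> g)" by (rule arc_imp_simple_path)
  have ends': "pathstart (to_sphere \<circ> g) = to_sphere a" "pathfinish (to_sphere \<circ> g) = to_sphere d"
    using ends by (simp_all add: pathstart_compose pathfinish_compose)
  have "(to_sphere \<circ> g) ` {0<..<1} = path_image (to_sphere \<circ> g) - {to_sphere a, to_sphere d}"
    using simple_path_endless[OF simp] ends' by simp
  also have "\<dots> = to_sphere ` (path_image g - {a, d})"
    using to_sphere_inj by (simp add: path_image_compose image_set_diff)
  finally have im: "(to_sphere \<circ> g) ` {0<..<1} = to_sphere ` ?s" using eq by simp
  have sphere_closure: "to_sphere z \<in> closure (to_sphere ` D)" if "z \<in> closure D" for z
  proof -
    have "to_sphere ` closure D \<subseteq> closure (to_sphere ` D)"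
      by (intro image_closure_subset continuous_on_to_sphere closure_subset) auto
    then show ?thesis using that by blast
  qed
  have "a \<in> closure (open_segment a b)" "d \<in> closure (open_segment c d)"
    using ne by (simp_all add: closure_open_segment)
  moreover have "open_segment a b \<subseteq> D" "open_segment c d \<subseteq> D"
  proof -
    have "a \<notin> closed_segment c d" "d \<notin> closed_segment a b" using lr unfolding ab cd by (auto simp: a_def d_def)
    then have "open_segment a b \<subseteq> path_image g - {a, d}" "open_segment c d \<subseteq> path_image g - {a, d}"
      unfolding im_g open_segment_def by auto
    then show "open_segment a b \<subseteq> D" "open_segment c d \<subseteq> D" using sD eq by auto
  qed
  ultimately have "a \<in> closure D" "d \<in> closure D" using closure_mono by blast+
  moreover have "a \<notin> D" "d \<notin> D"
    using D[of a] D[of d] el er lr by (auto simp: a_def d_def)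
  ultimately have "{to_sphere a, to_sphere d} \<subseteq> closure (to_sphere ` D) - to_sphere ` D"
    using sphere_closure to_sphere_inj by (auto simp: inj_image_mem_iff)
  then show ?thesis
    unfolding cross_cut_def using sD simp im ends' by metis
qed

text \<open>The walls have finite height, so the set on the right is compact in the plane and its
  image is closed on the sphere; no limit at infinity appears.\<close>

lemma closure_to_sphere_u_cut:
  assumes \<sigma>: "\<sigma> = 1 \<or> \<sigma> = - 1"
  shows "closure (to_sphere ` u_cut \<sigma> e l r y) \<subseteq>
     to_sphere ` {z. (Re z = l \<or> Re z = r) \<and> \<sigma> * y \<le> \<sigma> * Im z \<and> \<sigma> * Im z \<le> \<sigma> * e (Re z) \<or>
     l \<le> Re z \<and> Re z \<le> r \<and> Im z = y}" (is "_ \<subseteq> to_sphere ` ?S")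
proof (rule closure_minimal)
  show "to_sphere ` u_cut \<sigma> e l r y \<subseteq> to_sphere ` ?S"
    by (intro image_mono) (auto simp: u_cut_def)
  have S: "?S = ({z. Re z = l} \<inter> {z. \<sigma> * y \<le> \<sigma> * Im z} \<inter> {z. \<sigma> * Im z \<le> \<sigma> * e l}) \<union>
     ({z. Re z = r} \<inter> {z. \<sigma> * y \<le> \<sigma> * Im z} \<inter> {z. \<sigma> * Im z \<le> \<sigma> * e r}) \<union>
     ({z. l \<le> Re z} \<inter> {z. Re z \<le> r} \<inter> {z. Im z = y})" by auto
  have "closed ?S"
    unfolding S
    by (intro closed_Un closed_Int closed_Collect_eq closed_Collect_le continuous_intros)
  moreover have "bounded ?S"
  proof (rule boundedI)
    fix z assume "z \<in> ?S"
    then have "\<bar>Re z\<bar> \<le> \<bar>l\<bar> + \<bar>r\<bar>" "\<bar>Im z\<bar> \<le> \<bar>y\<bar> + \<bar>e l\<bar> + \<bar>e r\<bar>" using \<sigma> by auto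
    then show "norm z \<le> (\<bar>l\<bar> + \<bar>r\<bar>) + (\<bar>y\<bar> + \<bar>e l\<bar> + \<bar>e r\<bar>)"
      using cmod_le[of z] by linarith
  qed
  ultimately show "closed (to_sphere ` ?S)"
    by (intro compact_imp_closed compact_continuous_image continuous_on_to_sphere) (simp add: compact_eq_bounded_closed)
qed

text \<open>Nested three-sided cuts close in on the boundary point at height \<open>e x\<close>,
  with walls at \<open>l n\<close> and \<open>r n\<close> and the connecting side at level
  \<open>y n\<close>. Beyond this level, over \<open>[l n, r n]\<close>, the domain is exactly the
  part short of the graph of \<open>e\<close>, so the inside of a cut is given by three strict
  inequalities. The sign \<sigma> treats the top and the bottom of the fibre at once.\<close>

lemma prime_end_at_fibre_end:
  assumes D: "open D" "connected D" and hom: "homeomorphism D (ball 0 1) \<phi> \<psi>"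
    and \<sigma>: "\<sigma> = 1 \<or> \<sigma> = - 1"
    and l: "strict_mono l" "l \<longlonglongrightarrow> x" "\<And>n. l n < x"
    and r: "\<And>n. r (Suc n) < r n" "r \<longlonglongrightarrow> x" "\<And>n. x < r n"
    and y: "strict_mono (\<lambda>n. \<sigma> * y n)" "y \<longlonglongrightarrow> e x"
    and e: "(\<lambda>n. e (l n)) \<longlonglongrightarrow> e x" "(\<lambda>n. e (r n)) \<longlonglongrightarrow> e x"
    and H: "\<And>n z. l n \<le> Re z \<Longrightarrow> Re z \<le> r n \<Longrightarrow> \<sigma> * y n \<le> \<sigma> * Im z \<Longrightarrow> z \<in> D \<longleftrightarrow> \<sigma> * Im z < \<sigma> * e (Re z)"
    and He: "\<And>n t. l n \<le> t \<Longrightarrow> t \<le> r n \<Longrightarrow> \<sigma> * y n < \<sigma> * e t"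
    and \<zeta>: "norm \<zeta> = 1"
    and small: "\<And>d. 0 < d \<Longrightarrow> \<forall>\<^sub>F n in sequentially. \<phi> ` u_cut \<sigma> e (l n) (r n) (y n) \<subseteq> ball \<zeta> d"
    and v0: "\<sigma> * v0 \<le> \<sigma> * y 0" and ray: "Complex x v0 \<in> D"
  obtains p where "corresponds D \<phi> p \<zeta>" "converges_to_prime_end D (\<lambda>\<tau>. Complex x (v0 + \<tau> * (e x - v0))) p"
proof -
  define s where "s n = u_cut \<sigma> e (l n) (r n) (y n)" for n
  define W where "W n = {z \<in> D. l n < Re z \<and> Re z < r n \<and> \<sigma> * y n < \<sigma> * Im z}" for n
  let ?r = "\<lambda>\<tau>. Complex x (v0 + \<tau> * (e x - v0))"
  have lS: "l n < l (Suc n)" and yS: "\<sigma> * y n < \<sigma> * y (Suc n)" for n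
    using l(1) y(1) by (auto simp: strict_mono_Suc_iff)
  have lr: "l n < r n" for n using l(3) r(3) less_trans by blast
  have r_mono: "r n \<le> r m" if "m \<le> n" for m n
    using lift_Suc_antimono_le[of r] r(1) that by (meson less_imp_le)
  have yx: "\<sigma> * y n < \<sigma> * e x" for n
    using He l(3) r(3) less_imp_le by blast
  have cut: "cross_cut D (s n)" for n
    unfolding s_def by (intro cross_cut_u_cut \<sigma> lr H He)
  have sD: "s n \<subseteq> D" for n using cross_cut_props(1)[OF cut] .
  have sep: "s m \<inter> (W n \<union> s n) = {}" if "m < n" for m n
  proof -
    have "l m < l n" "\<sigma> * y m < \<sigma> * y n" using that l(1) y(1) by (auto simp: strict_mono_def)
    moreover have "r n < r m" using r(1)[of m] r_mono[of "Suc m" n] that by simp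
    ultimately show ?thesis using lr[of m] lr[of n] unfolding s_def u_cut_def W_def by auto
  qed
  \<comment> \<open>The outside of a cut is also given by strict inequalities, so both sides are
    open.\<close>
  have D_diff: "D - s n - W n = D \<inter> ({z. Re z < l n} \<union> {z. r n < Re z} \<union> {z. \<sigma> * Im z < \<sigma> * y n})" for n
  proof (intro equalityI subsetI)
    fix z assume z: "z \<in> D - s n - W n"
    show "z \<in> D \<inter> ({z. Re z < l n} \<union> {z. r n < Re z} \<union> {z. \<sigma> * Im z < \<sigma> * y n})"
    proof (rule ccontr)
      assume "\<not> ?thesis"
      then have *: "l n \<le> Re z" "Re z \<le> r n" "\<sigma> * y n \<le> \<sigma> * Im z" "z \<in> D" using z by auto
      then have "\<sigma> * Im z < \<sigma> * e (Re z)" using H by blast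
      moreover have "Im z = y n \<or> \<sigma> * y n < \<sigma> * Im z" using *(3) \<sigma> by auto
      ultimately have "z \<in> s n \<or> z \<in> W n"
        using * unfolding s_def u_cut_def W_def by auto
      then show False using z by blast
    qed
  next
    fix z assume "z \<in> D \<inter> ({z. Re z < l n} \<union> {z. r n < Re z} \<union> {z. \<sigma> * Im z < \<sigma> * y n})"
    then show "z \<in> D - s n - W n"
      using lr[of n] unfolding s_def u_cut_def W_def by auto
  qed
  \<comment> \<open>The walls shrink to the boundary point because \<open>e (l n)\<close> and
    \<open>e (r n)\<close> tend to \<open>e x\<close>; for a semicontinuous graph this depends on
    the choice of the walls.\<close>
  have near: "\<forall>\<^sub>F n in sequentially. s n \<subseteq> ball (Complex x (e x)) d" if d: "0 < d" for d
  proof -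
    obtain d' where d': "0 < d'" "d = d' + d'" using d by (metis field_sum_of_halves half_gt_zero)
    have "\<forall>\<^sub>F n in sequentially. dist (l n) x < d'" "\<forall>\<^sub>F n in sequentially. dist (r n) x < d'"
      "\<forall>\<^sub>F n in sequentially. dist (y n) (e x) < d'"
      "\<forall>\<^sub>F n in sequentially. dist (e (l n)) (e x) < d'" "\<forall>\<^sub>F n in sequentially. dist (e (r n)) (e x) < d'"
      using d'(1) by (intro tendstoD l(2) r(2) y(2) e; assumption)+
    then show ?thesis
    proof eventually_elim
      case (elim n)
      show ?case
      proof
        fix z assume "z \<in> s n"
        then have "\<bar>Re z - x\<bar> < d'" "\<bar>Im z - e x\<bar> < d'"
          using elim \<sigma> l(3)[of n] r(3)[of n] unfolding s_def u_cut_def dist_real_def abs_less_iff by auto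
        then have "norm (z - Complex x (e x)) < d"
          using cmod_le[of "z - Complex x (e x)"] by (simp add: d'(2))
        then show "z \<in> ball (Complex x (e x)) d" by (simp add: dist_norm norm_minus_commute)
      qed
    qed
  qed
  have sW: "s (Suc n) \<subseteq> W n" for n
  proof
    fix z assume z: "z \<in> s (Suc n)"
    then have "z \<in> D" using sD by blast
    moreover have "l (Suc n) \<le> Re z" "Re z \<le> r (Suc n)" "\<sigma> * y (Suc n) \<le> \<sigma> * Im z"
      using z lr[of "Suc n"] unfolding s_def u_cut_def by auto
    ultimately show "z \<in> W n" using lS[of n] yS[of n] r(1)[of n] unfolding W_def by auto
  qed
  obtain p where "corresponds D \<phi> p \<zeta>" "converges_to_prime_end D ?r p"
  proof (rule prime_end_of_cross_cuts[OF D hom cut, where W=W and \<zeta>=\<zeta> and r="?r"])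
    fix n
    show "closure (to_sphere ` s n) \<inter> closure (to_sphere ` s (Suc n)) = {}"
    proof -
      define S where "S m = {z. (Re z = l m \<or> Re z = r m) \<and> \<sigma> * y m \<le> \<sigma> * Im z \<and> \<sigma> * Im z \<le> \<sigma> * e (Re z) \<or>
           l m \<le> Re z \<and> Re z \<le> r m \<and> Im z = y m}" for m
      have "\<not> (l n < Re z \<and> Re z < r n \<and> \<sigma> * y n < \<sigma> * Im z)" if "z \<in> S n" for z
        using that unfolding S_def by auto
      moreover have "l n < Re z \<and> Re z < r n \<and> \<sigma> * y n < \<sigma> * Im z" if "z \<in> S (Suc n)" for z
        using that lS[of n] yS[of n] r(1)[of n] lr[of "Suc n"] unfolding S_def by auto
      ultimately have "S n \<inter> S (Suc n) = {}" by blast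
      then have "to_sphere ` S n \<inter> to_sphere ` S (Suc n) = {}"
        unfolding image_Int[OF to_sphere_inj, symmetric] by simp
      have "closure (to_sphere ` s m) \<subseteq> to_sphere ` S m" for m
        unfolding s_def S_def by (rule closure_to_sphere_u_cut[OF \<sigma>])
      from this[of n] this[of "Suc n"] \<open>to_sphere ` S n \<inter> _ = {}\<close> show ?thesis by blast
    qed
    have "open {z. l n < Re z}" "open {z. Re z < r n}" "open {z. \<sigma> * y n < \<sigma> * Im z}"
      "open {z. Re z < l n}" "open {z. r n < Re z}" "open {z. \<sigma> * Im z < \<sigma> * y n}"
      by (intro open_Collect_less continuous_intros)+
    moreover have "W n = D \<inter> {z. l n < Re z} \<inter> {z. Re z < r n} \<inter> {z. \<sigma> * y n < \<sigma> * Im z}" by (auto simp: W_def)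
    ultimately show "open (W n)" "open (D - s n - W n)"
      unfolding D_diff using D(1) by (auto intro: open_Int open_Un)
    show "W n \<subseteq> D - s n" by (auto simp: W_def s_def u_cut_def)
    show "s (Suc n) \<subseteq> W n" by (rule sW)
    show "s 0 \<inter> (W n \<union> s n) = {}" if "1 \<le> n" using sep[of 0 n] that by simp
    show "\<exists>t\<in>{0..<1}. ?r ` {t<..<1} \<subseteq> W n \<and> ?r ` {t<..<1} \<inter> s (Suc n) \<noteq> {}"
    proof -
      have mono: "\<sigma> * y 0 \<le> \<sigma> * y m" for m
        using strict_mono_less_eq[OF y(1), of 0 m] by simp
      have pos: "0 < \<sigma> * (e x - v0)" using yx[of 0] v0 by (simp add: right_diff_distrib)
      \<comment> \<open>The parameter at which the ray reaches level \<open>y m\<close>. Multiplying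
        by \<sigma> makes numerator nonnegative and denominator positive.\<close>
      define t where "t m = \<sigma> * (y m - v0) / (\<sigma> * (e x - v0))" for m
      have t_eq: "t m * (\<sigma> * (e x - v0)) = \<sigma> * (y m - v0)" for m
      proof -
        have "\<sigma> * (e x - v0) \<noteq> 0" using pos by linarith
        then show ?thesis unfolding t_def times_divide_eq_left by (rule nonzero_mult_div_cancel_right)
      qed
      have t01: "0 \<le> t m" "t m < 1" for m
      proof -
        have "0 \<le> \<sigma> * (y m - v0)" "\<sigma> * (y m - v0) < \<sigma> * (e x - v0)"
          using mono[of m] v0 yx[of m] by (simp_all add: right_diff_distrib)
        then show "0 \<le> t m" "t m < 1" using pos unfolding t_def by (simp_all only: zero_le_divide_iff divide_less_eq_1_pos less_imp_le simp_thms)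
      qed
      have tS: "t n < t (Suc n)"
        using pos yS[of n] unfolding t_def by (intro divide_strict_right_mono) (auto simp: right_diff_distrib)
      have "?r \<tau> \<in> W n" if \<tau>: "t n < \<tau>" "\<tau> < 1" for \<tau>
      proof -
        have "t n * (\<sigma> * (e x - v0)) < \<tau> * (\<sigma> * (e x - v0))" using \<tau> pos by (intro mult_strict_right_mono)
        then have 1: "\<sigma> * y n < \<sigma> * (v0 + \<tau> * (e x - v0))"
          unfolding t_eq by (simp add: algebra_simps)
        have "\<tau> * (\<sigma> * (e x - v0)) < 1 * (\<sigma> * (e x - v0))" using \<tau> pos by (intro mult_strict_right_mono)
        then have 2: "\<sigma> * (v0 + \<tau> * (e x - v0)) < \<sigma> * e x" by (simp add: algebra_simps)
        show ?thesis using 1 2 H[of n "?r \<tau>"] l(3)[of n] r(3)[of n] unfolding W_def by auto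
      qed
      moreover have "?r (t (Suc n)) \<in> s (Suc n)"
      proof -
        have "\<sigma> * (t (Suc n) * (e x - v0)) = \<sigma> * (y (Suc n) - v0)" using t_eq[of "Suc n"] by (simp add: algebra_simps)
        then have "t (Suc n) * (e x - v0) = y (Suc n) - v0" using \<sigma> by auto
        then show ?thesis using l(3)[of "Suc n"] r(3)[of "Suc n"] unfolding s_def u_cut_def by auto
      qed
      moreover have "t (Suc n) \<in> {t n<..<1}" using tS t01 by auto
      ultimately have "?r ` {t n<..<1} \<subseteq> W n" "?r ` {t n<..<1} \<inter> s (Suc n) \<noteq> {}" by fastforce+
      then show ?thesis using t01[of n] by (intro bexI[of _ "t n"]) auto
    qed
  next
    show "(\<lambda>n. diameter (to_sphere ` s n)) \<longlonglongrightarrow> 0"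
    proof (rule LIMSEQ_I)
      fix \<epsilon> :: real assume \<epsilon>: "0 < \<epsilon>"
      let ?c = "Complex x (e x)"
      obtain d where d: "0 < d" "\<And>z. dist z ?c < d \<Longrightarrow> dist (to_sphere z) (to_sphere ?c) < \<epsilon> / 4"
        using continuous_on_to_sphere[of UNIV] \<epsilon> unfolding continuous_on_iff by (metis UNIV_I divide_pos_pos zero_less_numeral)
      obtain N where N: "\<And>n. n \<ge> N \<Longrightarrow> s n \<subseteq> ball ?c d"
        using near[OF d(1)] unfolding eventually_sequentially by blast
      have "norm (diameter (to_sphere ` s n) - 0) < \<epsilon>" if "n \<ge> N" for n
      proof -
        have sub: "to_sphere ` s n \<subseteq> ball (to_sphere ?c) (\<epsilon> / 4)"
          using N[OF that] d(2) by (auto simp: dist_commute)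
        have "diameter (to_sphere ` s n) \<le> diameter (ball (to_sphere ?c) (\<epsilon> / 4))"
          using sub by (intro diameter_subset) auto
        also have "\<dots> = \<epsilon> / 2" using \<epsilon> by simp
        finally have "diameter (to_sphere ` s n) \<le> \<epsilon> / 2" .
        moreover have "0 \<le> diameter (to_sphere ` s n)"
          using sub by (intro diameter_ge_0) (meson bounded_ball bounded_subset)
        ultimately show ?thesis using \<epsilon> by simp
      qed
      then show "\<exists>N. \<forall>n\<ge>N. norm (diameter (to_sphere ` s n) - 0) < \<epsilon>" by blast
    qed
    show "\<forall>\<^sub>F n in sequentially. z \<notin> W n" if "z \<in> D" for z
    proof (cases "Re z = x")
      case False
      then consider "Re z < x" | "x < Re z" by linarith
      then show ?thesis
      proof cases
        case 1
        then have "\<forall>\<^sub>F n in sequentially. Re z < l n" using l(2) by (simp add: order_tendsto_iff)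
        then show ?thesis by eventually_elim (auto simp: W_def)
      next
        case 2
        then have "\<forall>\<^sub>F n in sequentially. r n < Re z" using r(2) by (simp add: order_tendsto_iff)
        then show ?thesis by eventually_elim (auto simp: W_def)
      qed
    next
      case True
      have "\<forall>\<^sub>F n in sequentially. \<sigma> * Im z \<le> \<sigma> * y n"
      proof (cases "\<sigma> * Im z < \<sigma> * e x")
        case True
        have "(\<lambda>n. \<sigma> * y n) \<longlonglongrightarrow> \<sigma> * e x" using y(2) by (intro tendsto_intros)
        then have "\<forall>\<^sub>F n in sequentially. \<sigma> * Im z < \<sigma> * y n" using True by (simp add: order_tendsto_iff)
        then show ?thesis by eventually_elim simp
      next
        case False
        then have "\<sigma> * y 0 \<le> \<sigma> * Im z" using yx[of 0] by linarith
        then have "z \<notin> D" using H[of 0 z] False l(3)[of 0] r(3)[of 0] \<open>Re z = x\<close> by auto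
        then show ?thesis using that by simp
      qed
      then show ?thesis by eventually_elim (auto simp: W_def)
    qed
    show "continuous_on {0..<1} ?r" unfolding Complex_eq by (intro continuous_intros)
    show "?r 0 \<in> D" using ray by simp
    show "norm \<zeta> = 1" by fact
    show "\<forall>\<^sub>F n in sequentially. \<phi> ` s n \<subseteq> ball \<zeta> d" if "0 < d" for d
      using small[OF that] by (simp add: s_def)
  qed
  then show thesis using that by blast
qed

subsection \<open>The Riemann map on vertical fibres\<close>

text \<open>The fundamental theorem of calculus and Cauchy-Schwarz, with the length factor reduced
  to the set \<open>S\<close> carrying the derivative. For \<open>S = UNIV\<close> this is a Hoelder
  estimate along a fibre; for small \<open>S\<close> it forces large energy when a bump changes by
  1.\<close>

lemma norm_diff_sq_le_nn_integral:
  fixes h h' :: "real \<Rightarrow> 'a::euclidean_space"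
  assumes ab: "a \<le> b" and S: "S \<in> sets borel"
    and der: "\<And>t. t \<in> {a..b} \<Longrightarrow> (h has_vector_derivative h' t) (at t within {a..b})"
    and cont: "continuous_on {a..b} h'"
    and zero: "\<And>t. t \<in> {a..b} \<Longrightarrow> t \<notin> S \<Longrightarrow> h' t = 0"
  shows "ennreal ((norm (h b - h a))\<^sup>2) \<le> emeasure lborel (S \<inter> {a..b}) * (\<integral>\<^sup>+ t \<in> {a..b}. ennreal ((norm (h' t))\<^sup>2) \<partial>lborel)"
proof -
  have int: "(h' has_integral (h b - h a)) {a..b}"
    using ab der by (intro fundamental_theorem_of_calculus) auto
  have nint: "(\<lambda>t. norm (h' t)) integrable_on {a..b}"
    using cont by (intro integrable_continuous_real continuous_intros)
  have "norm (h b - h a) \<le> integral {a..b} (\<lambda>t. norm (h' t))"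
    using integral_norm_bound_integral[OF has_integral_integrable[OF int] nint] int by (simp add: integral_unique)
  moreover have "(\<integral>\<^sup>+ t. ennreal (indicator {a..b} t * norm (h' t)) \<partial>lborel) = ennreal (integral {a..b} (\<lambda>t. norm (h' t)))"
    using nint by (intro nn_integral_has_integral_lebesgue) (auto simp: integrable_integral)
  ultimately have le: "ennreal (norm (h b - h a)) \<le> (\<integral>\<^sup>+ t. ennreal (indicator {a..b} t * norm (h' t)) \<partial>lborel)"
    by (simp add: ennreal_leI)
  define k where "k t = ennreal (indicator {a..b} t * norm (h' t))" for t
  have k_meas [measurable]: "k \<in> borel_measurable borel"
  proof -
    have "(\<lambda>t. indicator {a..b} t *\<^sub>R norm (h' t)) \<in> borel_measurable borel"
      using cont by (intro borel_measurable_continuous_on_indicator continuous_intros) auto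
    then show ?thesis unfolding k_def by simp
  qed
  have [measurable]: "S \<inter> {a..b} \<in> sets borel" using S by auto
  have "ennreal ((norm (h b - h a))\<^sup>2) = (ennreal (norm (h b - h a)))\<^sup>2"
    by (simp add: ennreal_power)
  also have "\<dots> \<le> (\<integral>\<^sup>+ t. k t \<partial>lborel)\<^sup>2"
    using le unfolding k_def by (intro power_mono) auto
  also have "(\<integral>\<^sup>+ t. k t \<partial>lborel) = (\<integral>\<^sup>+ t. indicator (S \<inter> {a..b}) t * k t \<partial>lborel)"
    using zero by (intro nn_integral_cong) (auto simp: k_def indicator_def)
  also have "\<dots>\<^sup>2 \<le> (\<integral>\<^sup>+ t. (indicator (S \<inter> {a..b}) t)\<^sup>2 \<partial>lborel) * (\<integral>\<^sup>+ t. (k t)\<^sup>2 \<partial>lborel)"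
    by (intro Cauchy_Schwarz_nn_integral) (use S in auto)
  also have "(\<integral>\<^sup>+ t. (indicator (S \<inter> {a..b}) t :: ennreal)\<^sup>2 \<partial>lborel) = (\<integral>\<^sup>+ t. indicator (S \<inter> {a..b}) t \<partial>lborel)"
    by (intro nn_integral_cong) (auto simp: indicator_def)
  also have "\<dots> = emeasure lborel (S \<inter> {a..b})" using S by simp
  also have "(\<integral>\<^sup>+ t. (k t)\<^sup>2 \<partial>lborel) = (\<integral>\<^sup>+ t \<in> {a..b}. ennreal ((norm (h' t))\<^sup>2) \<partial>lborel)"
    by (intro nn_integral_cong) (auto simp: k_def indicator_def ennreal_power)
  finally show ?thesis .
qed

text \<open>To a bad point attach a scale \<open>1 / (n + 1)\<close> at which it is bad and the grid
  cell of \<open>(x, p x, q x)\<close> at that scale. Two bad points with the same code would be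
  close in all three coordinates, and the smaller would contradict the badness of the larger. So the
  code is injective into a countable type, for arbitrary functions \<open>p\<close> and
  \<open>q\<close>.\<close>

lemma countable_not_left_accumulated:
  fixes p q :: "real \<Rightarrow> real"
  shows "countable {x. \<exists>\<delta>>0. \<forall>x'. x - \<delta> < x' \<and> x' < x \<longrightarrow> \<not> (\<bar>p x' - p x\<bar> < \<delta> \<and> \<bar>q x' - q x\<bar> < \<delta>)}"
    (is "countable ?S")
proof -
  define bad where "bad n x \<longleftrightarrow> (\<forall>x'. x - inverse (real (Suc n)) < x' \<and> x' < x \<longrightarrow>
      \<not> (\<bar>p x' - p x\<bar> < inverse (real (Suc n)) \<and> \<bar>q x' - q x\<bar> < inverse (real (Suc n))))" for n x
  have ex: "\<exists>n. bad n x" if "x \<in> ?S" for x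
  proof -
    obtain \<delta> where \<delta>: "\<delta> > 0" "\<And>x'. x - \<delta> < x' \<Longrightarrow> x' < x \<Longrightarrow> \<not> (\<bar>p x' - p x\<bar> < \<delta> \<and> \<bar>q x' - q x\<bar> < \<delta>)"
      using \<open>x \<in> ?S\<close> by blast
    obtain n where n: "inverse (real (Suc n)) < \<delta>" using reals_Archimedean[OF \<delta>(1)] by blast
    have "bad n x"
      unfolding bad_def
    proof (intro allI impI notI)
      fix x' assume a: "x - inverse (real (Suc n)) < x' \<and> x' < x"
        "\<bar>p x' - p x\<bar> < inverse (real (Suc n)) \<and> \<bar>q x' - q x\<bar> < inverse (real (Suc n))"
      show False using \<delta>(2)[of x'] a n by linarith
    qed
    then show ?thesis by blast
  qed
  define N where "N x = (SOME n. bad n x)" for x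
  define code where "code x = (N x, \<lfloor>real (Suc (N x)) * x\<rfloor>, \<lfloor>real (Suc (N x)) * p x\<rfloor>, \<lfloor>real (Suc (N x)) * q x\<rfloor>)" for x
  have close: "\<bar>u - v\<bar> < inverse (real (Suc n))" if "\<lfloor>real (Suc n) * u\<rfloor> = \<lfloor>real (Suc n) * v\<rfloor>" for u v n
  proof -
    have "\<bar>real (Suc n) * u - real (Suc n) * v\<bar> < 1" using that by linarith
    then have "real (Suc n) * \<bar>u - v\<bar> < 1" by (simp add: abs_mult flip: right_diff_distrib)
    then show ?thesis by (simp add: field_simps)
  qed
  have "x = x'" if x: "x \<in> ?S" "x' \<in> ?S" "code x = code x'" for x x'
  proof (rule ccontr)
    assume "x \<noteq> x'"
    have aux: False if "u \<in> ?S" "v \<in> ?S" "code u = code v" "u < v" for u v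
    proof -
      have N: "N u = N v" using that(3) by (simp add: code_def)
      have "bad (N v) v" unfolding N_def using ex[OF that(2)] by (rule someI_ex)
      moreover have "\<bar>u - v\<bar> < inverse (real (Suc (N v)))" "\<bar>p u - p v\<bar> < inverse (real (Suc (N v)))"
          "\<bar>q u - q v\<bar> < inverse (real (Suc (N v)))"
      proof -
        have "\<lfloor>real (Suc (N v)) * u\<rfloor> = \<lfloor>real (Suc (N v)) * v\<rfloor>" "\<lfloor>real (Suc (N v)) * p u\<rfloor> = \<lfloor>real (Suc (N v)) * p v\<rfloor>"
          "\<lfloor>real (Suc (N v)) * q u\<rfloor> = \<lfloor>real (Suc (N v)) * q v\<rfloor>"
          using that(3) N unfolding code_def by simp_all
        show "\<bar>u - v\<bar> < inverse (real (Suc (N v)))" "\<bar>p u - p v\<bar> < inverse (real (Suc (N v)))"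
          "\<bar>q u - q v\<bar> < inverse (real (Suc (N v)))" by (fact close[OF \<open>\<lfloor>_ * u\<rfloor> = _\<close>] close[OF \<open>\<lfloor>_ * p u\<rfloor> = _\<close>] close[OF \<open>\<lfloor>_ * q u\<rfloor> = _\<close>])+
      qed
      ultimately show False using \<open>u < v\<close> unfolding bad_def by (auto simp: abs_if)
    qed
    show False using aux[of x x'] aux[of x' x] x \<open>x \<noteq> x'\<close> by (metis linorder_neq_iff)
  qed
  then have "inj_on code ?S" by (intro inj_onI) blast
  then show ?thesis by (rule countableI')
qed

lemma countable_not_right_accumulated:
  fixes p q :: "real \<Rightarrow> real"
  shows "countable {x. \<exists>\<delta>>0. \<forall>x'. x < x' \<and> x' < x + \<delta> \<longrightarrow> \<not> (\<bar>p x' - p x\<bar> < \<delta> \<and> \<bar>q x' - q x\<bar> < \<delta>)}"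
    (is "countable ?S")
proof -
  let ?T = "{x. \<exists>\<delta>>0. \<forall>x'. x - \<delta> < x' \<and> x' < x \<longrightarrow> \<not> (\<bar>p (- x') - p (- x)\<bar> < \<delta> \<and> \<bar>q (- x') - q (- x)\<bar> < \<delta>)}"
  have "countable (uminus ` ?T)"
    using countable_not_left_accumulated[of "\<lambda>x. p (- x)" "\<lambda>x. q (- x)"] by (rule countable_image)
  moreover have "?S \<subseteq> uminus ` ?T"
  proof
    fix x assume "x \<in> ?S"
    then obtain \<delta> where \<delta>: "\<delta> > 0" "\<And>x'. x < x' \<Longrightarrow> x' < x + \<delta> \<Longrightarrow> \<not> (\<bar>p x' - p x\<bar> < \<delta> \<and> \<bar>q x' - q x\<bar> < \<delta>)"
      by blast
    have "\<not> (\<bar>p (- x') - p (- (- x))\<bar> < \<delta> \<and> \<bar>q (- x') - q (- (- x))\<bar> < \<delta>)" if "- x - \<delta> < x'" "x' < - x" for x'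
      using \<delta>(2)[of "- x'"] that by simp
    then have "- x \<in> ?T" using \<delta>(1) by (intro CollectI exI[of _ \<delta>]) simp
    then have "- (- x) \<in> uminus ` ?T" by (rule imageI)
    then show "x \<in> uminus ` ?T" by simp
  qed
  ultimately show ?thesis by (rule countable_subset[rotated])
qed

lemma strict_mono_selection:
  fixes x :: real
  assumes "\<And>n a. a < x \<Longrightarrow> \<exists>l. a < l \<and> l < x \<and> P n l"
  obtains l where "strict_mono l" "l \<longlonglongrightarrow> x" "\<And>n. l n < x" "\<And>n. P n (l n)"
proof -
  define Q where "Q n l \<longleftrightarrow> l < x \<and> P n l \<and> x - inverse (real (Suc n)) < l" for n l
  have "\<exists>l. \<forall>n. Q n (l n) \<and> l n < l (Suc n)"
  proof (rule dependent_nat_choice)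
    show "\<exists>l. Q 0 l" using assms[of "x - 1" 0] by (auto simp: Q_def)
    fix l n assume "Q n l"
    then have "max l (x - inverse (real (Suc (Suc n)))) < x" by (simp add: Q_def)
    from assms[OF this, of "Suc n"] show "\<exists>l'. Q (Suc n) l' \<and> l < l'" by (auto simp: Q_def)
  qed
  then obtain l where l: "\<And>n. Q n (l n)" "\<And>n. l n < l (Suc n)" by blast
  have "l \<longlonglongrightarrow> x"
  proof (rule tendsto_sandwich)
    show "\<forall>\<^sub>F n in sequentially. x - inverse (real (Suc n)) \<le> l n" "\<forall>\<^sub>F n in sequentially. l n \<le> x"
      using l(1) by (auto simp: Q_def intro!: always_eventually less_imp_le)
    show "(\<lambda>n. x - inverse (real (Suc n))) \<longlonglongrightarrow> x"
      using tendsto_diff[OF tendsto_const LIMSEQ_inverse_real_of_nat, of x] by simp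
  qed simp
  then show thesis using that[of l] l by (auto simp: Q_def strict_mono_Suc_iff)
qed

lemma has_vector_derivative_fibre:
  assumes "(h has_derivative h') (at (Complex x y))"
  shows "((\<lambda>t. h (Complex x t)) has_vector_derivative h' \<i>) (at y within T)"
proof -
  have "((\<lambda>t. Complex x t) has_derivative (\<lambda>t. t *\<^sub>R \<i>)) (at y within T)"
    unfolding Complex_eq by (auto intro!: derivative_eq_intros simp: scaleR_conv_of_real)
  then have "((\<lambda>t. h (Complex x t)) has_derivative (\<lambda>t. h' (t *\<^sub>R \<i>))) (at y within T)"
    using assms by (rule has_derivative_compose)
  moreover have "h' (t *\<^sub>R \<i>) = t *\<^sub>R h' \<i>" for t
    using has_derivative_linear[OF assms] by (rule linear_scale)
  ultimately show ?thesis unfolding has_vector_derivative_def by simp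
qed

section \<open>The Riemann map of the domain under the graph\<close>

locale under_graph_map =
  fixes A B :: ereal and f :: "real \<Rightarrow> real" and D :: "complex set" and \<phi> :: "complex \<Rightarrow> complex"
  assumes pos: "\<And>x. x \<in> ereal_interval A B \<Longrightarrow> 0 < f x"
    and lsc: "lower_semicontinuous_on (ereal_interval A B) f"
    and D_eq: "D = under_graph A B f"
    and area: "emeasure lborel D < \<infinity>"
    and rm: "riemann_map D \<phi>"
begin

abbreviation base :: "real set" where "base \<equiv> ereal_interval A B"

lemma open_base: "open base"
proof -
  have "base = ereal -` {A<..<B}" by (auto simp: ereal_interval_def)
  moreover have "open (ereal -` {A<..<B})"
    by (intro open_vimage open_greaterThanLessThan continuous_on_ereal continuous_on_id)
  ultimately show ?thesis by simp
qed

lemma mem_D: "z \<in> D \<longleftrightarrow> Re z \<in> base \<and> 0 < Im z \<and> Im z < f (Re z)"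
  by (simp add: D_eq under_graph_def)

lemma lsc_nbhd:
  assumes "x \<in> base" "c < f x"
  obtains d where "0 < d" "\<And>t. \<bar>t - x\<bar> < d \<Longrightarrow> t \<in> base \<and> c < f t"
proof -
  have "\<forall>\<^sub>F t in at x within base. c < f t"
    using lsc assms unfolding lower_semicontinuous_on_def by blast
  then obtain d1 where d1: "d1 > 0" "\<And>t. t \<in> base \<Longrightarrow> t \<noteq> x \<Longrightarrow> dist t x < d1 \<Longrightarrow> c < f t"
    unfolding eventually_at by blast
  obtain d2 where d2: "d2 > 0" "ball x d2 \<subseteq> base"
    using open_base assms(1) unfolding open_contains_ball by blast
  show thesis
  proof (rule that[of "min d1 d2"])
    fix t assume t: "\<bar>t - x\<bar> < min d1 d2"
    then have "t \<in> base" using d2(2) by (auto simp: dist_real_def subset_iff)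
    then show "t \<in> base \<and> c < f t" using d1(2)[of t] t assms by (cases "t = x") (auto simp: dist_real_def)
  qed (use d1 d2 in auto)
qed

lemma open_D: "open D"
proof (rule openI)
  fix z assume z: "z \<in> D"
  then obtain c where c: "Im z < c" "c < f (Re z)" using dense mem_D by blast
  obtain d where d: "0 < d" "\<And>t. \<bar>t - Re z\<bar> < d \<Longrightarrow> t \<in> base \<and> c < f t"
    using lsc_nbhd[of "Re z" c] z c mem_D by blast
  let ?r = "min d (min (Im z) (c - Im z))"
  have "w \<in> D" if "w \<in> ball z ?r" for w
  proof -
    have "norm (w - z) < ?r" using that by (simp add: dist_norm norm_minus_commute)
    then have "\<bar>Re w - Re z\<bar> < ?r" "\<bar>Im w - Im z\<bar> < ?r"
      using abs_Re_le_cmod[of "w - z"] abs_Im_le_cmod[of "w - z"] by auto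
    then show ?thesis using d(2)[of "Re w"] by (auto simp: mem_D)
  qed
  moreover have "0 < ?r" using d c z mem_D by auto
  ultimately show "\<exists>e>0. ball z e \<subseteq> D" by blast
qed

lemma phi_image: "\<phi> ` D = ball 0 1" and phi_inj: "inj_on \<phi> D" and phi_holo: "\<phi> holomorphic_on D"
  using rm unfolding riemann_map_def bij_betw_def by auto

lemma phi_cont: "continuous_on D \<phi>"
  using phi_holo by (rule holomorphic_on_imp_continuous_on)

definition psi :: "complex \<Rightarrow> complex" where
  "psi = (SOME \<psi>. homeomorphism D (ball 0 1) \<phi> \<psi>)"

text \<open>Invariance of domain makes a continuous injection of an open plane set a homeomorphism
  onto its image. Connectedness of \<open>D\<close> is then read off from the disk.\<close>

lemma homeo: "homeomorphism D (ball 0 1) \<phi> psi"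
proof -
  obtain g where "homeomorphism D (\<phi> ` D) \<phi> g"
    using invariance_of_domain_homeomorphism[OF open_D phi_cont _ phi_inj] by auto
  then have "\<exists>\<psi>. homeomorphism D (ball 0 1) \<phi> \<psi>" unfolding phi_image by blast
  then show ?thesis unfolding psi_def by (rule someI_ex)
qed

lemma connected_D: "connected D"
proof -
  have "psi ` ball 0 1 = D" "continuous_on (ball 0 1) psi" using homeo by (auto simp: homeomorphism_def)
  then show ?thesis using connected_continuous_image[of "ball 0 1" psi] by auto
qed

lemma phi_deriv: "z \<in> D \<Longrightarrow> (\<phi> has_field_derivative deriv \<phi> z) (at z)"
  using phi_holo open_D by (rule holomorphic_derivI)

lemma deriv_cont: "continuous_on D (deriv \<phi>)"
  using holomorphic_deriv[OF phi_holo open_D] by (rule holomorphic_on_imp_continuous_on)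

definition energy_density :: "complex \<Rightarrow> ennreal" where
  "energy_density z = indicator D z * ennreal ((cmod (deriv \<phi> z))\<^sup>2)"

lemma indicator_deriv_measurable:
  assumes "S \<in> sets borel" "S \<subseteq> D"
  shows "(\<lambda>z. indicator S z * (cmod (deriv \<phi> z))\<^sup>2) \<in> borel_measurable borel"
proof -
  have "(\<lambda>z. indicator S z *\<^sub>R (cmod (deriv \<phi> z))\<^sup>2) \<in> borel_measurable borel"
    using assms by (intro borel_measurable_continuous_on_indicator continuous_intros continuous_on_subset[OF deriv_cont])
  then show ?thesis by simp
qed

lemma energy_density_measurable [measurable]: "energy_density \<in> borel_measurable borel"
proof -
  have eq: "energy_density = (\<lambda>z. ennreal (indicator D z * (cmod (deriv \<phi> z))\<^sup>2))"
    by (auto simp: energy_density_def indicator_def fun_eq_iff)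
  have "D \<in> sets borel" using open_D by simp
  from indicator_deriv_measurable[OF this order_refl]
  have "(\<lambda>z. ennreal (indicator D z * (cmod (deriv \<phi> z))\<^sup>2)) \<in> borel_measurable borel"
    by (rule measurable_compose[OF _ measurable_ennreal])
  then show ?thesis unfolding eq .
qed

text \<open>The energy over the preimage is the area of the part of the ball inside the unit
  disk.\<close>

lemma energy_preimage_ball:
  "(\<integral>\<^sup>+ z. indicator (\<phi> -` ball c r \<inter> D) z * energy_density z \<partial>lborel) \<le> emeasure lborel (ball c r)"
proof -
  let ?S = "\<phi> -` ball c r \<inter> D"
  have S: "open ?S"
    using continuous_open_preimage[OF phi_cont open_D open_ball] by (simp add: Int_commute)
  have im: "\<phi> ` ?S = ball c r \<inter> ball 0 1"
    unfolding phi_image[symmetric] by auto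
  have "(\<integral>\<^sup>+ z. indicator ?S z * energy_density z \<partial>lborel)
      = (\<integral>\<^sup>+ z. indicator ?S z * ennreal ((cmod (deriv \<phi> z))\<^sup>2) \<partial>lborel)"
    by (intro nn_integral_cong) (auto simp: energy_density_def indicator_def)
  also have "\<dots> = emeasure lborel (\<phi> ` ?S)"
  proof (rule nn_integral_norm_deriv_sq)
    show "?S \<in> sets borel" using S by simp
    show "inj_on \<phi> ?S" using phi_inj by (rule inj_on_subset) auto
    show "\<phi> ` ?S \<in> sets borel" "bounded (\<phi> ` ?S)" unfolding im by auto
    show "(\<lambda>z. indicator ?S z * (cmod (deriv \<phi> z))\<^sup>2) \<in> borel_measurable borel"
      using S by (intro indicator_deriv_measurable) auto
  qed (auto intro: phi_deriv)
  also have "\<dots> \<le> emeasure lborel (ball c r)" unfolding im by (intro emeasure_mono) auto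
  finally show ?thesis .
qed

lemma energy_finite: "(\<integral>\<^sup>+ z. energy_density z \<partial>lborel) < \<infinity>"
proof -
  have "(\<integral>\<^sup>+ z. energy_density z \<partial>lborel) = (\<integral>\<^sup>+ z. indicator (\<phi> -` ball 0 1 \<inter> D) z * energy_density z \<partial>lborel)"
    using phi_image by (intro nn_integral_cong) (auto simp: energy_density_def indicator_def)
  also have "\<dots> \<le> emeasure lborel (ball (0::complex) 1)" by (rule energy_preimage_ball)
  also have "\<dots> < \<infinity>" by (rule emeasure_bounded_finite) simp
  finally show ?thesis .
qed

definition fibre_energy :: "real \<Rightarrow> ennreal" where
  "fibre_energy x = (\<integral>\<^sup>+ y. energy_density (Complex x y) \<partial>lborel)"

lemma AE_fibre_energy_finite: "AE x in lborel. fibre_energy x < \<infinity>"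
proof -
  have "(\<integral>\<^sup>+ x. fibre_energy x \<partial>lborel) = (\<integral>\<^sup>+ z. energy_density z \<partial>lborel)"
    unfolding fibre_energy_def by (rule nn_integral_complex_iterated[symmetric]) measurable
  then have "(\<integral>\<^sup>+ x. fibre_energy x \<partial>lborel) \<noteq> \<infinity>" using energy_finite by simp
  moreover have "fibre_energy \<in> borel_measurable lborel"
    unfolding fibre_energy_def by measurable
  ultimately have "AE x in lborel. fibre_energy x \<noteq> \<infinity>" by (intro nn_integral_PInf_AE) auto
  then show ?thesis by (simp add: less_top)
qed

lemma continuous_on_fibre:
  assumes "continuous_on D g" "x \<in> base"
  shows "continuous_on {0<..<f x} (\<lambda>y. g (Complex x y))"
  by (rule continuous_on_compose2[OF assms(1)])
     (use assms in \<open>auto simp: mem_D Complex_eq intro!: continuous_intros\<close>)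

text \<open>Hoelder continuity with exponent 1/2 on a fibre, with a constant governed by the fibre
  energy alone; the same bound later controls the walls of cross-cuts on neighbouring
  fibres.\<close>

lemma phi_fibre_dist:
  assumes x: "x \<in> base" and y: "0 < y1" "y1 \<le> y2" "y2 < f x"
  shows "ennreal ((dist (\<phi> (Complex x y2)) (\<phi> (Complex x y1)))\<^sup>2) \<le> ennreal (y2 - y1) * fibre_energy x"
proof -
  have inD: "Complex x t \<in> D" if "t \<in> {y1..y2}" for t using that x y by (auto simp: mem_D)
  have sub: "{y1..y2} \<subseteq> {0<..<f x}" using y by auto
  have der: "((\<lambda>t. \<phi> (Complex x t)) has_vector_derivative deriv \<phi> (Complex x t) * \<i>) (at t within {y1..y2})"
    if "t \<in> {y1..y2}" for t
    using has_vector_derivative_fibre[OF phi_deriv[OF inD[OF that], unfolded has_field_derivative_def]]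
    by simp
  have "ennreal ((dist (\<phi> (Complex x y2)) (\<phi> (Complex x y1)))\<^sup>2)
     \<le> emeasure lborel (UNIV \<inter> {y1..y2}) * (\<integral>\<^sup>+ t \<in> {y1..y2}. ennreal ((norm (deriv \<phi> (Complex x t) * \<i>))\<^sup>2) \<partial>lborel)"
    unfolding dist_norm using y der continuous_on_subset[OF continuous_on_fibre[OF deriv_cont x] sub]
    by (intro norm_diff_sq_le_nn_integral) (auto intro!: continuous_intros)
  also have "\<dots> \<le> ennreal (y2 - y1) * fibre_energy x"
    unfolding fibre_energy_def using y inD
    by (intro mult_mono nn_integral_mono) (auto simp: energy_density_def indicator_def norm_mult)
  finally show ?thesis .
qed

section \<open>Boundary limits along fibres\<close>

definition fibre_limit :: "real \<Rightarrow> real \<Rightarrow> complex \<Rightarrow> bool" where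
  "fibre_limit x e0 \<zeta> \<longleftrightarrow> ((\<lambda>y. \<phi> (Complex x y)) \<longlongrightarrow> \<zeta>) (at e0 within {0<..<f x})"

text \<open>By the Hoelder estimate the Riemann map is uniformly continuous on the fibre and extends
  to its closure. A limit inside the disk would be sent by \<open>psi\<close> into \<open>D\<close>,
  while the fibre tends to a point with height 0 or \<open>f x\<close>, which is outside
  \<open>D\<close>.\<close>

lemma fibre_limit_exists:
  assumes x: "x \<in> base" and fin: "fibre_energy x < \<infinity>" and e0: "e0 = 0 \<or> e0 = f x"
  obtains \<zeta> where "fibre_limit x e0 \<zeta>" "norm \<zeta> = 1"
proof -
  have fx: "0 < f x" using pos x .
  define K where "K = enn2real (fibre_energy x)"
  have K: "fibre_energy x = ennreal K" "0 \<le> K" using fin by (auto simp: K_def less_top)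
  have est: "(dist (\<phi> (Complex x y2)) (\<phi> (Complex x y1)))\<^sup>2 \<le> \<bar>y2 - y1\<bar> * K"
    if "y1 \<in> {0<..<f x}" "y2 \<in> {0<..<f x}" for y1 y2
  proof -
    have *: "(dist (\<phi> (Complex x y2)) (\<phi> (Complex x y1)))\<^sup>2 \<le> \<bar>y2 - y1\<bar> * K"
      if "y1 \<in> {0<..<f x}" "y2 \<in> {0<..<f x}" "y1 \<le> y2" for y1 y2
      using phi_fibre_dist[OF x, of y1 y2] that K by (simp add: ennreal_le_iff flip: ennreal_mult)
    show ?thesis using *[of y1 y2] *[of y2 y1] that by (cases "y1 \<le> y2") (auto simp: dist_commute abs_minus_commute)
  qed
  have "uniformly_continuous_on {0<..<f x} (\<lambda>y. \<phi> (Complex x y))"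
    unfolding uniformly_continuous_on_def
  proof (intro allI impI)
    fix e :: real assume e: "0 < e"
    show "\<exists>d>0. \<forall>y\<in>{0<..<f x}. \<forall>y'\<in>{0<..<f x}. dist y' y < d \<longrightarrow> dist (\<phi> (Complex x y')) (\<phi> (Complex x y)) < e"
    \<comment> \<open>Solves \<open>\<bar>y' - y\<bar> * (K + 1) < e\<^sup>2\<close>; the added 1
      guards against \<open>K = 0\<close>.\<close>
    proof (intro exI[of _ "e\<^sup>2 / (K + 1)"] conjI ballI impI)
      show "0 < e\<^sup>2 / (K + 1)" using e K by simp
      fix y y' assume y: "y \<in> {0<..<f x}" "y' \<in> {0<..<f x}" "dist y' y < e\<^sup>2 / (K + 1)"
      have "(dist (\<phi> (Complex x y')) (\<phi> (Complex x y)))\<^sup>2 \<le> \<bar>y' - y\<bar> * K" using est y by blast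
      also have "\<dots> \<le> \<bar>y' - y\<bar> * (K + 1)" by (intro mult_left_mono) auto
      also have "\<dots> < e\<^sup>2" using y(3) K by (simp add: dist_real_def pos_less_divide_eq)
      finally show "dist (\<phi> (Complex x y')) (\<phi> (Complex x y)) < e"
        using e by (auto intro: power2_less_imp_less)
    qed
  qed
  from uniformly_continuous_on_extension_on_closure[OF this]
  obtain g where g: "uniformly_continuous_on (closure {0<..<f x}) g" "\<And>y. y \<in> {0<..<f x} \<Longrightarrow> \<phi> (Complex x y) = g y"
    by metis
  have cl: "closure {0<..<f x} = {0..f x}" using fx by simp
  have e0_in: "e0 \<in> {0..f x}" using e0 fx by auto
  have "(g \<longlongrightarrow> g e0) (at e0 within {0..f x})"
    using uniformly_continuous_imp_continuous[OF g(1)] e0_in unfolding cl continuous_on_def by blast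
  then have "(g \<longlongrightarrow> g e0) (at e0 within {0<..<f x})" by (rule tendsto_within_subset) auto
  then have lim: "((\<lambda>y. \<phi> (Complex x y)) \<longlongrightarrow> g e0) (at e0 within {0<..<f x})"
    by (rule Lim_transform_eventually) (auto simp: eventually_at_filter g(2))
  have nb: "at e0 within {0<..<f x} \<noteq> bot"
  proof -
    have "{0<..<f x} - {e0} = {0<..<f x}" using e0 by auto
    then show ?thesis using e0_in cl by (simp add: at_within_eq_bot_iff)
  qed
  have inD: "Complex x y \<in> D" if "y \<in> {0<..<f x}" for y using that x by (auto simp: mem_D)
  have ev: "\<forall>\<^sub>F y in at e0 within {0<..<f x}. y \<in> {0<..<f x}" by (simp add: eventually_at_filter)
  have "\<forall>\<^sub>F y in at e0 within {0<..<f x}. \<phi> (Complex x y) \<in> cball 0 1"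
    using ev by eventually_elim (use inD phi_image ball_subset_cball in blast)
  then have le1: "g e0 \<in> cball 0 1"
    using lim nb by (intro Lim_in_closed_set[OF closed_cball])
  have "norm (g e0) \<noteq> 1 \<Longrightarrow> False"
  proof -
    assume "norm (g e0) \<noteq> 1"
    then have in_ball: "g e0 \<in> ball 0 1" using le1 by auto
    have contpsi: "continuous_on (ball 0 1) psi" and psiD: "psi ` ball 0 1 = D" and inv: "\<And>z. z \<in> D \<Longrightarrow> psi (\<phi> z) = z"
      using homeo by (auto simp: homeomorphism_def)
    have "((\<lambda>y. psi (\<phi> (Complex x y))) \<longlongrightarrow> psi (g e0)) (at e0 within {0<..<f x})"
    proof (rule continuous_on_tendsto_compose[OF contpsi lim in_ball])
      show "\<forall>\<^sub>F y in at e0 within {0<..<f x}. \<phi> (Complex x y) \<in> ball 0 1"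
        using ev by eventually_elim (use inD phi_image in blast)
    qed
    then have l1: "((\<lambda>y. Complex x y) \<longlongrightarrow> psi (g e0)) (at e0 within {0<..<f x})"
      by (rule Lim_transform_eventually) (use ev in eventually_elim, auto simp: inv inD)
    have l2: "((\<lambda>y. Complex x y) \<longlongrightarrow> Complex x e0) (at e0 within {0<..<f x})"
      unfolding Complex_eq by (intro tendsto_intros)
    have "psi (g e0) = Complex x e0" using tendsto_unique[OF nb l1 l2] .
    moreover have "psi (g e0) \<in> D" using in_ball psiD by blast
    ultimately show False using e0 by (auto simp: mem_D)
  qed
  then show thesis using that[of "g e0"] lim by (auto simp: fibre_limit_def)
qed

text \<open>The value \<open>-1\<close> keeps fibres of infinite energy away from the others.\<close>
definition energy_code :: "real \<Rightarrow> real" where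
  "energy_code x = (if fibre_energy x < \<infinity> then 1 + enn2real (fibre_energy x) else - 1)"

text \<open>The walls of the cross-cuts must stand, on both sides of \<open>x\<close>, on fibres
  that end near the end of the fibre at \<open>x\<close> and whose energies are bounded in common.
  This notion provides them where \<open>f\<close> is discontinuous.\<close>

definition accumulated :: "real \<Rightarrow> bool" where
  "accumulated x \<longleftrightarrow>
    (\<forall>\<delta>>0. \<exists>x'. x - \<delta> < x' \<and> x' < x \<and> \<bar>f x' - f x\<bar> < \<delta> \<and> \<bar>energy_code x' - energy_code x\<bar> < \<delta>) \<and>
    (\<forall>\<delta>>0. \<exists>x'. x < x' \<and> x' < x + \<delta> \<and> \<bar>f x' - f x\<bar> < \<delta> \<and> \<bar>energy_code x' - energy_code x\<bar> < \<delta>)"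

lemma AE_accumulated: "AE x in lborel. accumulated x"
proof -
  let ?L = "{x. \<exists>\<delta>>0. \<forall>x'. x - \<delta> < x' \<and> x' < x \<longrightarrow> \<not> (\<bar>f x' - f x\<bar> < \<delta> \<and> \<bar>energy_code x' - energy_code x\<bar> < \<delta>)}"
  let ?R = "{x. \<exists>\<delta>>0. \<forall>x'. x < x' \<and> x' < x + \<delta> \<longrightarrow> \<not> (\<bar>f x' - f x\<bar> < \<delta> \<and> \<bar>energy_code x' - energy_code x\<bar> < \<delta>)}"
  have "countable (?L \<union> ?R)"
    using countable_not_left_accumulated countable_not_right_accumulated by (rule countable_Un)
  then have "AE x in lborel. x \<notin> ?L \<union> ?R"
    by (intro AE_not_in countable_imp_null_set_lborel)
  then show ?thesis
  proof eventually_elim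
    case (elim x)
    then show ?case unfolding accumulated_def by blast
  qed
qed

text \<open>The cuts have small images: on a wall the Hoelder estimate applies with a common energy
  bound \<open>K\<close> and a height tending to 0, and on the connecting side continuity of \<phi>
  at the single point \<open>Complex x (y n)\<close> suffices once the walls are close enough to
  \<open>x\<close>.\<close>

lemma prime_end_of_fibre_end:
  fixes \<sigma> :: real
  assumes x: "x \<in> base" and fin: "fibre_energy x < \<infinity>" and acc: "accumulated x"
    and side: "\<sigma> = 1 \<and> e = f \<or> \<sigma> = - 1 \<and> e = (\<lambda>_. 0)"
    and lim: "fibre_limit x (e x) \<zeta>" and \<zeta>: "norm \<zeta> = 1"
  obtains p where "corresponds D \<phi> p \<zeta>"
    "converges_to_prime_end D (\<lambda>\<tau>. Complex x (f x / 2 + \<tau> * (e x - f x / 2))) p"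
proof -
  have fx: "0 < f x" using pos x .
  \<comment> \<open>This equals \<open>energy_code x\<close>. A neighbour whose code differs by less
    than 1 has a positive code, hence finite energy, and that energy is below
    \<open>K\<close>.\<close>
  define K where "K = enn2real (fibre_energy x) + 1"
  have K: "0 \<le> K" by (simp add: K_def)
  define v0 where "v0 = f x / 2"
  \<comment> \<open>The levels start at the midpoint \<open>v0\<close> for \<open>n = 0\<close> and
    move monotonically towards \<open>e x\<close>.\<close>
  define y where "y n = e x + (v0 - e x) / real (Suc n)" for n
  have half: "(v0 - f x) / c = - (v0 / c)" for c
  proof -
    have "v0 - f x = - v0" by (simp add: v0_def)
    then show ?thesis by (simp only: minus_divide_left)
  qed
  have ex: "e x = 0 \<or> e x = f x" using side by auto
  have y_in: "0 < y n" "y n < f x" for n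
  proof -
    have d: "0 < v0 / real (Suc n)" "v0 / real (Suc n) \<le> v0"
      using fx by (auto simp: v0_def field_simps)
    have v: "0 < v0" "v0 < f x" using fx by (simp_all add: v0_def)
    have "y n = f x - v0 / real (Suc n) \<or> y n = v0 / real (Suc n)"
      using side by (auto simp: y_def half)
    then show "0 < y n" "y n < f x" using d v by linarith+
  qed
  have y_lim: "y \<longlonglongrightarrow> e x"
  proof -
    have "(\<lambda>n. (v0 - e x) / real (Suc n)) \<longlonglongrightarrow> 0" by real_asymp
    then show ?thesis unfolding y_def using tendsto_add[OF tendsto_const, of _ 0 _ "e x"] by auto
  qed
  have y_mono: "strict_mono (\<lambda>n. \<sigma> * y n)"
    unfolding strict_mono_Suc_iff
  proof
    fix n
    have "v0 / real (Suc (Suc n)) < v0 / real (Suc n)"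
      using fx by (intro divide_strict_left_mono) (auto simp: v0_def)
    then show "\<sigma> * y n < \<sigma> * y (Suc n)" using side unfolding y_def by (auto simp: half)
  qed
  define b where "b n = inverse (real (Suc n))" for n
  have b: "0 < b n" "b n \<le> 1" for n by (auto simp: b_def field_simps)
  \<comment> \<open>\<open>P n l\<close> says that \<open>l\<close> may carry a wall of the
    \<open>n\<close>-th cut. The condition on all \<open>t\<close> up to \<open>l\<close> keeps the
    connecting side in \<open>D\<close> and its image near that of
    \<open>Complex x (y n)\<close>.\<close>
  define P where "P n l \<longleftrightarrow> (\<forall>t. \<bar>t - x\<bar> \<le> \<bar>l - x\<bar> \<longrightarrow> t \<in> base \<and> y n < f t \<and>
       dist (\<phi> (Complex t (y n))) (\<phi> (Complex x (y n))) < b n) \<and>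
     \<bar>e l - e x\<bar> < b n \<and> fibre_energy l \<le> ennreal K" for n l
  \<comment> \<open>Lower semicontinuity keeps level \<open>y n\<close> below the graph on a full
    neighbourhood of \<open>x\<close>; closeness of the wall ends has to come from closeness of the
    values of \<open>f\<close>.\<close>
  have near: "\<exists>\<delta>>0. \<forall>l. \<bar>l - x\<bar> < \<delta> \<and> \<bar>f l - f x\<bar> < \<delta> \<and> \<bar>energy_code l - energy_code x\<bar> < \<delta> \<longrightarrow> P n l" for n
  proof -
    obtain d1 where d1: "0 < d1" "\<And>t. \<bar>t - x\<bar> < d1 \<Longrightarrow> t \<in> base \<and> y n < f t"
      using lsc_nbhd[OF x y_in(2)] by blast
    have "Complex x (y n) \<in> D" using x y_in by (simp add: mem_D)
    then have "continuous (at (Complex x (y n))) \<phi>"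
      using phi_cont open_D by (simp add: continuous_on_eq_continuous_at)
    then obtain d2 where d2: "0 < d2" "\<And>z. dist z (Complex x (y n)) < d2 \<Longrightarrow> dist (\<phi> z) (\<phi> (Complex x (y n))) < b n"
      using b(1)[of n] unfolding continuous_at_eps_delta by blast
    have dist_eq: "dist (Complex t (y n)) (Complex x (y n)) = \<bar>t - x\<bar>" for t
      by (simp add: dist_norm cmod_def)
    show ?thesis
    proof (intro exI[of _ "min (min d1 d2) (b n)"] conjI allI impI)
      show "0 < min (min d1 d2) (b n)" using d1 d2 b by simp
      fix l assume l: "\<bar>l - x\<bar> < min (min d1 d2) (b n) \<and> \<bar>f l - f x\<bar> < min (min d1 d2) (b n) \<and>
          \<bar>energy_code l - energy_code x\<bar> < min (min d1 d2) (b n)"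
      have "\<bar>energy_code l - energy_code x\<bar> < 1" using l b(2)[of n] by linarith
      moreover have "energy_code x = K" using fin by (simp add: energy_code_def K_def)
      moreover have "1 \<le> K" by (simp add: K_def)
      ultimately have pos_l: "0 < energy_code l" "energy_code l < K + 1" by linarith+
      then have fl: "fibre_energy l < \<infinity>" unfolding energy_code_def by (auto split: if_splits)
      then have "enn2real (fibre_energy l) < K" using pos_l by (simp add: energy_code_def)
      then have "fibre_energy l \<le> ennreal K" using fl by (simp add: enn2real_le less_imp_le)
      moreover have "\<bar>e l - e x\<bar> < b n" using l side b[of n] by auto
      moreover have "t \<in> base \<and> y n < f t \<and> dist (\<phi> (Complex t (y n))) (\<phi> (Complex x (y n))) < b n"
        if "\<bar>t - x\<bar> \<le> \<bar>l - x\<bar>" for t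
        using d1(2)[of t] d2(2)[of "Complex t (y n)"] that l unfolding dist_eq by linarith
      ultimately show "P n l" unfolding P_def by blast
    qed
  qed
  have "\<exists>l. a < l \<and> l < x \<and> P n l" if a: "a < x" for n a
  proof -
    obtain \<delta> where \<delta>: "\<delta> > 0" "\<And>l. \<bar>l - x\<bar> < \<delta> \<Longrightarrow> \<bar>f l - f x\<bar> < \<delta> \<Longrightarrow> \<bar>energy_code l - energy_code x\<bar> < \<delta> \<Longrightarrow> P n l"
      using near by blast
    have "0 < min \<delta> (x - a)" using \<delta> a by simp
    then obtain l where l: "x - min \<delta> (x - a) < l" "l < x" "\<bar>f l - f x\<bar> < min \<delta> (x - a)"
        "\<bar>energy_code l - energy_code x\<bar> < min \<delta> (x - a)"
      using acc unfolding accumulated_def by blast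
    then show ?thesis using \<delta>(2)[of l] by (intro exI[of _ l]) auto
  qed
  then obtain l where l: "strict_mono l" "l \<longlonglongrightarrow> x" "\<And>n. l n < x" "\<And>n. P n (l n)"
    using strict_mono_selection[of x P] by blast
  \<comment> \<open>Reflection turns the walls on the right into an increasing sequence, so the same
    selection lemma applies.\<close>
  have "\<exists>r. a < r \<and> r < - x \<and> P n (- r)" if a: "a < - x" for n a
  proof -
    obtain \<delta> where \<delta>: "\<delta> > 0" "\<And>l. \<bar>l - x\<bar> < \<delta> \<Longrightarrow> \<bar>f l - f x\<bar> < \<delta> \<Longrightarrow> \<bar>energy_code l - energy_code x\<bar> < \<delta> \<Longrightarrow> P n l"
      using near by blast
    have "0 < min \<delta> (- x - a)" using \<delta> a by simp
    then obtain r where r: "x < r" "r < x + min \<delta> (- x - a)" "\<bar>f r - f x\<bar> < min \<delta> (- x - a)"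
        "\<bar>energy_code r - energy_code x\<bar> < min \<delta> (- x - a)"
      using acc unfolding accumulated_def by blast
    then show ?thesis using \<delta>(2)[of r] by (intro exI[of _ "- r"]) auto
  qed
  then obtain r' where r': "strict_mono r'" "r' \<longlonglongrightarrow> - x" "\<And>n. r' n < - x" "\<And>n. P n (- r' n)"
    using strict_mono_selection[of "- x" "\<lambda>n r. P n (- r)"] by blast
  define r where "r n = - r' n" for n
  have r: "r (Suc n) < r n" "x < r n" "P n (r n)" for n
    using r'(1) r'(3)[of n] r'(4)[of n] by (auto simp: r_def strict_mono_Suc_iff)
  have r_lim: "r \<longlonglongrightarrow> x" unfolding r_def using tendsto_minus[OF r'(2)] by simp
  have b_lim: "b \<longlonglongrightarrow> 0" unfolding b_def by (rule LIMSEQ_inverse_real_of_nat)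
  have e_lim: "(\<lambda>n. e (w n)) \<longlonglongrightarrow> e x" if "\<And>n. P n (w n)" for w
  proof (rule LIM_zero_cancel, rule Lim_null_comparison[OF _ b_lim])
    show "\<forall>\<^sub>F n in sequentially. norm (e (w n) - e x) \<le> b n"
      using that unfolding P_def by (auto intro!: always_eventually less_imp_le)
  qed
  have H: "t \<in> base \<and> y n < f t \<and> dist (\<phi> (Complex t (y n))) (\<phi> (Complex x (y n))) < b n"
    if "l n \<le> t" "t \<le> r n" for n t
  proof (cases "t \<le> x")
    case True
    then have "\<bar>t - x\<bar> \<le> \<bar>l n - x\<bar>" using that by auto
    then show ?thesis using l(4)[of n] unfolding P_def by blast
  next
    case False
    then have "\<bar>t - x\<bar> \<le> \<bar>r n - x\<bar>" using that by auto
    then show ?thesis using r(3)[of n] unfolding P_def by blast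
  qed
  \<comment> \<open>Three contributions to the distance from \<zeta>: along a wall, along the
    connecting side, and from the point of the fibre at level \<open>y n\<close>.\<close>
  define \<beta> where "\<beta> n = sqrt ((b n + \<bar>e x - y n\<bar>) * K) + b n + dist (\<phi> (Complex x (y n))) \<zeta>" for n
  have "(\<lambda>n. \<phi> (Complex x (y n))) \<longlonglongrightarrow> \<zeta>"
  proof (rule filterlim_compose[OF lim[unfolded fibre_limit_def]])
    show "filterlim y (at (e x) within {0<..<f x}) sequentially"
    proof -
      have "y n \<noteq> e x" for n using y_in[of n] ex by linarith
      then have "y n \<in> {0<..<f x} \<and> y n \<noteq> e x" for n using y_in[of n] by simp
      then show ?thesis unfolding filterlim_at using y_lim always_eventually by blast
    qed
  qed
  then have "(\<lambda>n. dist (\<phi> (Complex x (y n))) \<zeta>) \<longlonglongrightarrow> 0" by (rule tendsto_dist_iff[THEN iffD1])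
  moreover have "(\<lambda>n. sqrt ((b n + \<bar>e x - y n\<bar>) * K)) \<longlonglongrightarrow> sqrt ((0 + \<bar>e x - e x\<bar>) * K)"
    by (intro tendsto_intros b_lim y_lim)
  ultimately have \<beta>_lim: "\<beta> \<longlonglongrightarrow> 0"
    unfolding \<beta>_def using b_lim by (auto intro!: tendsto_add_zero)
  have wall: "dist (\<phi> (Complex w v)) (\<phi> (Complex w (y n))) \<le> sqrt ((b n + \<bar>e x - y n\<bar>) * K)"
    if w: "P n w" "w \<in> base" "y n < f w" and v: "\<sigma> * y n \<le> \<sigma> * v" "\<sigma> * v < \<sigma> * e w" for n w v
  proof -
    have v': "0 < v" "v < f w" using side v w y_in[of n] by auto
    have "\<bar>v - y n\<bar> \<le> \<bar>e w - y n\<bar>" using v side by auto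
    also have "\<dots> \<le> b n + \<bar>e x - y n\<bar>" using w(1) unfolding P_def by linarith
    finally have vy: "\<bar>v - y n\<bar> \<le> b n + \<bar>e x - y n\<bar>" .
    define c where "c = b n + \<bar>e x - y n\<bar>"
    have c: "0 \<le> c" using b(1)[of n] by (simp add: c_def)
    have "ennreal ((dist (\<phi> (Complex w v)) (\<phi> (Complex w (y n))))\<^sup>2) \<le> ennreal \<bar>v - y n\<bar> * fibre_energy w"
      using phi_fibre_dist[OF w(2), of v "y n"] phi_fibre_dist[OF w(2), of "y n" v] v' w(3) y_in(1)[of n]
      by (cases "v \<le> y n") (auto simp: dist_commute)
    also have "\<dots> \<le> ennreal c * ennreal K"
      using vy[folded c_def] w(1) unfolding P_def by (intro mult_mono ennreal_leI) auto
    finally have "(dist (\<phi> (Complex w v)) (\<phi> (Complex w (y n))))\<^sup>2 \<le> c * K"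
      using K c by (simp add: ennreal_le_iff flip: ennreal_mult)
    then show ?thesis unfolding c_def by (rule real_le_rsqrt)
  qed
  have cut_small: "dist (\<phi> z) \<zeta> \<le> \<beta> n" if z: "z \<in> u_cut \<sigma> e (l n) (r n) (y n)" for z n
  proof -
    have zr: "l n \<le> Re z" "Re z \<le> r n"
      using z l(3)[of n] r(2)[of n] unfolding u_cut_def by auto
    have "dist (\<phi> z) (\<phi> (Complex (Re z) (y n))) \<le> sqrt ((b n + \<bar>e x - y n\<bar>) * K)"
    proof (cases "Im z = y n")
      case True
      then have "Complex (Re z) (y n) = z" by (simp add: complex_eq_iff)
      then show ?thesis using K b(1)[of n] by simp
    next
      case False
      then have *: "Re z = l n \<or> Re z = r n" "\<sigma> * y n \<le> \<sigma> * Im z" "\<sigma> * Im z < \<sigma> * e (Re z)"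
        using z unfolding u_cut_def by auto
      have "P n (Re z)" using *(1) l(4)[of n] r(3)[of n] by auto
      then show ?thesis using wall[of n "Re z" "Im z"] *(2,3) H[OF zr] by simp
    qed
    moreover have "dist (\<phi> (Complex (Re z) (y n))) (\<phi> (Complex x (y n))) < b n"
      using H[OF zr] by blast
    ultimately show ?thesis
      using dist_triangle[of "\<phi> z" \<zeta> "\<phi> (Complex (Re z) (y n))"]
        dist_triangle[of "\<phi> (Complex (Re z) (y n))" \<zeta> "\<phi> (Complex x (y n))"]
      unfolding \<beta>_def by linarith
  qed
  show thesis
  proof (rule prime_end_at_fibre_end[OF open_D connected_D homeo, where \<sigma>=\<sigma> and l=l and x=x and r=r and y=y and e=e and \<zeta>=\<zeta> and ?v0.0=v0])
    show "\<sigma> = 1 \<or> \<sigma> = - 1" using side by blast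
    show "z \<in> D \<longleftrightarrow> \<sigma> * Im z < \<sigma> * e (Re z)" if "l n \<le> Re z" "Re z \<le> r n" "\<sigma> * y n \<le> \<sigma> * Im z" for n z
      using H[OF that(1,2)] that(3) side y_in(1)[of n] unfolding mem_D by auto
    show "\<sigma> * y n < \<sigma> * e t" if "l n \<le> t" "t \<le> r n" for n t
      using H[OF that] side y_in(1)[of n] by auto
    show "\<forall>\<^sub>F n in sequentially. \<phi> ` u_cut \<sigma> e (l n) (r n) (y n) \<subseteq> ball \<zeta> d" if d: "0 < d" for d
    proof -
      have "\<forall>\<^sub>F n in sequentially. \<beta> n < d" using \<beta>_lim d by (simp add: order_tendsto_iff)
      then show ?thesis
        by eventually_elim (use cut_small in \<open>force simp: dist_commute\<close>)
    qed
    show "\<sigma> * v0 \<le> \<sigma> * y 0" by (simp add: y_def)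
    show "Complex x v0 \<in> D" using x fx by (simp add: mem_D v0_def)
    show "(\<lambda>n. e (l n)) \<longlonglongrightarrow> e x" using e_lim l(4) .
    show "(\<lambda>n. e (r n)) \<longlonglongrightarrow> e x" using e_lim r(3) .
    show thesis if "corresponds D \<phi> p \<zeta>" "converges_to_prime_end D (\<lambda>\<tau>. Complex x (v0 + \<tau> * (e x - v0))) p" for p
      using \<open>\<And>p. corresponds D \<phi> p \<zeta> \<Longrightarrow> _ \<Longrightarrow> thesis\<close>[OF that(1)] that(2) by (simp add: v0_def)
  qed (use l r r_lim y_mono y_lim \<zeta> in auto)
qed

text \<open>Seen from its midpoint the fibre consists of the two rays just treated, the lower one
  running to parameter 0. Both orders of \<open>P\<close> and \<open>Q\<close> hold since curves are
  unoriented.\<close>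

lemma vertical_fibre_connects:
  assumes x: "x \<in> base" and fin: "fibre_energy x < \<infinity>" and acc: "accumulated x"
    and lim: "fibre_limit x 0 \<zeta>" "fibre_limit x (f x) \<omega>" and norm: "norm \<zeta> = 1" "norm \<omega> = 1"
    and PQ: "\<And>p. corresponds D \<phi> p \<zeta> \<Longrightarrow> p \<in> P" "\<And>q. corresponds D \<phi> q \<omega> \<Longrightarrow> q \<in> Q"
  shows "vertical_fibre x (f x) \<in> connecting_curves D P Q" "vertical_fibre x (f x) \<in> connecting_curves D Q P"
    "vertical_segment (vertical_fibre x (f x))"
proof -
  have fx: "0 < f x" using pos x .
  obtain p where p: "corresponds D \<phi> p \<zeta>" "converges_to_prime_end D (\<lambda>\<tau>. Complex x (f x / 2 + \<tau> * (0 - f x / 2))) p"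
    using prime_end_of_fibre_end[OF x fin acc, of "-1" "\<lambda>_. 0" \<zeta>] lim(1) norm(1) by auto
  obtain q where q: "corresponds D \<phi> q \<omega>" "converges_to_prime_end D (\<lambda>\<tau>. Complex x (f x / 2 + \<tau> * (f x - f x / 2))) q"
    using prime_end_of_fibre_end[OF x fin acc, of 1 f \<omega>] lim(2) norm(2) by auto
  have "(\<lambda>\<tau>. vertical_fibre x (f x) ((1 - \<tau>) / 2)) = (\<lambda>\<tau>. Complex x (f x / 2 + \<tau> * (0 - f x / 2)))"
    "(\<lambda>\<tau>. vertical_fibre x (f x) ((1 + \<tau>) / 2)) = (\<lambda>\<tau>. Complex x (f x / 2 + \<tau> * (f x - f x / 2)))"
    by (auto simp: vertical_fibre_def fun_eq_iff field_simps)
  then have conv: "converges_to_prime_end D (\<lambda>\<tau>. vertical_fibre x (f x) ((1 - \<tau>) / 2)) p"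
    "converges_to_prime_end D (\<lambda>\<tau>. vertical_fibre x (f x) ((1 + \<tau>) / 2)) q"
    using p q by simp_all
  have im: "vertical_fibre x (f x) ` {0<..<1} \<subseteq> D"
    using x fx by (auto simp: vertical_fibre_def mem_D)
  have rect: "locally_rectifiable (vertical_fibre x (f x))"
    using fx by (intro locally_rectifiable_vertical_fibre) simp
  show "vertical_fibre x (f x) \<in> connecting_curves D P Q" "vertical_fibre x (f x) \<in> connecting_curves D Q P"
    unfolding connecting_curves_def using conv im rect PQ(1)[OF p(1)] PQ(2)[OF q(1)] by blast+
  show "vertical_segment (vertical_fibre x (f x))"
    unfolding vertical_segment_def
  proof (intro conjI exI)
    show "inj_on (vertical_fibre x (f x)) {0<..<1}"
      using fx by (auto simp: inj_on_def vertical_fibre_def)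
    show "0 < f x" by fact
    show "vertical_fibre x (f x) ` {0<..<1} = {z. Re z = x \<and> 0 < Im z \<and> Im z < f x}"
    proof (intro equalityI subsetI)
      fix z assume z: "z \<in> {z. Re z = x \<and> 0 < Im z \<and> Im z < f x}"
      then have "z = vertical_fibre x (f x) (Im z / f x)" "Im z / f x \<in> {0<..<1}"
        using fx by (auto simp: vertical_fibre_def complex_eq_iff)
      then show "z \<in> vertical_fibre x (f x) ` {0<..<1}" by blast
    qed (use fx in \<open>auto simp: vertical_fibre_def\<close>)
  qed
qed

end

subsection \<open>Cut-off functions\<close>

lemma has_real_derivative_max_0_sq: "((\<lambda>t. (max 0 t)\<^sup>2) has_real_derivative 2 * max 0 t) (at t)"
proof -
  consider "t < 0" | "t = 0" | "0 < t" by linarith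
  then show ?thesis
  proof cases
    case 1
    have "((\<lambda>t. 0) has_real_derivative 2 * max 0 t) (at t)" using 1 by simp
    then show ?thesis
      by (rule has_field_derivative_transform_within_open[of _ _ _ "{..<0}"]) (use 1 in auto)
  next
    case 3
    have "((\<lambda>t. t\<^sup>2) has_real_derivative 2 * max 0 t) (at t)"
      using 3 by (auto intro!: derivative_eq_intros)
    then show ?thesis
      by (rule has_field_derivative_transform_within_open[of _ _ _ "{0<..}"]) (use 3 in auto)
  next
    case 2
    have "((\<lambda>h. ((max 0 (0 + h))\<^sup>2 - (max 0 0)\<^sup>2) / h) \<longlongrightarrow> 0) (at (0::real))"
    proof (rule Lim_null_comparison)
      show "\<forall>\<^sub>F h in at (0::real). norm (((max 0 (0 + h))\<^sup>2 - (max 0 0)\<^sup>2) / h) \<le> \<bar>h\<bar>"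
        by (rule always_eventually) (auto simp: max_def power2_eq_square)
      show "((\<lambda>h. \<bar>h\<bar>) \<longlongrightarrow> 0) (at (0::real))" by (intro tendsto_eq_intros) auto
    qed
    then show ?thesis using 2 by (simp add: DERIV_def)
  qed
qed

text \<open>A \<open>C\<^sup>1\<close> approximation, with smoothing width \<open>k\<close>, of the piecewise linear function that rises
  from \<open>0\<close> at \<open>a\<close> to \<open>1\<close> at \<open>b\<close>.\<close>
definition ramp :: "real \<Rightarrow> real \<Rightarrow> real \<Rightarrow> real \<Rightarrow> real" where
  "ramp a b k t = ((max 0 (t - a))\<^sup>2 - (max 0 (t - a - k))\<^sup>2 - (max 0 (t - b))\<^sup>2 + (max 0 (t - b - k))\<^sup>2) / (2 * k * (b - a))"

definition ramp' :: "real \<Rightarrow> real \<Rightarrow> real \<Rightarrow> real \<Rightarrow> real" where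
  "ramp' a b k t = (max 0 (t - a) - max 0 (t - a - k) - max 0 (t - b) + max 0 (t - b - k)) / (k * (b - a))"

context
  fixes a b k :: real
  assumes ab: "a < b" and k: "0 < k"
begin

lemma ramp_has_derivative: "(ramp a b k has_real_derivative ramp' a b k t) (at t)"
proof -
  have *: "((\<lambda>t. (max 0 (t - c))\<^sup>2) has_real_derivative 2 * max 0 (t - c)) (at t)" for c
  proof -
    have "((\<lambda>t. t - c) has_real_derivative 1) (at t)" by (auto intro!: derivative_eq_intros)
    from DERIV_chain2[OF has_real_derivative_max_0_sq this] show ?thesis by simp
  qed
  show ?thesis
  proof -
    have "((\<lambda>t. (max 0 (t - a))\<^sup>2 - (max 0 (t - (a + k)))\<^sup>2 - (max 0 (t - b))\<^sup>2 + (max 0 (t - (b + k)))\<^sup>2)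
      has_real_derivative (2 * max 0 (t - a) - 2 * max 0 (t - (a + k)) - 2 * max 0 (t - b) + 2 * max 0 (t - (b + k)))) (at t)"
      by (intro DERIV_add DERIV_diff *)
    from DERIV_cdivide[OF this, of "2 * k * (b - a)"]
    have "((\<lambda>t. ramp a b k t) has_real_derivative
       (2 * max 0 (t - a) - 2 * max 0 (t - (a + k)) - 2 * max 0 (t - b) + 2 * max 0 (t - (b + k))) / (2 * k * (b - a))) (at t)"
      unfolding ramp_def diff_diff_eq .
    also have "(2 * max 0 (t - a) - 2 * max 0 (t - (a + k)) - 2 * max 0 (t - b) + 2 * max 0 (t - (b + k))) / (2 * k * (b - a)) = ramp' a b k t"
    proof -
      have "2 * max 0 (t - a) - 2 * max 0 (t - (a + k)) - 2 * max 0 (t - b) + 2 * max 0 (t - (b + k))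
          = 2 * (max 0 (t - a) - max 0 (t - (a + k)) - max 0 (t - b) + max 0 (t - (b + k)))" by simp
      then show ?thesis unfolding ramp'_def diff_diff_eq mult.assoc by (simp only: mult_divide_mult_cancel_left_if) simp
    qed
    finally show ?thesis .
  qed
qed

lemma ramp'_continuous: "continuous_on S (ramp' a b k)"
  unfolding ramp'_def by (intro continuous_intros) (use ab k in auto)

lemma ramp'_nonneg: "0 \<le> ramp' a b k t"
  unfolding ramp'_def using ab k by (intro divide_nonneg_pos) (auto simp: max_def)

text \<open>Smoothing does not exceed the slope of the linear ramp; it only extends the transition
  interval by \<open>k\<close>. Hence the energy is at most
  \<open>(b + k - a) / (b - a)\<^sup>2\<close>, close to the optimal value for small
  \<open>k\<close>.\<close>

lemma ramp'_le: "ramp' a b k t \<le> 1 / (b - a)"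
proof -
  have "max 0 (t - a) - max 0 (t - a - k) - max 0 (t - b) + max 0 (t - b - k) \<le> k"
    using ab k by (auto simp: max_def)
  then have "ramp' a b k t \<le> k / (k * (b - a))"
    unfolding ramp'_def using ab k by (intro divide_right_mono) auto
  then show ?thesis using k by simp
qed

lemma ramp'_eq_0: "t \<le> a \<or> b + k \<le> t \<Longrightarrow> ramp' a b k t = 0"
  unfolding ramp'_def using ab k by (auto simp: max_def)

lemma ramp_eq_0: "t \<le> a \<Longrightarrow> ramp a b k t = 0"
  unfolding ramp_def using ab k by (auto simp: max_def)

lemma ramp_eq_1: "b + k \<le> t \<Longrightarrow> ramp a b k t = 1"
proof -
  assume t: "b + k \<le> t"
  have "(t - a)\<^sup>2 - (t - a - k)\<^sup>2 - (t - b)\<^sup>2 + (t - b - k)\<^sup>2 = 2 * k * (b - a)"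
    by (simp add: power2_eq_square algebra_simps)
  then show ?thesis unfolding ramp_def using t ab k by (simp add: max_def)
qed

lemma ramp_mono: "s \<le> t \<Longrightarrow> ramp a b k s \<le> ramp a b k t"
  by (rule DERIV_nonneg_imp_nondecreasing) (use ramp_has_derivative ramp'_nonneg in blast)+

lemma ramp_range: "0 \<le> ramp a b k t" "ramp a b k t \<le> 1"
  using ramp_mono[of "min a t" t] ramp_mono[of t "max (b + k) t"] ramp_eq_0[of "min a t"] ramp_eq_1[of "max (b + k) t"] by auto

end

text \<open>Continuity of the gradient is part of the notion because the estimate along every
  rectifiable curve integrates it over that curve.\<close>

definition has_gradient_on :: "(complex \<Rightarrow> real) \<Rightarrow> (complex \<Rightarrow> complex) \<Rightarrow> complex set \<Rightarrow> bool" where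
  "has_gradient_on u g S \<longleftrightarrow> (\<forall>z\<in>S. (u has_derivative (\<lambda>h. g z \<bullet> h)) (at z)) \<and> continuous_on S g"

lemma has_gradient_onD: "has_gradient_on u g S \<Longrightarrow> z \<in> S \<Longrightarrow> (u has_derivative (\<lambda>h. g z \<bullet> h)) (at z)"
  by (simp add: has_gradient_on_def)

lemma gradient_zero_if_locally_constant:
  assumes "has_gradient_on u g S" "z \<in> S" "open N" "z \<in> N" "\<And>w. w \<in> N \<Longrightarrow> u w = c"
  shows "g z = 0"
proof -
  have "((\<lambda>_. c) has_derivative (\<lambda>h. 0)) (at z)" by simp
  then have "(u has_derivative (\<lambda>h. 0)) (at z)"
    by (rule has_derivative_transform_within_open[OF _ assms(3,4)]) (use assms(5) in auto)
  with has_gradient_onD[OF assms(1,2)] have "(\<lambda>h. g z \<bullet> h) = (\<lambda>h. 0)" by (rule has_derivative_unique)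
  then have "g z \<bullet> g z = 0" by meson
  then show ?thesis by simp
qed

lemma has_gradient_on_mult:
  assumes "has_gradient_on u g S" "has_gradient_on v h S"
  shows "has_gradient_on (\<lambda>z. u z * v z) (\<lambda>z. u z *\<^sub>R h z + v z *\<^sub>R g z) S"
proof -
  have "continuous_on S u" "continuous_on S v"
    using assms unfolding has_gradient_on_def
    by (meson continuous_at_imp_continuous_on has_derivative_continuous)+
  then show ?thesis
    using assms unfolding has_gradient_on_def
    by (auto intro!: derivative_eq_intros continuous_intros simp: inner_add_left algebra_simps)
qed

lemma has_gradient_on_add:
  assumes "has_gradient_on u g S" "has_gradient_on v h S"
  shows "has_gradient_on (\<lambda>z. u z + v z) (\<lambda>z. g z + h z) S"
  using assms unfolding has_gradient_on_def
  by (auto intro!: derivative_eq_intros continuous_intros simp: inner_add_left)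

lemma has_gradient_on_const: "has_gradient_on (\<lambda>_. c) (\<lambda>_. 0) S"
  by (simp add: has_gradient_on_def)

lemma has_gradient_on_minus:
  assumes "has_gradient_on u g S"
  shows "has_gradient_on (\<lambda>z. - u z) (\<lambda>z. - g z) S"
  using assms unfolding has_gradient_on_def
  by (auto intro!: derivative_eq_intros continuous_intros)

text \<open>The radius is squared, so its sign is irrelevant; for \<open>r = 0\<close> the bump is identically \<open>0\<close>.\<close>
definition bump :: "complex \<Rightarrow> real \<Rightarrow> complex \<Rightarrow> real" where
  "bump c r w = ramp 1 2 1 ((norm (w - c))\<^sup>2 / r\<^sup>2)"

definition bump_grad :: "complex \<Rightarrow> real \<Rightarrow> complex \<Rightarrow> complex" where
  "bump_grad c r w = (ramp' 1 2 1 ((norm (w - c))\<^sup>2 / r\<^sup>2) * (2 / r\<^sup>2)) *\<^sub>R (w - c)"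

lemma bump_gradient: "has_gradient_on (bump c r) (bump_grad c r) UNIV"
  unfolding has_gradient_on_def
proof (intro conjI ballI)
  fix w
  have "((\<lambda>w. (w - c) \<bullet> (w - c) / r\<^sup>2) has_derivative (\<lambda>h. 2 * ((w - c) \<bullet> h) / r\<^sup>2)) (at w)"
    unfolding divide_inverse by (auto intro!: derivative_eq_intros simp: inner_commute)
  then have "((\<lambda>w. (norm (w - c))\<^sup>2 / r\<^sup>2) has_derivative (\<lambda>h. 2 * ((w - c) \<bullet> h) / r\<^sup>2)) (at w)"
    by (simp add: power2_norm_eq_inner)
  moreover have "(ramp 1 2 1 has_derivative (\<lambda>h. ramp' 1 2 1 ((norm (w - c))\<^sup>2 / r\<^sup>2) * h)) (at ((norm (w - c))\<^sup>2 / r\<^sup>2))"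
    using ramp_has_derivative[of 1 2 1 "(norm (w - c))\<^sup>2 / r\<^sup>2"] by (simp add: has_field_derivative_def)
  ultimately have "((\<lambda>w. ramp 1 2 1 ((norm (w - c))\<^sup>2 / r\<^sup>2)) has_derivative
      (\<lambda>h. ramp' 1 2 1 ((norm (w - c))\<^sup>2 / r\<^sup>2) * (2 * ((w - c) \<bullet> h) / r\<^sup>2))) (at w)"
    by (rule has_derivative_compose)
  then show "(bump c r has_derivative (\<lambda>h. bump_grad c r w \<bullet> h)) (at w)"
    unfolding bump_def[abs_def] bump_grad_def by (simp add: mult.assoc)
next
  have "continuous_on UNIV (\<lambda>w. (norm (w - c))\<^sup>2 / r\<^sup>2)"
    unfolding divide_inverse by (intro continuous_intros)
  then show "continuous_on UNIV (bump_grad c r)"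
    unfolding bump_grad_def
    by (intro continuous_on_scaleR continuous_on_mult continuous_on_const continuous_on_diff continuous_on_id
        continuous_on_compose2[OF ramp'_continuous[of 1 2 1 UNIV]]) auto
qed

lemma bump_range: "0 \<le> bump c r w" "bump c r w \<le> 1"
  unfolding bump_def by (simp_all add: ramp_range)

lemma bump_eq_0: "norm (w - c) \<le> r \<Longrightarrow> bump c r w = 0"
proof -
  assume w: "norm (w - c) \<le> r"
  then have "(norm (w - c))\<^sup>2 \<le> r\<^sup>2" by (intro power_mono) auto
  then have "(norm (w - c))\<^sup>2 / r\<^sup>2 \<le> 1" by (cases "r = 0") (auto simp: divide_le_eq_1)
  then show ?thesis unfolding bump_def by (intro ramp_eq_0) auto
qed

lemma bump_outside:
  assumes "0 < r" "2 * r \<le> norm (w - c)"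
  shows "bump c r w = 1" "bump_grad c r w = 0"
proof -
  have "(2 * r)\<^sup>2 \<le> (norm (w - c))\<^sup>2" using assms by (intro power_mono) auto
  moreover have "3 * r\<^sup>2 \<le> (2 * r)\<^sup>2" by (simp add: power_mult_distrib)
  ultimately have "3 * r\<^sup>2 \<le> (norm (w - c))\<^sup>2" by linarith
  then have "3 \<le> (norm (w - c))\<^sup>2 / r\<^sup>2" using assms by (simp add: pos_le_divide_eq)
  then show "bump c r w = 1" "bump_grad c r w = 0"
    unfolding bump_def bump_grad_def by (auto intro: ramp_eq_1 simp: ramp'_eq_0)
qed

text \<open>The ramp has slope at most 1, and the gradient vanishes beyond distance
  \<open>2 * \<bar>r\<bar>\<close> from \<open>c\<close>, which gives
  \<open>(2 / r\<^sup>2) * (2 * \<bar>r\<bar>)\<close>. For \<open>r = 0\<close> both sides are 0 by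
  the convention on division.\<close>

lemma bump_grad_le: "norm (bump_grad c r w) \<le> 4 / \<bar>r\<bar>"
proof (cases "r = 0 \<or> 2 * \<bar>r\<bar> \<le> norm (w - c)")
  case True
  then have "bump_grad c r w = 0"
    using bump_outside(2)[of "\<bar>r\<bar>" w c] by (auto simp: bump_grad_def)
  then show ?thesis by simp
next
  case False
  then have r: "r \<noteq> 0" "norm (w - c) \<le> 2 * \<bar>r\<bar>" by auto
  have "norm (bump_grad c r w) = ramp' 1 2 1 ((norm (w - c))\<^sup>2 / r\<^sup>2) * (2 / r\<^sup>2) * norm (w - c)"
    unfolding bump_grad_def by (simp add: abs_mult ramp'_nonneg)
  also have "\<dots> \<le> 1 * (2 / r\<^sup>2) * (2 * \<bar>r\<bar>)"
    using r ramp'_le[of 1 2 1] by (intro mult_mono) (auto simp: ramp'_nonneg)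
  also have "\<dots> = 4 / \<bar>r\<bar>" using r by (simp add: power2_eq_square abs_if field_simps)
  finally show ?thesis .
qed

text \<open>Indexing the cut-offs by lists of rationals makes the family countable.\<close>
type_synonym cutoff_code = "(rat \<times> rat \<times> rat) list"

fun cutoff :: "cutoff_code \<Rightarrow> complex \<Rightarrow> real" where
  "cutoff [] w = 1"
| "cutoff ((p, q, r) # xs) w = bump (Complex (of_rat p) (of_rat q)) (of_rat r) w * cutoff xs w"

fun cutoff_grad :: "cutoff_code \<Rightarrow> complex \<Rightarrow> complex" where
  "cutoff_grad [] w = 0"
| "cutoff_grad ((p, q, r) # xs) w =
     bump (Complex (of_rat p) (of_rat q)) (of_rat r) w *\<^sub>R cutoff_grad xs w +
     cutoff xs w *\<^sub>R bump_grad (Complex (of_rat p) (of_rat q)) (of_rat r) w"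

lemma cutoff_gradient: "has_gradient_on (cutoff xs) (cutoff_grad xs) UNIV"
proof (induction xs)
  case Nil
  have "cutoff [] = (\<lambda>_. 1)" "cutoff_grad [] = (\<lambda>_. 0)" by auto
  then show ?case by (simp add: has_gradient_on_const)
next
  case (Cons x xs)
  obtain p q r where x: "x = (p, q, r)" by (cases x)
  have eq: "cutoff (x # xs) = (\<lambda>w. bump (Complex (of_rat p) (of_rat q)) (of_rat r) w * cutoff xs w)"
    "cutoff_grad (x # xs) = (\<lambda>w. bump (Complex (of_rat p) (of_rat q)) (of_rat r) w *\<^sub>R cutoff_grad xs w +
     cutoff xs w *\<^sub>R bump_grad (Complex (of_rat p) (of_rat q)) (of_rat r) w)" by (auto simp: x)
  show ?case unfolding eq by (intro has_gradient_on_mult bump_gradient Cons)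
qed

lemma cutoff_range: "0 \<le> cutoff xs w \<and> cutoff xs w \<le> 1"
  by (induction xs) (auto simp: bump_range mult_le_one)

lemma cutoff_grad_bounded: "\<exists>C. \<forall>w. norm (cutoff_grad xs w) \<le> C"
proof (induction xs)
  case (Cons x xs)
  obtain p q r where x: "x = (p, q, r)" by (cases x)
  obtain C where C: "\<And>w. norm (cutoff_grad xs w) \<le> C" using Cons by blast
  let ?c = "Complex (of_rat p) (of_rat q)" and ?r = "of_rat r :: real"
  have "norm (cutoff_grad (x # xs) w) \<le> C + 4 / \<bar>?r\<bar>" for w
  proof -
    have "norm (cutoff_grad (x # xs) w) \<le> \<bar>bump ?c ?r w\<bar> * norm (cutoff_grad xs w) + \<bar>cutoff xs w\<bar> * norm (bump_grad ?c ?r w)"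
      unfolding x cutoff_grad.simps by (rule order_trans[OF norm_triangle_ineq]) simp
    also have "\<dots> \<le> 1 * norm (cutoff_grad xs w) + 1 * norm (bump_grad ?c ?r w)"
      using bump_range[of ?c ?r w] cutoff_range[of xs w] by (intro add_mono mult_right_mono) auto
    also have "\<dots> \<le> C + 4 / \<bar>?r\<bar>" using C[of w] bump_grad_le[of ?c ?r w] by simp
    finally show ?thesis .
  qed
  then show ?case by blast
qed auto

lemma cutoff_eq_0: "(p, q, r) \<in> set xs \<Longrightarrow> norm (w - Complex (of_rat p) (of_rat q)) \<le> of_rat r \<Longrightarrow> cutoff xs w = 0"
  by (induction xs) (auto simp: bump_eq_0)

lemma cutoff_eq_1:
  "(\<And>p q r. (p, q, r) \<in> set xs \<Longrightarrow> 0 < r \<and> 2 * of_rat r \<le> norm (w - Complex (of_rat p) (of_rat q))) \<Longrightarrow> cutoff xs w = 1"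
proof (induction xs)
  case (Cons x xs)
  obtain p q r where x: "x = (p, q, r)" by (cases x)
  have "cutoff xs w = 1"
  proof (rule Cons.IH)
    fix p q r assume "(p, q, r) \<in> set xs"
    then show "0 < r \<and> 2 * of_rat r \<le> norm (w - Complex (of_rat p) (of_rat q))"
      using Cons.prems[of p q r] by simp
  qed
  moreover have "bump (Complex (of_rat p) (of_rat q)) (of_rat r) w = 1"
    using Cons.prems[of p q r] by (intro bump_outside) (auto simp: x)
  ultimately show ?case by (simp add: x)
qed simp

text \<open>Cover \<open>K\<close> by finitely many rational disks whose doubles stay in
  \<open>U\<close>; the product of their bumps vanishes on the disks and is 1 off
  \<open>U\<close>.\<close>

lemma cutoff_separates:
  assumes K: "compact K" and U: "open U" "K \<subseteq> U"
  obtains xs N where "open N" "K \<subseteq> N" "\<And>w. w \<in> N \<Longrightarrow> cutoff xs w = 0" "\<And>w. w \<notin> U \<Longrightarrow> cutoff xs w = 1"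
proof -
  define c where "c x = (case x of (p, q, r) \<Rightarrow> Complex (of_rat p) (of_rat q))" for x :: "rat \<times> rat \<times> rat"
  define rd :: "rat \<times> rat \<times> rat \<Rightarrow> real" where "rd x = of_rat (snd (snd x))" for x
  define G where "G = {x. 0 < snd (snd x) \<and> cball (c x) (2 * rd x) \<subseteq> U}"
  have cover: "\<exists>x\<in>G. w \<in> ball (c x) (rd x)" if w: "w \<in> K" for w
  proof -
    obtain e where e: "e > 0" "ball w e \<subseteq> U" using U w unfolding open_contains_ball by blast
    \<comment> \<open>A third of \<open>e\<close>: the centre will be within \<open>r\<close> of
      \<open>w\<close>, and the doubled disk reaches \<open>2 * r\<close> further.\<close>
    obtain r :: rat where r: "0 < (of_rat r :: real)" "of_rat r < e / 3"
      using of_rat_dense[of 0 "e / 3"] e by auto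
    obtain p :: rat where p: "Re w - of_rat r / 2 < of_rat p" "of_rat p < Re w"
      using of_rat_dense[of "Re w - of_rat r / 2" "Re w"] r by auto
    obtain q :: rat where q: "Im w - of_rat r / 2 < of_rat q" "of_rat q < Im w"
      using of_rat_dense[of "Im w - of_rat r / 2" "Im w"] r by auto
    let ?x = "(p, q, r)"
    have d: "dist (c ?x) w < of_rat r"
      using cmod_le[of "c ?x - w"] p q by (simp add: dist_norm c_def)
    have "cball (c ?x) (2 * rd ?x) \<subseteq> ball w e"
    proof
      fix z assume "z \<in> cball (c ?x) (2 * rd ?x)"
      then have "dist (c ?x) z \<le> 2 * of_rat r" by (simp add: rd_def)
      then show "z \<in> ball w e" using dist_triangle[of w z "c ?x"] d r by (simp add: dist_commute)
    qed
    then have "?x \<in> G" using e r by (auto simp: G_def)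
    moreover have "w \<in> ball (c ?x) (rd ?x)" using d by (simp add: rd_def)
    ultimately show ?thesis by blast
  qed
  obtain F where F: "F \<subseteq> G" "finite F" "K \<subseteq> (\<Union>x\<in>F. ball (c x) (rd x))"
  proof (rule compactE_image[OF K, of G "\<lambda>x. ball (c x) (rd x)"])
    show "K \<subseteq> (\<Union>x\<in>G. ball (c x) (rd x))" using cover by blast
  qed auto
  obtain xs where xs: "set xs = F" using finite_list[OF F(2)] by blast
  show thesis
  proof (rule that[of "\<Union>x\<in>F. ball (c x) (rd x)" xs])
    show "cutoff xs w = 0" if "w \<in> (\<Union>x\<in>F. ball (c x) (rd x))" for w
    proof -
      obtain x where "x \<in> F" "w \<in> ball (c x) (rd x)" using \<open>w \<in> _\<close> by blast
      then obtain p q r where "(p, q, r) \<in> F" "w \<in> ball (c (p, q, r)) (rd (p, q, r))" by (metis surj_pair)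
      then show ?thesis
        using cutoff_eq_0[of p q r xs w] xs by (auto simp: c_def rd_def dist_norm norm_minus_commute)
    qed
    show "cutoff xs w = 1" if "w \<notin> U" for w
    proof (rule cutoff_eq_1)
      fix p q r assume "(p, q, r) \<in> set xs"
      then have g: "(p, q, r) \<in> G" using xs F(1) by blast
      then have "w \<notin> cball (c (p, q, r)) (2 * rd (p, q, r))" using that by (auto simp: G_def)
      then show "0 < r \<and> 2 * of_rat r \<le> norm (w - Complex (of_rat p) (of_rat q))"
        using g by (auto simp: G_def c_def rd_def dist_norm norm_minus_commute)
    qed
  qed (use F in auto)
qed

section \<open>Fibres that end at a prescribed boundary point\<close>

context under_graph_map
begin

text \<open>The adjoint of multiplication by the derivative, for the real inner product, is
  multiplication by its conjugate.\<close>

lemma has_gradient_on_compose_phi: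
  assumes "has_gradient_on u g UNIV"
  shows "has_gradient_on (\<lambda>z. u (\<phi> z)) (\<lambda>z. cnj (deriv \<phi> z) * g (\<phi> z)) D"
  unfolding has_gradient_on_def
proof (intro conjI ballI)
  fix z assume z: "z \<in> D"
  have "((\<lambda>z. u (\<phi> z)) has_derivative (\<lambda>h. g (\<phi> z) \<bullet> (deriv \<phi> z * h))) (at z)"
    by (rule has_derivative_compose[OF phi_deriv[OF z, unfolded has_field_derivative_def]])
       (use assms in \<open>simp add: has_gradient_on_def\<close>)
  moreover have "g (\<phi> z) \<bullet> (deriv \<phi> z * h) = (cnj (deriv \<phi> z) * g (\<phi> z)) \<bullet> h" for h
    by (simp add: inner_complex_def algebra_simps)
  ultimately show "((\<lambda>z. u (\<phi> z)) has_derivative (\<lambda>h. (cnj (deriv \<phi> z) * g (\<phi> z)) \<bullet> h)) (at z)" by simp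
next
  have "continuous_on D (\<lambda>z. g (\<phi> z))"
    using assms by (intro continuous_on_compose2[OF _ phi_cont, of UNIV g]) (auto simp: has_gradient_on_def)
  then show "continuous_on D (\<lambda>z. cnj (deriv \<phi> z) * g (\<phi> z))"
    by (intro continuous_intros deriv_cont)
qed

lemma borel_fibre_preimage:
  assumes "open N" "x \<in> base"
  shows "open {y \<in> {0<..<f x}. \<phi> (Complex x y) \<in> N}"
proof -
  have "open ({0<..<f x} \<inter> (\<lambda>y. \<phi> (Complex x y)) -` N)"
    by (rule continuous_open_preimage[OF continuous_on_fibre[OF phi_cont assms(2)] _ assms(1)]) auto
  then show ?thesis by (simp add: Int_def vimage_def)
qed

text \<open>The sets decrease, have finite measure, and have empty intersection because the map
  takes values in the open disk.\<close>

lemma emeasure_near_limit_tendsto_0: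
  assumes x: "x \<in> base" and \<alpha>: "norm \<alpha> = 1"
  shows "(\<lambda>j. emeasure lborel {y \<in> {0<..<f x}. \<phi> (Complex x y) \<in> ball \<alpha> (2 / 2 ^ j)}) \<longlonglongrightarrow> 0"
proof -
  define M where "M j = {y \<in> {0<..<f x}. \<phi> (Complex x y) \<in> ball \<alpha> (2 / 2 ^ j)}" for j :: nat
  have "(\<lambda>j. emeasure lborel (M j)) \<longlonglongrightarrow> emeasure lborel (\<Inter>j. M j)"
  proof (rule Lim_emeasure_decseq)
    have "M j \<in> sets lborel" for j
      using borel_fibre_preimage[OF open_ball x, of \<alpha> "2 / 2 ^ j"] unfolding M_def sets_lborel by (rule borel_open)
    then show "range M \<subseteq> sets lborel" by blast
    show "decseq M"
    proof (rule antimonoI)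
      fix i j :: nat assume "i \<le> j"
      then have "2 / 2 ^ j \<le> (2 / 2 ^ i :: real)" by (intro divide_left_mono power_increasing) auto
      then have sub: "ball \<alpha> (2 / 2 ^ j) \<subseteq> ball \<alpha> (2 / 2 ^ i)" by (rule subset_ball)
      show "M j \<subseteq> M i" unfolding M_def by (rule Collect_mono) (use sub in \<open>blast intro: subsetD\<close>)
    qed
    show "emeasure lborel (M j) \<noteq> \<infinity>" for j
    proof -
      have "bounded (M j)" by (rule bounded_subset[of "{0<..<f x}"]) (auto simp: M_def)
      then show ?thesis using emeasure_bounded_finite by (metis less_irrefl)
    qed
  qed
  moreover have "(\<Inter>j. M j) = {}"
  proof (rule ccontr)
    assume "(\<Inter>j. M j) \<noteq> {}"
    then obtain y where y: "\<And>j. y \<in> M j" by blast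
    then have "Complex x y \<in> D" using x by (auto simp: M_def mem_D)
    then have "norm (\<phi> (Complex x y)) < 1" using phi_image by fastforce
    then have "\<phi> (Complex x y) \<noteq> \<alpha>" using \<alpha> by auto
    then have "0 < dist \<alpha> (\<phi> (Complex x y)) / 2" by simp
    then obtain j where "(1 / 2) ^ j < dist \<alpha> (\<phi> (Complex x y)) / 2"
      using real_arch_pow_inv[of "dist \<alpha> (\<phi> (Complex x y)) / 2" "1/2"] by auto
    then have "2 / 2 ^ j < dist \<alpha> (\<phi> (Complex x y))" by (simp add: power_divide)
    then show False using y[of j] by (simp add: M_def)
  qed
  ultimately show ?thesis by (simp add: M_def)
qed

text \<open>An upper bound for the energy, on the fibre over \<open>x\<close>, of the bump of radius
  \<open>1 / 2 ^ j\<close> about \<alpha> composed with the Riemann map: the bump has gradient at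
  most \<open>4 * 2 ^ j\<close>, and this gradient vanishes outside the disk of twice the
  radius.\<close>

definition annulus_energy :: "complex \<Rightarrow> nat \<Rightarrow> real \<Rightarrow> ennreal" where
  "annulus_energy \<alpha> j x = ennreal ((4 * 2 ^ j)\<^sup>2) *
     (\<integral>\<^sup>+ y. indicator (\<phi> -` ball \<alpha> (2 / 2 ^ j) \<inter> D) (Complex x y) * energy_density (Complex x y) \<partial>lborel)"

lemma preimage_ball_borel [measurable]: "\<phi> -` ball \<alpha> r \<inter> D \<in> sets borel"
  using continuous_open_preimage[OF phi_cont open_D open_ball] by (simp add: Int_commute)

lemma annulus_energy_measurable [measurable]: "annulus_energy \<alpha> j \<in> borel_measurable borel"
proof -
  have [measurable]: "(\<lambda>z. indicator (\<phi> -` ball \<alpha> (2 / 2 ^ j) \<inter> D) z * energy_density z) \<in> borel_measurable borel"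
    by measurable
  have [measurable]: "(\<lambda>x. \<integral>\<^sup>+ y. indicator (\<phi> -` ball \<alpha> (2 / 2 ^ j) \<inter> D) (Complex x y) * energy_density (Complex x y) \<partial>lborel) \<in> borel_measurable borel"
    by (rule borel_measurable_fibre_integral) measurable
  show ?thesis unfolding annulus_energy_def[abs_def] by measurable
qed

text \<open>The bump of radius \<open>2\<^sup>-\<^sup>j\<close> has gradient of size \<open>2\<^sup>j\<close> on a disk of that scale, so its Dirichlet
  integral is bounded independently of \<open>j\<close>.\<close>
lemma annulus_energy_bounded:
  "(\<integral>\<^sup>+ x. annulus_energy \<alpha> j x \<partial>lborel) \<le> ennreal (64 * unit_ball_vol 2)"
proof -
  have "(\<integral>\<^sup>+ x. annulus_energy \<alpha> j x \<partial>lborel)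
     = ennreal ((4 * 2 ^ j)\<^sup>2) * (\<integral>\<^sup>+ x. \<integral>\<^sup>+ y. indicator (\<phi> -` ball \<alpha> (2 / 2 ^ j) \<inter> D) (Complex x y) * energy_density (Complex x y) \<partial>lborel \<partial>lborel)"
    unfolding annulus_energy_def by (rule nn_integral_cmult) measurable
  also have "\<dots> = ennreal ((4 * 2 ^ j)\<^sup>2) * (\<integral>\<^sup>+ z. indicator (\<phi> -` ball \<alpha> (2 / 2 ^ j) \<inter> D) z * energy_density z \<partial>lborel)"
    by (subst nn_integral_complex_iterated) auto
  also have "\<dots> \<le> ennreal ((4 * 2 ^ j)\<^sup>2) * emeasure lborel (ball \<alpha> (2 / 2 ^ j))"
    by (intro mult_left_mono energy_preimage_ball) auto
  \<comment> \<open>The factor \<open>16 * 4 ^ j\<close> meets the area \<open>4 / 4 ^ j\<close>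
    times the area of the unit disk; the powers cancel.\<close>
  also have "\<dots> = ennreal (64 * unit_ball_vol 2)"
    by (subst emeasure_ball) (auto simp: power_mult_distrib power_divide field_simps simp flip: ennreal_mult)
  finally show ?thesis .
qed

text \<open>If the fibre ends at \<alpha>, the bump falls along it from 1 at the midpoint to 0.
  Cauchy-Schwarz, restricted to the part of the fibre mapped into the doubled disk, bounds this
  change by measure times energy.\<close>

lemma fibre_limit_annulus_energy:
  assumes x: "x \<in> base" and \<alpha>: "norm \<alpha> = 1" and e0: "e0 = 0 \<or> e0 = f x" and lim: "fibre_limit x e0 \<alpha>"
  shows "\<forall>\<^sub>F j in sequentially. 1 \<le> emeasure lborel {y \<in> {0<..<f x}. \<phi> (Complex x y) \<in> ball \<alpha> (2 / 2 ^ j)} * annulus_energy \<alpha> j x"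
proof -
  have fx: "0 < f x" using pos x .
  have inD: "Complex x y \<in> D" if "y \<in> {0<..<f x}" for y using that x by (auto simp: mem_D)
  let ?y1 = "f x / 2"
  have y1: "?y1 \<in> {0<..<f x}" using fx by auto
  have "norm (\<phi> (Complex x ?y1)) < 1" using phi_image inD[OF y1] by fastforce
  then have d0: "0 < dist \<alpha> (\<phi> (Complex x ?y1))" using \<alpha> by auto
  have "(\<lambda>j. 2 * (1 / 2) ^ j) \<longlonglongrightarrow> 2 * (0::real)"
    by (intro tendsto_mult tendsto_const LIMSEQ_power_zero) auto
  then have "\<forall>\<^sub>F j in sequentially. 2 * (1 / 2) ^ j < dist \<alpha> (\<phi> (Complex x ?y1))"
    using d0 by (simp add: order_tendsto_iff)
  then show ?thesis
  proof eventually_elim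
    case (elim j)
    define r :: real where "r = 1 / 2 ^ j"
    have r: "0 < r" by (simp add: r_def)
    have far: "2 * r \<le> norm (\<phi> (Complex x ?y1) - \<alpha>)"
      using elim by (simp add: r_def power_divide dist_norm norm_minus_commute)
    have "\<forall>\<^sub>F y in at e0 within {0<..<f x}. dist (\<phi> (Complex x y)) \<alpha> < r"
      using lim r unfolding fibre_limit_def tendsto_iff by blast
    moreover have "\<forall>\<^sub>F y in at e0 within {0<..<f x}. y \<in> {0<..<f x}" by (simp add: eventually_at_filter)
    moreover have "at e0 within {0<..<f x} \<noteq> bot"
    proof -
      have "{0<..<f x} - {e0} = {0<..<f x}" using e0 by auto
      moreover have "e0 \<in> closure {0<..<f x}" using e0 fx by auto
      ultimately show ?thesis by (simp add: at_within_eq_bot_iff)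
    qed
    ultimately obtain y2 where y2: "y2 \<in> {0<..<f x}" "dist (\<phi> (Complex x y2)) \<alpha> < r"
      by (metis (mono_tags, lifting) eventually_conj eventually_happens)
    define h where "h y = bump \<alpha> r (\<phi> (Complex x y))" for y
    define g where "g z = cnj (deriv \<phi> z) * bump_grad \<alpha> r (\<phi> z)" for z
    define h' where "h' y = g (Complex x y) \<bullet> \<i>" for y
    have grad: "has_gradient_on (\<lambda>z. bump \<alpha> r (\<phi> z)) g D"
      unfolding g_def by (rule has_gradient_on_compose_phi[OF bump_gradient])
    define S where "S = {y \<in> {0<..<f x}. \<phi> (Complex x y) \<in> ball \<alpha> (2 / 2 ^ j)}"
    have S_open: "open S" unfolding S_def by (rule borel_fibre_preimage[OF open_ball x])
    define a where "a = min ?y1 y2"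
    define b where "b = max ?y1 y2"
    have ab: "a \<le> b" "{a..b} \<subseteq> {0<..<f x}" using y1 y2 by (auto simp: a_def b_def)
    have "h ?y1 = 1" unfolding h_def using far r by (intro bump_outside) auto
    moreover have "h y2 = 0" unfolding h_def using y2 by (intro bump_eq_0) (simp add: dist_norm)
    ultimately have "(norm (h b - h a))\<^sup>2 = 1" by (auto simp: a_def b_def min_def max_def)
    then have "1 = ennreal ((norm (h b - h a))\<^sup>2)" by simp
    also have "\<dots> \<le> emeasure lborel (S \<inter> {a..b}) * (\<integral>\<^sup>+ t \<in> {a..b}. ennreal ((norm (h' t))\<^sup>2) \<partial>lborel)"
    proof (rule norm_diff_sq_le_nn_integral)
      show "S \<in> sets borel" using S_open by simp
      show "(h has_vector_derivative h' t) (at t within {a..b})" if "t \<in> {a..b}" for t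
        unfolding h_def[abs_def] h'_def
        by (rule has_vector_derivative_fibre[OF has_gradient_onD[OF grad]]) (use that ab inD in blast)
      have "continuous_on D g" using grad by (simp add: has_gradient_on_def)
      then show "continuous_on {a..b} h'"
        unfolding h'_def using ab x
        by (intro continuous_intros continuous_on_subset[OF continuous_on_fibre]) auto
      show "h' t = 0" if "t \<in> {a..b}" "t \<notin> S" for t
      proof -
        have "\<phi> (Complex x t) \<notin> ball \<alpha> (2 / 2 ^ j)" using that ab unfolding S_def by blast
        then have "2 * r \<le> norm (\<phi> (Complex x t) - \<alpha>)" by (simp add: r_def dist_norm norm_minus_commute)
        then show ?thesis using bump_outside(2)[OF r] by (simp add: h'_def g_def)
      qed
    qed (use ab in auto)
    also have "\<dots> \<le> emeasure lborel S * annulus_energy \<alpha> j x"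
    proof (rule mult_mono)
      show "emeasure lborel (S \<inter> {a..b}) \<le> emeasure lborel S" using S_open by (intro emeasure_mono) auto
      have "(\<integral>\<^sup>+ t \<in> {a..b}. ennreal ((norm (h' t))\<^sup>2) \<partial>lborel)
        \<le> (\<integral>\<^sup>+ y. ennreal ((4 * 2 ^ j)\<^sup>2) * (indicator (\<phi> -` ball \<alpha> (2 / 2 ^ j) \<inter> D) (Complex x y) * energy_density (Complex x y)) \<partial>lborel)"
      proof (rule nn_integral_mono)
        fix t
        show "ennreal ((norm (h' t))\<^sup>2) * indicator {a..b} t
          \<le> ennreal ((4 * 2 ^ j)\<^sup>2) * (indicator (\<phi> -` ball \<alpha> (2 / 2 ^ j) \<inter> D) (Complex x t) * energy_density (Complex x t))"
        proof (cases "t \<in> {a..b}")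
          case True
          then have D: "Complex x t \<in> D" using ab inD by blast
          show ?thesis
          proof (cases "\<phi> (Complex x t) \<in> ball \<alpha> (2 / 2 ^ j)")
            case False
            then have "2 * r \<le> norm (\<phi> (Complex x t) - \<alpha>)" by (simp add: r_def dist_norm norm_minus_commute)
            then show ?thesis using bump_outside(2)[OF r] by (simp add: h'_def g_def)
          next
            case in_ball: True
            have "norm (h' t) \<le> norm (g (Complex x t)) * norm \<i>"
              unfolding h'_def real_norm_def by (rule Cauchy_Schwarz_ineq2)
            also have "\<dots> = norm (deriv \<phi> (Complex x t)) * norm (bump_grad \<alpha> r (\<phi> (Complex x t)))"
              by (simp add: g_def norm_mult)
            also have "\<dots> \<le> norm (deriv \<phi> (Complex x t)) * (4 * 2 ^ j)"
              using bump_grad_le[of \<alpha> r "\<phi> (Complex x t)"] by (intro mult_left_mono) (auto simp: r_def)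
            finally have "(norm (h' t))\<^sup>2 \<le> (norm (deriv \<phi> (Complex x t)) * (4 * 2 ^ j))\<^sup>2"
              by (intro power_mono) auto
            then have "ennreal ((norm (h' t))\<^sup>2) \<le> ennreal ((4 * 2 ^ j)\<^sup>2) * ennreal ((norm (deriv \<phi> (Complex x t)))\<^sup>2)"
              by (simp add: power_mult_distrib mult.commute ennreal_leI flip: ennreal_mult)
            then show ?thesis using True D in_ball by (simp add: energy_density_def)
          qed
        qed simp
      qed
      also have "\<dots> = annulus_energy \<alpha> j x"
        unfolding annulus_energy_def by (rule nn_integral_cmult) measurable
      finally show "(\<integral>\<^sup>+ t \<in> {a..b}. ennreal ((norm (h' t))\<^sup>2) \<partial>lborel) \<le> annulus_energy \<alpha> j x" .
    qed auto
    finally show ?case by (simp add: S_def)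
  qed
qed

text \<open>Boundary points have capacity zero.\<close>
lemma AE_fibre_limit_ne:
  assumes \<alpha>: "norm \<alpha> = 1"
  shows "AE x in lborel. x \<in> base \<longrightarrow> \<not> fibre_limit x 0 \<alpha> \<and> \<not> fibre_limit x (f x) \<alpha>"
proof -
  \<comment> \<open>Fatou turns the uniform bound on the integrals into finiteness of the lower
    limit for almost every \<open>x\<close>.\<close>
  have "(\<integral>\<^sup>+ x. liminf (\<lambda>j. annulus_energy \<alpha> j x) \<partial>lborel) \<le> liminf (\<lambda>j. \<integral>\<^sup>+ x. annulus_energy \<alpha> j x \<partial>lborel)"
    by (rule nn_integral_liminf) measurable
  also have "\<dots> \<le> liminf (\<lambda>j. ennreal (64 * unit_ball_vol 2))"
    by (intro Liminf_mono always_eventually allI annulus_energy_bounded)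
  also have "\<dots> < \<infinity>" by (simp add: Liminf_const)
  finally have "AE x in lborel. liminf (\<lambda>j. annulus_energy \<alpha> j x) \<noteq> \<infinity>"
    by (intro nn_integral_PInf_AE) auto
  then show ?thesis
  proof eventually_elim
    case (elim x)
    \<comment> \<open>The added 1 gives a bound below which the energies fall infinitely
      often.\<close>
    define c where "c = liminf (\<lambda>j. annulus_energy \<alpha> j x) + 1"
    have c: "c < \<infinity>" using elim by (simp add: c_def less_top)
    have freq: "\<exists>\<^sub>F j in sequentially. annulus_energy \<alpha> j x < c"
    proof (rule ccontr)
      assume "\<not> ?thesis"
      then have "\<forall>\<^sub>F j in sequentially. c \<le> annulus_energy \<alpha> j x" by (simp add: not_frequently not_less)
      then have "c \<le> liminf (\<lambda>j. annulus_energy \<alpha> j x)" by (rule Liminf_bounded)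
      then show False using elim unfolding c_def
        by (cases "liminf (\<lambda>j. annulus_energy \<alpha> j x)") (auto simp flip: ennreal_1 ennreal_plus)
    qed
    \<comment> \<open>On a fibre ending at \<alpha> the product of \<open>m j\<close> and the energy
      stays at least 1 while \<open>m j\<close> tends to 0, so the energies could be below
      \<open>c\<close> only finitely often.\<close>
    have False if x: "x \<in> base" and e0: "e0 = 0 \<or> e0 = f x" and lim: "fibre_limit x e0 \<alpha>" for e0
    proof -
      define m where "m j = emeasure lborel {y \<in> {0<..<f x}. \<phi> (Complex x y) \<in> ball \<alpha> (2 / 2 ^ j)}" for j :: nat
      have "m \<longlonglongrightarrow> 0" unfolding m_def by (rule emeasure_near_limit_tendsto_0[OF x \<alpha>])
      then have "(\<lambda>j. c * m j) \<longlonglongrightarrow> c * 0" using c by (intro ennreal_tendsto_cmult) auto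
      then have "\<forall>\<^sub>F j in sequentially. c * m j < 1" by (simp add: order_tendsto_iff)
      moreover have "\<forall>\<^sub>F j in sequentially. 1 \<le> m j * annulus_energy \<alpha> j x"
        unfolding m_def by (rule fibre_limit_annulus_energy[OF x \<alpha> e0 lim])
      ultimately have "\<forall>\<^sub>F j in sequentially. \<not> annulus_energy \<alpha> j x < c"
      proof eventually_elim
        case (elim j)
        show ?case
        proof
          assume "annulus_energy \<alpha> j x < c"
          then have "m j * annulus_energy \<alpha> j x \<le> c * m j" unfolding mult.commute[of c] by (intro mult_left_mono) auto
          then show False using elim by (meson less_le_not_le order_trans)
        qed
      qed
      then show False using freq by (simp add: frequently_def)
    qed
    then show ?case by blast
  qed
qed

end

subsection \<open>Potentials\<close>

context under_graph_map
begin

text \<open>A square of three summands is at most three times the sum of their squares, and the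
  constant \<open>C\<close> is square integrable because \<open>D\<close> has finite area.\<close>

lemma square_integrable_mono:
  fixes g h k :: "complex \<Rightarrow> complex"
  assumes "\<And>z. z \<in> D \<Longrightarrow> norm (k z) \<le> norm (g z) + norm (h z) + C" "0 \<le> C"
    and cont: "continuous_on D g" "continuous_on D h"
    and fin: "(\<integral>\<^sup>+ z \<in> D. ennreal ((norm (g z))\<^sup>2) \<partial>lborel) < \<infinity>" "(\<integral>\<^sup>+ z \<in> D. ennreal ((norm (h z))\<^sup>2) \<partial>lborel) < \<infinity>"
  shows "(\<integral>\<^sup>+ z \<in> D. ennreal ((norm (k z))\<^sup>2) \<partial>lborel) < \<infinity>"
proof -
  have meas: "(\<lambda>z. ennreal ((norm (g z))\<^sup>2) * indicator D z) \<in> borel_measurable lborel"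
    if "continuous_on D g" for g :: "complex \<Rightarrow> complex"
  proof -
    have "(\<lambda>z. indicator D z *\<^sub>R (norm (g z))\<^sup>2) \<in> borel_measurable borel"
      using open_D that by (intro borel_measurable_continuous_on_indicator continuous_intros) auto
    then have "(\<lambda>z. ennreal (indicator D z *\<^sub>R (norm (g z))\<^sup>2)) \<in> borel_measurable borel"
      by (rule measurable_compose[OF _ measurable_ennreal])
    also have "(\<lambda>z. ennreal (indicator D z *\<^sub>R (norm (g z))\<^sup>2)) = (\<lambda>z. ennreal ((norm (g z))\<^sup>2) * indicator D z)"
      by (auto simp: fun_eq_iff indicator_def)
    finally show ?thesis by simp
  qed
  have sq: "(norm (k z))\<^sup>2 \<le> 3 * (norm (g z))\<^sup>2 + 3 * (norm (h z))\<^sup>2 + 3 * C\<^sup>2" if "z \<in> D" for z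
  proof -
    have "(norm (k z))\<^sup>2 \<le> (norm (g z) + norm (h z) + C)\<^sup>2"
      using assms(1)[OF that] by (intro power_mono) auto
    also have "\<dots> \<le> 3 * (norm (g z))\<^sup>2 + 3 * (norm (h z))\<^sup>2 + 3 * C\<^sup>2"
      using sum_squares_ge_zero[of "norm (g z) - norm (h z)" "norm (g z) - C"] zero_le_power2[of "norm (h z) - C"]
      by (simp add: power2_eq_square algebra_simps)
    finally show ?thesis .
  qed
  have "(\<integral>\<^sup>+ z \<in> D. ennreal ((norm (k z))\<^sup>2) \<partial>lborel) \<le>
    (\<integral>\<^sup>+ z. 3 * (ennreal ((norm (g z))\<^sup>2) * indicator D z) + 3 * (ennreal ((norm (h z))\<^sup>2) * indicator D z) + ennreal (3 * C\<^sup>2) * indicator D z \<partial>lborel)"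
  proof (rule nn_integral_mono)
    fix z
    show "ennreal ((norm (k z))\<^sup>2) * indicator D z \<le> 3 * (ennreal ((norm (g z))\<^sup>2) * indicator D z) + 3 * (ennreal ((norm (h z))\<^sup>2) * indicator D z) + ennreal (3 * C\<^sup>2) * indicator D z"
    proof (cases "z \<in> D")
      case True
      have "ennreal ((norm (k z))\<^sup>2) \<le> ennreal (3 * (norm (g z))\<^sup>2 + 3 * (norm (h z))\<^sup>2 + 3 * C\<^sup>2)"
        by (rule ennreal_leI[OF sq[OF True]])
      also have "\<dots> = 3 * ennreal ((norm (g z))\<^sup>2) + 3 * ennreal ((norm (h z))\<^sup>2) + ennreal (3 * C\<^sup>2)"
        by (simp add: ennreal_mult)
      finally show ?thesis using True by simp
    qed simp
  qed
  also have "\<dots> = 3 * (\<integral>\<^sup>+ z \<in> D. ennreal ((norm (g z))\<^sup>2) \<partial>lborel) + 3 * (\<integral>\<^sup>+ z \<in> D. ennreal ((norm (h z))\<^sup>2) \<partial>lborel)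
      + ennreal (3 * C\<^sup>2) * emeasure lborel D"
  proof -
    have [measurable]: "(\<lambda>z. ennreal ((norm (g z))\<^sup>2) * indicator D z) \<in> borel_measurable lborel"
      "(\<lambda>z. ennreal ((norm (h z))\<^sup>2) * indicator D z) \<in> borel_measurable lborel" "D \<in> sets lborel"
      using meas cont open_D by auto
    have "integral\<^sup>N lborel (indicator D) = emeasure lborel D"
      using open_D by (intro nn_integral_indicator) auto
    then show ?thesis by (simp add: nn_integral_add nn_integral_cmult)
  qed
  also have "\<dots> < \<infinity>" using fin area by (auto simp: ennreal_mult_less_top ennreal_add_less_top)
  finally show ?thesis .
qed

text \<open>The boundary values are taken on neighbourhoods, seen in the disk, of the two compact
  sets. A curve in the family thus attains the values 0 and 1 at interior parameters, before its
  ends.\<close>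

definition potential :: "complex set \<Rightarrow> complex set \<Rightarrow> (complex \<Rightarrow> real) \<Rightarrow> (complex \<Rightarrow> complex) \<Rightarrow> bool" where
  "potential K\<^sub>0 K\<^sub>1 u g \<longleftrightarrow> has_gradient_on u g D \<and> (\<forall>z\<in>D. 0 \<le> u z \<and> u z \<le> 1) \<and>
     (\<exists>N. open N \<and> K\<^sub>0 \<subseteq> N \<and> (\<forall>z\<in>D. \<phi> z \<in> N \<longrightarrow> u z = 0)) \<and>
     (\<exists>N. open N \<and> K\<^sub>1 \<subseteq> N \<and> (\<forall>z\<in>D. \<phi> z \<in> N \<longrightarrow> u z = 1)) \<and>
     (\<integral>\<^sup>+ z \<in> D. ennreal ((norm (g z))\<^sup>2) \<partial>lborel) < \<infinity>"

text \<open>The product rule leaves the additional term \<open>(v z - u z) *\<^sub>R k z\<close>,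
  which is bounded since both potentials lie between 0 and 1.\<close>

lemma potential_mix:
  assumes u: "potential K\<^sub>0 K\<^sub>1 u g" and v: "potential K\<^sub>0 K\<^sub>1 v h"
    and m: "has_gradient_on m k D" "\<And>z. z \<in> D \<Longrightarrow> 0 \<le> m z \<and> m z \<le> 1" "\<And>z. z \<in> D \<Longrightarrow> norm (k z) \<le> C"
  shows "potential K\<^sub>0 K\<^sub>1 (\<lambda>z. (1 - m z) * u z + m z * v z)
     (\<lambda>z. (1 - m z) *\<^sub>R g z + m z *\<^sub>R h z + (v z - u z) *\<^sub>R k z)"
proof -
  let ?w = "\<lambda>z. (1 - m z) * u z + m z * v z"
  let ?k = "\<lambda>z. (1 - m z) *\<^sub>R g z + m z *\<^sub>R h z + (v z - u z) *\<^sub>R k z"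
  have gu: "has_gradient_on u g D" and gv: "has_gradient_on v h D"
    and ru: "\<And>z. z \<in> D \<Longrightarrow> 0 \<le> u z \<and> u z \<le> 1" and rv: "\<And>z. z \<in> D \<Longrightarrow> 0 \<le> v z \<and> v z \<le> 1"
    using u v by (auto simp: potential_def)
  have 1: "has_gradient_on (\<lambda>z. 1 - m z) (\<lambda>z. - k z) D"
    using has_gradient_on_add[OF has_gradient_on_const[of 1] has_gradient_on_minus[OF m(1)]] by simp
  have grad: "has_gradient_on ?w ?k D"
    using has_gradient_on_add[OF has_gradient_on_mult[OF 1 gu] has_gradient_on_mult[OF m(1) gv]]
    by (simp add: algebra_simps)
  have range: "0 \<le> ?w z \<and> ?w z \<le> 1" if "z \<in> D" for z
  proof
    show "0 \<le> ?w z" using m(2)[OF that] ru[OF that] rv[OF that] by simp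
    have "?w z \<le> (1 - m z) * 1 + m z * 1"
      using m(2)[OF that] ru[OF that] rv[OF that] by (intro add_mono mult_left_mono) auto
    then show "?w z \<le> 1" by simp
  qed
  obtain N0 M0 where N0: "open N0" "K\<^sub>0 \<subseteq> N0" "\<And>z. z \<in> D \<Longrightarrow> \<phi> z \<in> N0 \<Longrightarrow> u z = 0"
    and M0: "open M0" "K\<^sub>0 \<subseteq> M0" "\<And>z. z \<in> D \<Longrightarrow> \<phi> z \<in> M0 \<Longrightarrow> v z = 0"
    using u v unfolding potential_def by metis
  obtain N1 M1 where N1: "open N1" "K\<^sub>1 \<subseteq> N1" "\<And>z. z \<in> D \<Longrightarrow> \<phi> z \<in> N1 \<Longrightarrow> u z = 1"
    and M1: "open M1" "K\<^sub>1 \<subseteq> M1" "\<And>z. z \<in> D \<Longrightarrow> \<phi> z \<in> M1 \<Longrightarrow> v z = 1"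
    using u v unfolding potential_def by metis
  have "(\<integral>\<^sup>+ z \<in> D. ennreal ((norm (?k z))\<^sup>2) \<partial>lborel) < \<infinity>"
  proof (rule square_integrable_mono[of _ g h "max 0 C"])
    fix z assume z: "z \<in> D"
    have "norm (?k z) \<le> norm ((1 - m z) *\<^sub>R g z) + norm (m z *\<^sub>R h z) + norm ((v z - u z) *\<^sub>R k z)"
      by (meson norm_triangle_ineq norm_triangle_le order_trans add_mono order_refl)
    also have "\<dots> \<le> 1 * norm (g z) + 1 * norm (h z) + 1 * max 0 C"
      using m(2,3)[OF z] ru[OF z] rv[OF z] unfolding norm_scaleR
      by (intro add_mono mult_mono) auto
    finally show "norm (?k z) \<le> norm (g z) + norm (h z) + max 0 C" by simp
  qed (use u v in \<open>auto simp: potential_def has_gradient_on_def\<close>)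
  moreover have "\<exists>N. open N \<and> K\<^sub>0 \<subseteq> N \<and> (\<forall>z\<in>D. \<phi> z \<in> N \<longrightarrow> ?w z = 0)"
    using N0 M0 by (intro exI[of _ "N0 \<inter> M0"]) auto
  moreover have "\<exists>N. open N \<and> K\<^sub>1 \<subseteq> N \<and> (\<forall>z\<in>D. \<phi> z \<in> N \<longrightarrow> ?w z = 1)"
    using N1 M1 by (intro exI[of _ "N1 \<inter> M1"]) auto
  ultimately show ?thesis unfolding potential_def using grad range by blast
qed

text \<open>The gradient of the cut-off is bounded, and the energy of the Riemann map is finite
  because its image has finite area.\<close>

lemma potential_cutoff:
  assumes N: "open N" "K\<^sub>0 \<subseteq> N" "\<And>w. w \<in> N \<Longrightarrow> cutoff xs w = 0"
    and M: "open M" "K\<^sub>1 \<subseteq> M" "\<And>w. w \<in> M \<Longrightarrow> cutoff xs w = 1"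
  shows "potential K\<^sub>0 K\<^sub>1 (\<lambda>z. cutoff xs (\<phi> z)) (\<lambda>z. cnj (deriv \<phi> z) * cutoff_grad xs (\<phi> z))"
proof -
  obtain C where C: "\<And>w. norm (cutoff_grad xs w) \<le> C" using cutoff_grad_bounded by blast
  have "(\<integral>\<^sup>+ z \<in> D. ennreal ((norm (cnj (deriv \<phi> z) * cutoff_grad xs (\<phi> z)))\<^sup>2) \<partial>lborel)
      \<le> (\<integral>\<^sup>+ z. ennreal (C\<^sup>2) * energy_density z \<partial>lborel)"
  proof (rule nn_integral_mono)
    fix z
    have "norm (cnj (deriv \<phi> z) * cutoff_grad xs (\<phi> z)) \<le> norm (deriv \<phi> z) * C"
      using C[of "\<phi> z"] by (simp add: norm_mult mult_left_mono)
    then have "(norm (cnj (deriv \<phi> z) * cutoff_grad xs (\<phi> z)))\<^sup>2 \<le> (norm (deriv \<phi> z) * C)\<^sup>2"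
      by (intro power_mono) auto
    then have "ennreal ((norm (cnj (deriv \<phi> z) * cutoff_grad xs (\<phi> z)))\<^sup>2) \<le> ennreal (C\<^sup>2) * ennreal ((norm (deriv \<phi> z))\<^sup>2)"
      by (simp add: power_mult_distrib mult.commute ennreal_leI flip: ennreal_mult)
    then show "ennreal ((norm (cnj (deriv \<phi> z) * cutoff_grad xs (\<phi> z)))\<^sup>2) * indicator D z \<le> ennreal (C\<^sup>2) * energy_density z"
      by (simp add: energy_density_def indicator_def)
  qed
  also have "\<dots> = ennreal (C\<^sup>2) * (\<integral>\<^sup>+ z. energy_density z \<partial>lborel)" by (rule nn_integral_cmult) measurable
  also have "\<dots> < \<infinity>" using energy_finite by (simp add: ennreal_mult_less_top)
  finally have fin: "(\<integral>\<^sup>+ z \<in> D. ennreal ((norm (cnj (deriv \<phi> z) * cutoff_grad xs (\<phi> z)))\<^sup>2) \<partial>lborel) < \<infinity>" .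
  show ?thesis
    unfolding potential_def
  proof (intro conjI fin has_gradient_on_compose_phi[OF cutoff_gradient])
    show "\<forall>z\<in>D. 0 \<le> cutoff xs (\<phi> z) \<and> cutoff xs (\<phi> z) \<le> 1" using cutoff_range by blast
    show "\<exists>N. open N \<and> K\<^sub>0 \<subseteq> N \<and> (\<forall>z\<in>D. \<phi> z \<in> N \<longrightarrow> cutoff xs (\<phi> z) = 0)"
      using N by (intro exI[of _ N]) auto
    show "\<exists>N. open N \<and> K\<^sub>1 \<subseteq> N \<and> (\<forall>z\<in>D. \<phi> z \<in> N \<longrightarrow> cutoff xs (\<phi> z) = 1)"
      using M by (intro exI[of _ M]) auto
  qed
qed

section \<open>Vertical energy and gluing of potentials\<close>

definition vertical_energy :: "(complex \<Rightarrow> complex) \<Rightarrow> real \<Rightarrow> ennreal" where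
  "vertical_energy g x = (\<integral>\<^sup>+ y. indicator D (Complex x y) * ennreal ((Im (g (Complex x y)))\<^sup>2) \<partial>lborel)"

lemma Im_sq_measurable:
  assumes "continuous_on D g"
  shows "(\<lambda>z. indicator D z * ennreal ((Im (g z))\<^sup>2)) \<in> borel_measurable borel"
proof -
  have "(\<lambda>z. indicator D z *\<^sub>R (Im (g z))\<^sup>2) \<in> borel_measurable borel"
    using open_D assms by (intro borel_measurable_continuous_on_indicator continuous_intros) auto
  then have "(\<lambda>z. ennreal (indicator D z *\<^sub>R (Im (g z))\<^sup>2)) \<in> borel_measurable borel"
    by (rule measurable_compose[OF _ measurable_ennreal])
  also have "(\<lambda>z. ennreal (indicator D z *\<^sub>R (Im (g z))\<^sup>2)) = (\<lambda>z. indicator D z * ennreal ((Im (g z))\<^sup>2))"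
    by (auto simp: fun_eq_iff indicator_def)
  finally show ?thesis .
qed

lemma vertical_energy_measurable:
  assumes "continuous_on D g"
  shows "vertical_energy g \<in> borel_measurable borel"
  unfolding vertical_energy_def[abs_def] by (rule borel_measurable_fibre_integral[OF Im_sq_measurable[OF assms]])

lemma nn_integral_vertical_energy:
  assumes "continuous_on D g"
  shows "(\<integral>\<^sup>+ x. vertical_energy g x \<partial>lborel) = (\<integral>\<^sup>+ z \<in> D. ennreal ((Im (g z))\<^sup>2) \<partial>lborel)"
proof -
  have "(\<integral>\<^sup>+ x. vertical_energy g x \<partial>lborel) = (\<integral>\<^sup>+ z. indicator D z * ennreal ((Im (g z))\<^sup>2) \<partial>lborel)"
    unfolding vertical_energy_def by (rule nn_integral_complex_iterated[symmetric, OF Im_sq_measurable[OF assms]])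
  then show ?thesis by (simp add: mult.commute)
qed

lemma potential_energy_finite:
  assumes "potential K\<^sub>0 K\<^sub>1 u g"
  shows "continuous_on D g" "(\<integral>\<^sup>+ x. vertical_energy g x \<partial>lborel) < \<infinity>" "(\<integral>\<^sup>+ z \<in> D. ennreal ((Re (g z))\<^sup>2) \<partial>lborel) < \<infinity>"
proof -
  show c: "continuous_on D g" using assms by (simp add: potential_def has_gradient_on_def)
  have fin: "(\<integral>\<^sup>+ z \<in> D. ennreal ((norm (g z))\<^sup>2) \<partial>lborel) < \<infinity>" using assms by (simp add: potential_def)
  have "(Re w)\<^sup>2 \<le> (norm w)\<^sup>2" "(Im w)\<^sup>2 \<le> (norm w)\<^sup>2" for w by (simp_all add: cmod_power2)
  then have "(\<integral>\<^sup>+ z \<in> D. ennreal ((Re (g z))\<^sup>2) \<partial>lborel) \<le> (\<integral>\<^sup>+ z \<in> D. ennreal ((norm (g z))\<^sup>2) \<partial>lborel)"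
    "(\<integral>\<^sup>+ z \<in> D. ennreal ((Im (g z))\<^sup>2) \<partial>lborel) \<le> (\<integral>\<^sup>+ z \<in> D. ennreal ((norm (g z))\<^sup>2) \<partial>lborel)"
    by (intro nn_integral_mono mult_right_mono ennreal_leI; simp)+
  then show "(\<integral>\<^sup>+ x. vertical_energy g x \<partial>lborel) < \<infinity>" "(\<integral>\<^sup>+ z \<in> D. ennreal ((Re (g z))\<^sup>2) \<partial>lborel) < \<infinity>"
    using fin nn_integral_vertical_energy[OF c] by (auto intro: le_less_trans)
qed

text \<open>Weights that depend on \<open>x\<close> only contribute nothing to the vertical derivative of the glued
  function, so the vertical energy can be minimised fibre by fibre.\<close>
lemma potential_min:
  assumes u: "potential K\<^sub>0 K\<^sub>1 u g" and v: "potential K\<^sub>0 K\<^sub>1 v h" and d: "0 < d"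
  shows "\<exists>w k r. potential K\<^sub>0 K\<^sub>1 w k \<and> r \<in> borel_measurable borel \<and> (\<integral>\<^sup>+ x. r x \<partial>lborel) \<le> ennreal d \<and>
     (\<forall>x. vertical_energy k x \<le> min (vertical_energy g x) (vertical_energy h x) + r x)"
proof -
  let ?E = "vertical_energy"
  note cg = potential_energy_finite(1)[OF u] and ch = potential_energy_finite(1)[OF v]
  have [measurable]: "?E g \<in> borel_measurable borel" "?E h \<in> borel_measurable borel"
    using vertical_energy_measurable cg ch by auto
  \<comment> \<open>This finite measure weighs a set of \<open>x\<close> by the energy at stake
    there; \<open>S\<close> collects the fibres on which \<open>v\<close> is better.\<close>
  define \<mu> where "\<mu> = density lborel (\<lambda>x. ?E g x + ?E h x)"
  define S where "S = {x. ?E h x < ?E g x}"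
  have sets_\<mu>: "sets \<mu> = sets borel" by (simp add: \<mu>_def)
  have em: "emeasure \<mu> A = (\<integral>\<^sup>+ x \<in> A. (?E g x + ?E h x) \<partial>lborel)" if "A \<in> sets borel" for A
    unfolding \<mu>_def using that by (subst emeasure_density) auto
  have fin: "emeasure \<mu> (space \<mu>) \<noteq> \<infinity>"
  proof -
    have "emeasure \<mu> (space \<mu>) = (\<integral>\<^sup>+ x. (?E g x + ?E h x) \<partial>lborel)"
      by (simp add: em \<mu>_def[THEN arg_cong[where f=space]])
    also have "\<dots> = (\<integral>\<^sup>+ x. ?E g x \<partial>lborel) + (\<integral>\<^sup>+ x. ?E h x \<partial>lborel)"
      by (rule nn_integral_add) auto
    also have "\<dots> < \<infinity>" using potential_energy_finite(2)[OF u] potential_energy_finite(2)[OF v] by simp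
    finally show ?thesis by simp
  qed
  have S_borel: "S \<in> sets borel" unfolding S_def by measurable
  interpret finite_measure \<mu> by (rule finite_measureI) (use fin in simp)
  \<comment> \<open>Regularity of the measure encloses \<open>S\<close> between a compact set and an
    open set, differing by at most \<open>d\<close> in measure. A smooth weight switches from
    \<open>u\<close> to \<open>v\<close> in the gap.\<close>
  obtain C where C: "C \<subseteq> S" "compact C" "emeasure \<mu> S < emeasure \<mu> C + ennreal (d / 2)"
  proof -
    have inn: "emeasure \<mu> S = (SUP K \<in> {K. K \<subseteq> S \<and> compact K}. emeasure \<mu> K)"
      by (rule inner_regular[OF sets_\<mu> fin S_borel])
    have "\<exists>K. K \<subseteq> S \<and> compact K \<and> emeasure \<mu> S < emeasure \<mu> K + ennreal (d / 2)"
    proof (rule ccontr)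
      assume no: "\<not> ?thesis"
      have "emeasure \<mu> K + ennreal (d / 2) \<le> emeasure \<mu> S" if "K \<subseteq> S" "compact K" for K
        using no that by (meson not_less)
      then have "(SUP K \<in> {K. K \<subseteq> S \<and> compact K}. emeasure \<mu> K + ennreal (d / 2)) \<le> emeasure \<mu> S"
        by (intro SUP_least) auto
      moreover have "(SUP K \<in> {K. K \<subseteq> S \<and> compact K}. emeasure \<mu> K + ennreal (d / 2)) = emeasure \<mu> S + ennreal (d / 2)"
        unfolding inn by (rule ennreal_SUP_add_left) (auto intro: exI[of _ "{}"])
      ultimately have "emeasure \<mu> S + ennreal (d / 2) \<le> emeasure \<mu> S" by simp
      then show False using d by (simp add: emeasure_eq_measure flip: ennreal_plus)
    qed
    then show thesis using that by blast
  qed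
  obtain U where U: "S \<subseteq> U" "open U" "emeasure \<mu> U < emeasure \<mu> S + ennreal (d / 2)"
  proof -
    have out: "emeasure \<mu> S = (INF U \<in> {U. S \<subseteq> U \<and> open U}. emeasure \<mu> U)"
      by (rule outer_regular[OF sets_\<mu> fin S_borel])
    have "emeasure \<mu> S < emeasure \<mu> S + ennreal (d / 2)"
      using d by (simp add: emeasure_eq_measure ennreal_less_iff flip: ennreal_plus)
    then have "(INF U \<in> {U. S \<subseteq> U \<and> open U}. emeasure \<mu> U) < emeasure \<mu> S + ennreal (d / 2)" using out by simp
    then show thesis using that unfolding INF_less_iff by blast
  qed
  have C_borel: "C \<in> sets borel" and U_borel: "U \<in> sets borel" using C U by (auto intro: borel_compact)
  have UC: "emeasure \<mu> (U - C) \<le> ennreal d"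
  proof -
    have "measure \<mu> (U - C) = measure \<mu> U - measure \<mu> C"
      using C U C_borel U_borel sets_\<mu> by (intro finite_measure_Diff) auto
    moreover have "measure \<mu> U < measure \<mu> S + d / 2" "measure \<mu> S < measure \<mu> C + d / 2"
      using C(3) U(3) d by (auto simp: emeasure_eq_measure ennreal_less_iff simp flip: ennreal_plus)
    ultimately show ?thesis by (simp add: emeasure_eq_measure ennreal_leI)
  qed
  \<comment> \<open>The cut-offs live on the complex plane, so the set of abscissas is placed on the
    real axis; evaluation at \<open>Re z\<close> makes the weight independent of height.\<close>
  have "compact (complex_of_real ` C)"
    using C(2) by (intro compact_continuous_image continuous_intros)
  moreover have "open (Re -` U)"
    using U(2) by (intro open_vimage continuous_intros)
  moreover have "complex_of_real ` C \<subseteq> Re -` U" using C U by auto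
  ultimately obtain xs N where N: "open N" "complex_of_real ` C \<subseteq> N" "\<And>w. w \<in> N \<Longrightarrow> cutoff xs w = 0"
     "\<And>w. w \<notin> Re -` U \<Longrightarrow> cutoff xs w = 1"
    using cutoff_separates by metis
  define m where "m z = 1 - cutoff xs (complex_of_real (Re z))" for z
  define k0 where "k0 z = complex_of_real (- Re (cutoff_grad xs (complex_of_real (Re z))))" for z
  have grad_m: "has_gradient_on m k0 D"
    unfolding has_gradient_on_def
  proof (intro conjI ballI)
    fix z
    have "((\<lambda>z. complex_of_real (Re z)) has_derivative (\<lambda>h. complex_of_real (Re h))) (at z)"
      by (auto intro!: derivative_eq_intros)
    then have "((\<lambda>z. cutoff xs (complex_of_real (Re z))) has_derivative
        (\<lambda>h. cutoff_grad xs (complex_of_real (Re z)) \<bullet> complex_of_real (Re h))) (at z)"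
      by (rule has_derivative_compose) (use cutoff_gradient[of xs] in \<open>simp add: has_gradient_on_def\<close>)
    then have "(m has_derivative (\<lambda>h. - (cutoff_grad xs (complex_of_real (Re z)) \<bullet> complex_of_real (Re h)))) (at z)"
      unfolding m_def[abs_def] by (auto intro!: derivative_eq_intros)
    then show "(m has_derivative (\<lambda>h. k0 z \<bullet> h)) (at z)"
      by (simp add: k0_def inner_complex_def)
  next
    have "continuous_on UNIV (cutoff_grad xs)" using cutoff_gradient[of xs] by (simp add: has_gradient_on_def)
    then have "continuous_on D (\<lambda>z. cutoff_grad xs (complex_of_real (Re z)))"
      by (rule continuous_on_compose2) (auto intro!: continuous_intros)
    then show "continuous_on D k0"
      unfolding k0_def by (intro continuous_intros)
  qed
  have m_range: "0 \<le> m z \<and> m z \<le> 1" for z using cutoff_range[of xs] by (simp add: m_def)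
  obtain B' where B': "\<And>w. norm (cutoff_grad xs w) \<le> B'" using cutoff_grad_bounded by blast
  have k0_bound: "norm (k0 z) \<le> B'" for z
    unfolding k0_def norm_of_real abs_minus_cancel using abs_Re_le_cmod B' order_trans by blast
  define w where "w z = (1 - m z) * u z + m z * v z" for z
  define k where "k z = (1 - m z) *\<^sub>R g z + m z *\<^sub>R h z + (v z - u z) *\<^sub>R k0 z" for z
  have pot: "potential K\<^sub>0 K\<^sub>1 w k"
    unfolding w_def[abs_def] k_def[abs_def] by (rule potential_mix[OF u v grad_m m_range k0_bound])
  \<comment> \<open>In the gap, where the choice may be wrong, both energies are charged as an
    error.\<close>
  define r where "r x = (?E g x + ?E h x) * indicator (U - C) x" for x
  have r_meas: "r \<in> borel_measurable borel" unfolding r_def using C_borel U_borel by measurable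
  have r_int: "(\<integral>\<^sup>+ x. r x \<partial>lborel) \<le> ennreal d"
    using UC em[of "U - C"] C_borel U_borel by (simp add: r_def)
  have m_fibre: "m (Complex x y) = m (complex_of_real x)" for x y by (simp add: m_def)
  have Im_k: "Im (k (Complex x y)) = (1 - m (complex_of_real x)) * Im (g (Complex x y)) + m (complex_of_real x) * Im (h (Complex x y))" for x y
    by (simp add: k_def k0_def m_fibre)
  have Eg: "?E k x = ?E g x" if "m (complex_of_real x) = 0" for x
    unfolding vertical_energy_def Im_k that by simp
  have Eh: "?E k x = ?E h x" if "m (complex_of_real x) = 1" for x
    unfolding vertical_energy_def Im_k that by simp
  have Esum: "?E k x \<le> ?E g x + ?E h x" for x
  proof -
    have [measurable]: "(\<lambda>y. indicator D (Complex x y) * ennreal ((Im (g (Complex x y)))\<^sup>2)) \<in> borel_measurable borel"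
      "(\<lambda>y. indicator D (Complex x y) * ennreal ((Im (h (Complex x y)))\<^sup>2)) \<in> borel_measurable borel"
      using measurable_compose[OF _ Im_sq_measurable[OF cg], of "\<lambda>y. Complex x y" borel]
         measurable_compose[OF _ Im_sq_measurable[OF ch], of "\<lambda>y. Complex x y" borel] by measurable
    \<comment> \<open>Convexity of the square; no derivative of the weight enters the vertical
      component.\<close>
    have conv: "((1 - t) * a + t * b)\<^sup>2 \<le> a\<^sup>2 + b\<^sup>2" if "0 \<le> t" "t \<le> 1" for t a b :: real
    proof -
      have "a\<^sup>2 + b\<^sup>2 - ((1 - t) * a + t * b)\<^sup>2 = t * (1 - t) * (a - b)\<^sup>2 + t * a\<^sup>2 + (1 - t) * b\<^sup>2"
        by (simp add: power2_eq_square algebra_simps)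
      moreover have "0 \<le> t * (1 - t) * (a - b)\<^sup>2 + t * a\<^sup>2 + (1 - t) * b\<^sup>2" using that by simp
      ultimately show ?thesis by linarith
    qed
    have "?E k x \<le> (\<integral>\<^sup>+ y. indicator D (Complex x y) * ennreal ((Im (g (Complex x y)))\<^sup>2)
        + indicator D (Complex x y) * ennreal ((Im (h (Complex x y)))\<^sup>2) \<partial>lborel)"
      unfolding vertical_energy_def
    proof (rule nn_integral_mono)
      fix y
      have "(Im (k (Complex x y)))\<^sup>2 \<le> (Im (g (Complex x y)))\<^sup>2 + (Im (h (Complex x y)))\<^sup>2"
        unfolding Im_k using m_range by (intro conv) auto
      then show "indicator D (Complex x y) * ennreal ((Im (k (Complex x y)))\<^sup>2)
        \<le> indicator D (Complex x y) * ennreal ((Im (g (Complex x y)))\<^sup>2) + indicator D (Complex x y) * ennreal ((Im (h (Complex x y)))\<^sup>2)"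
        by (simp add: indicator_def ennreal_leI flip: ennreal_plus)
    qed
    also have "\<dots> = ?E g x + ?E h x"
      unfolding vertical_energy_def by (rule nn_integral_add) auto
    finally show ?thesis .
  qed
  have "?E k x \<le> min (?E g x) (?E h x) + r x" for x
  proof (cases "x \<in> C")
    case True
    then have "complex_of_real x \<in> N" using N(2) by blast
    then have "m (complex_of_real x) = 1" using N(3) by (simp add: m_def)
    moreover have "?E h x < ?E g x" using True C(1) by (auto simp: S_def)
    ultimately show ?thesis using Eh[of x] by (simp add: min_def add_increasing2)
  next
    case nC: False
    show ?thesis
    proof (cases "x \<in> U")
      case True
      then have "r x = ?E g x + ?E h x" using nC by (simp add: r_def)
      then show ?thesis using Esum[of x] by (simp add: add_increasing)
    next
      case False
      then have "m (complex_of_real x) = 0" using N(4)[of "complex_of_real x"] by (simp add: m_def)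
      moreover have "x \<notin> S" using False U(1) by blast
      then have "?E g x \<le> ?E h x" by (simp add: S_def not_less)
      ultimately show ?thesis using Eg[of x] by (simp add: min_def add_increasing2)
    qed
  qed
  then show ?thesis using pot r_meas r_int by blast
qed

text \<open>Competitors are glued in one at a time. Half of the error is allotted to the earlier
  ones and half to the last.\<close>

lemma potential_min_sequence:
  fixes n :: nat
  assumes pot: "\<And>n. potential K\<^sub>0 K\<^sub>1 (u n) (g n)" and "0 < d"
  shows "\<exists>w k r. potential K\<^sub>0 K\<^sub>1 w k \<and> r \<in> borel_measurable borel \<and> (\<integral>\<^sup>+ x. r x \<partial>lborel) \<le> ennreal d \<and>
     (\<forall>x. vertical_energy k x \<le> (INF i\<in>{..n}. vertical_energy (g i) x) + r x)"
  using \<open>0 < d\<close>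
proof (induction n arbitrary: d)
  case 0
  then show ?case using pot[of 0]
    by (intro exI[of _ "u 0"] exI[of _ "g 0"] exI[of _ "\<lambda>_. 0"]) auto
next
  case (Suc n)
  obtain w k r where w: "potential K\<^sub>0 K\<^sub>1 w k" "r \<in> borel_measurable borel" "(\<integral>\<^sup>+ x. r x \<partial>lborel) \<le> ennreal (d / 2)"
     "\<And>x. vertical_energy k x \<le> (INF i\<in>{..n}. vertical_energy (g i) x) + r x"
    using Suc.IH[of "d / 2"] Suc.prems by auto
  obtain w' k' r' where w': "potential K\<^sub>0 K\<^sub>1 w' k'" "r' \<in> borel_measurable borel" "(\<integral>\<^sup>+ x. r' x \<partial>lborel) \<le> ennreal (d / 2)"
     "\<And>x. vertical_energy k' x \<le> min (vertical_energy k x) (vertical_energy (g (Suc n)) x) + r' x"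
    using potential_min[OF w(1) pot[of "Suc n"], of "d / 2"] Suc.prems by auto
  have le: "vertical_energy k' x \<le> (INF i\<in>{..Suc n}. vertical_energy (g i) x) + (r x + r' x)" for x
  proof -
    have "min (vertical_energy k x) (vertical_energy (g (Suc n)) x)
        \<le> min ((INF i\<in>{..n}. vertical_energy (g i) x) + r x) (vertical_energy (g (Suc n)) x + r x)"
      using w(4)[of x] by (intro min.mono) (auto simp: add_increasing2)
    also have "\<dots> = min (INF i\<in>{..n}. vertical_energy (g i) x) (vertical_energy (g (Suc n)) x) + r x"
      by (simp add: min_def)
    also have "min (INF i\<in>{..n}. vertical_energy (g i) x) (vertical_energy (g (Suc n)) x) = (INF i\<in>{..Suc n}. vertical_energy (g i) x)"
      by (simp add: atMost_Suc inf_min min.commute)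
    finally have "vertical_energy k' x \<le> (INF i\<in>{..Suc n}. vertical_energy (g i) x) + r x + r' x"
      using w'(4)[of x] by (meson add_right_mono order_trans)
    then show ?thesis by (simp add: add.assoc)
  qed
  have "(\<integral>\<^sup>+ x. r x + r' x \<partial>lborel) = (\<integral>\<^sup>+ x. r x \<partial>lborel) + (\<integral>\<^sup>+ x. r' x \<partial>lborel)"
    using w(2) w'(2) by (intro nn_integral_add) auto
  also have "\<dots> \<le> ennreal (d / 2) + ennreal (d / 2)" using w(3) w'(3) by (rule add_mono)
  also have "\<dots> = ennreal d" using Suc.prems by (simp flip: ennreal_plus)
  finally have int: "(\<integral>\<^sup>+ x. r x + r' x \<partial>lborel) \<le> ennreal d" .
  have meas: "(\<lambda>x. r x + r' x) \<in> borel_measurable borel" using w(2) w'(2) by measurable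
  show ?case
    using w'(1) meas int le by (intro exI[of _ w'] exI[of _ k'] exI[of _ "\<lambda>x. r x + r' x"]) auto
qed

text \<open>The finite minima decrease to the infimum, and the first has finite integral, so
  monotone convergence shows that the integral over a long finite minimum is already close.\<close>

lemma potential_near_infimum:
  assumes pot: "\<And>n :: nat. potential K\<^sub>0 K\<^sub>1 (u n) (g n)" and d: "0 < d"
  obtains w k where "potential K\<^sub>0 K\<^sub>1 w k"
    "(\<integral>\<^sup>+ x. vertical_energy k x \<partial>lborel) \<le> (\<integral>\<^sup>+ x. (INF n. vertical_energy (g n) x) \<partial>lborel) + ennreal d"
proof -
  define M where "M n x = (INF i\<in>{..n}. vertical_energy (g i) x)" for n x
  have E_meas [measurable]: "vertical_energy (g n) \<in> borel_measurable borel" for n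
    using vertical_energy_measurable potential_energy_finite(1)[OF pot] .
  have M_meas [measurable]: "M n \<in> borel_measurable borel" for n
    unfolding M_def[abs_def] by measurable
  have "decseq M" unfolding M_def by (intro antimonoI le_funI INF_superset_mono) auto
  have M_INF: "(INF n. M n x) = (INF n. vertical_energy (g n) x)" for x
  proof (rule antisym)
    show "(INF n. M n x) \<le> (INF n. vertical_energy (g n) x)"
      by (intro INF_mono) (auto simp: M_def intro!: INF_lower)
    show "(INF n. vertical_energy (g n) x) \<le> (INF n. M n x)"
      unfolding M_def by (intro INF_greatest INF_lower) auto
  qed
  have fin0: "(\<integral>\<^sup>+ x. M 0 x \<partial>lborel) < \<infinity>"
    using potential_energy_finite(2)[OF pot[of 0]] by (simp add: M_def)
  have eq: "(\<integral>\<^sup>+ x. (INF n. M n x) \<partial>lborel) = (INF n. (\<integral>\<^sup>+ x. M n x \<partial>lborel))"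
    by (rule nn_integral_monotone_convergence_INF_decseq[of _ _ 0]) (use \<open>decseq M\<close> fin0 in auto)
  have "(INF n. (\<integral>\<^sup>+ x. M n x \<partial>lborel)) < (INF n. (\<integral>\<^sup>+ x. M n x \<partial>lborel)) + ennreal (d / 2)"
  proof -
    have "(INF n. (\<integral>\<^sup>+ x. M n x \<partial>lborel)) < \<infinity>" using fin0 INF_lower[of 0 UNIV "\<lambda>n. \<integral>\<^sup>+ x. M n x \<partial>lborel"] by (auto intro: le_less_trans)
    then show ?thesis using d
      by (cases "(INF n. (\<integral>\<^sup>+ x. M n x \<partial>lborel))") (auto simp: ennreal_less_iff simp flip: ennreal_plus)
  qed
  then obtain n where n: "(\<integral>\<^sup>+ x. M n x \<partial>lborel) < (INF n. (\<integral>\<^sup>+ x. M n x \<partial>lborel)) + ennreal (d / 2)"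
    unfolding INF_less_iff by blast
  obtain w k r where w: "potential K\<^sub>0 K\<^sub>1 w k" "r \<in> borel_measurable borel" "(\<integral>\<^sup>+ x. r x \<partial>lborel) \<le> ennreal (d / 2)"
     "\<And>x. vertical_energy k x \<le> M n x + r x"
    using potential_min_sequence[of K\<^sub>0 K\<^sub>1 u g "d / 2" n, OF pot] d unfolding M_def by auto
  have "(\<integral>\<^sup>+ x. vertical_energy k x \<partial>lborel) \<le> (\<integral>\<^sup>+ x. M n x + r x \<partial>lborel)"
    by (intro nn_integral_mono w(4))
  also have "\<dots> = (\<integral>\<^sup>+ x. M n x \<partial>lborel) + (\<integral>\<^sup>+ x. r x \<partial>lborel)"
    using w(2) by (intro nn_integral_add) auto
  also have "\<dots> \<le> ((INF n. (\<integral>\<^sup>+ x. M n x \<partial>lborel)) + ennreal (d / 2)) + ennreal (d / 2)"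
    using n w(3) by (intro add_mono) auto
  also have "\<dots> = (\<integral>\<^sup>+ x. (INF n. vertical_energy (g n) x) \<partial>lborel) + ennreal d"
    using d eq unfolding M_INF by (simp add: add.assoc flip: ennreal_plus)
  finally show thesis using that w(1) by blast
qed

end

section \<open>Competitors adapted to a single fibre\<close>

lemma cutoff_separates_compact:
  assumes "compact K" "compact K'" "K \<inter> K' = {}"
  obtains xs N M where "open N" "K \<subseteq> N" "\<And>w. w \<in> N \<Longrightarrow> cutoff xs w = 0"
    "open M" "K' \<subseteq> M" "\<And>w. w \<in> M \<Longrightarrow> cutoff xs w = 1"
proof -
  obtain U V where UV: "open U" "open V" "K \<subseteq> U" "K' \<subseteq> V" "U \<inter> V = {}"
    using separation_normal_compact[OF assms(1) compact_imp_closed[OF assms(2)] assms(3)] by metis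
  obtain xs N where N: "open N" "K \<subseteq> N" "\<And>w. w \<in> N \<Longrightarrow> cutoff xs w = 0" "\<And>w. w \<notin> U \<Longrightarrow> cutoff xs w = 1"
    using cutoff_separates[OF assms(1) UV(1,3)] by metis
  show thesis
    by (rule that[OF N(1,2,3) UV(2,4)]) (use UV(5) N(4) in blast)+
qed

lemma cutoff_grad_eq_0:
  assumes "open N" "\<And>w. w \<in> N \<Longrightarrow> cutoff xs w = c" "w \<in> N"
  shows "cutoff_grad xs w = 0"
  by (rule gradient_zero_if_locally_constant[OF cutoff_gradient _ assms(1,3,2)]) auto

text \<open>The energy of the linear ramp over a whole fibre of height \<open>m\<close> is
  \<open>1 / m\<close>. A rational ramp that stays away from both ends and has small smoothing width
  comes within the factor shown.\<close>

lemma exists_ramp_parameters: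
  fixes m :: real
  assumes m: "0 < m" and \<eta>: "0 < \<eta>" "\<eta> < 1"
  obtains p q k :: rat where "0 < p" "p < q" "0 < k" "of_rat q + of_rat k < m"
    "(of_rat q + of_rat k - of_rat p) / (of_rat q - of_rat p)\<^sup>2 \<le> 1 / (m * (1 - \<eta>)\<^sup>2)"
proof -
  have em: "0 < \<eta> * m" "\<eta> * m < m" using assms by auto
  \<comment> \<open>Quarters of \<open>\<eta> * m\<close> bound \<open>p\<close>, \<open>k\<close>
    and the room above \<open>q\<close>, so that \<open>q + k\<close> stays below \<open>m\<close>
    while \<open>q - p\<close> is at least \<open>m * (1 - \<eta>)\<close>.\<close>
  obtain p :: rat where p: "0 < (of_rat p :: real)" "of_rat p < \<eta> * m / 4"
    using of_rat_dense[of 0 "\<eta> * m / 4"] em by auto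
  obtain q :: rat where q: "m - \<eta> * m / 2 < of_rat q" "of_rat q < m - \<eta> * m / 4"
    using of_rat_dense[of "m - \<eta> * m / 2" "m - \<eta> * m / 4"] em by auto
  obtain k :: rat where k: "0 < (of_rat k :: real)" "of_rat k < \<eta> * m / 4"
    using of_rat_dense[of 0 "\<eta> * m / 4"] em by auto
  have qp: "m * (1 - \<eta>) \<le> of_rat q - of_rat p" using p q by (simp add: algebra_simps)
  have pos: "0 < m * (1 - \<eta>)" using assms by simp
  have sum: "of_rat q + of_rat k - of_rat p \<le> m" using p q k by linarith
  have "(of_rat q + of_rat k - of_rat p) / (of_rat q - of_rat p)\<^sup>2 \<le> m / (m * (1 - \<eta>))\<^sup>2"
    using sum qp pos m by (intro frac_le power_mono) auto
  also have "\<dots> = 1 / (m * (1 - \<eta>)\<^sup>2)" using m by (simp add: power2_eq_square)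
  finally have le: "(of_rat q + of_rat k - of_rat p) / (of_rat q - of_rat p)\<^sup>2 \<le> 1 / (m * (1 - \<eta>)\<^sup>2)" .
  have "(of_rat p :: real) < of_rat q" using qp pos by linarith
  then show thesis using that[of p q k] p q k le by (simp add: of_rat_less)
qed

context under_graph_map
begin

text \<open>The limits at both ends close the image of the fibre to a path in the closed disk, and
  pieces of it become compact sets that cut-offs can separate.\<close>

lemma fibre_path:
  assumes x: "x \<in> base" and b: "fibre_limit x 0 b" and t: "fibre_limit x (f x) t"
  obtains h where "continuous_on {0..f x} h" "h 0 = b" "h (f x) = t" "\<And>y. y \<in> {0<..<f x} \<Longrightarrow> h y = \<phi> (Complex x y)"
proof -
  have fx: "0 < f x" using pos x .
  define h where "h y = (if y \<le> 0 then b else if f x \<le> y then t else \<phi> (Complex x y))" for y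
  have h: "h 0 = b" "h (f x) = t" "\<And>y. y \<in> {0<..<f x} \<Longrightarrow> h y = \<phi> (Complex x y)"
    using fx by (auto simp: h_def)
  have r: "at_right 0 = at 0 within {0<..<f x}"
    by (rule at_within_nhd[of _ "{..<f x}"]) (use fx in auto)
  have l: "at_left (f x) = at (f x) within {0<..<f x}"
    by (rule at_within_nhd[of _ "{0<..}"]) (use fx in auto)
  have ev: "\<forall>\<^sub>F y in at e within {0<..<f x}. \<phi> (Complex x y) = h y" for e
    unfolding eventually_at_filter using h(3) by (auto intro!: always_eventually)
  have "continuous_on {0..f x} h"
  proof (rule continuous_on_IccI[OF _ _ _ fx])
    show "(h \<longlongrightarrow> h 0) (at_right 0)"
      unfolding r h(1) by (rule Lim_transform_eventually[OF b[unfolded fibre_limit_def] ev])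
    show "(h \<longlongrightarrow> h (f x)) (at_left (f x))"
      unfolding l h(2) by (rule Lim_transform_eventually[OF t[unfolded fibre_limit_def] ev])
    fix y assume y: "0 < y" "y < f x"
    have "continuous_on {0<..<f x} h"
      by (rule continuous_on_eq[OF continuous_on_fibre[OF phi_cont x]]) (use h(3) in simp)
    then have "continuous (at y) h" using y by (simp add: continuous_on_eq_continuous_at)
    then show "h \<midarrow>y\<rightarrow> h y" by (simp add: isCont_def)
  qed
  then show thesis using that h by blast
qed

definition cutoff_phi_grad :: "cutoff_code \<Rightarrow> complex \<Rightarrow> complex" where
  "cutoff_phi_grad xs z = cnj (deriv \<phi> z) * cutoff_grad xs (\<phi> z)"

text \<open>Two cut-offs blended by a ramp in the height. On a fibre joining the two arcs, the first
  is to be constant along the lower part, the second along the upper part, so that the ramp makes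
  the whole transition. Equal codes give a plain cut-off. Codes are built from rationals, hence form
  a countable type.\<close>

definition mix_pot :: "cutoff_code \<times> cutoff_code \<times> rat \<times> rat \<times> rat \<Rightarrow> complex \<Rightarrow> real" where
  "mix_pot = (\<lambda>(xs, ys, p, q, k) z.
     (1 - ramp (of_rat p) (of_rat q) (of_rat k) (Im z)) * cutoff xs (\<phi> z) +
     ramp (of_rat p) (of_rat q) (of_rat k) (Im z) * cutoff ys (\<phi> z))"

definition mix_grad :: "cutoff_code \<times> cutoff_code \<times> rat \<times> rat \<times> rat \<Rightarrow> complex \<Rightarrow> complex" where
  "mix_grad = (\<lambda>(xs, ys, p, q, k) z.
     (1 - ramp (of_rat p) (of_rat q) (of_rat k) (Im z)) *\<^sub>R cutoff_phi_grad xs z +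
     ramp (of_rat p) (of_rat q) (of_rat k) (Im z) *\<^sub>R cutoff_phi_grad ys z +
     (cutoff ys (\<phi> z) - cutoff xs (\<phi> z)) *\<^sub>R (ramp' (of_rat p) (of_rat q) (of_rat k) (Im z) *\<^sub>R \<i>))"

lemma potential_mix_code:
  assumes "potential K\<^sub>0 K\<^sub>1 (\<lambda>z. cutoff xs (\<phi> z)) (cutoff_phi_grad xs)"
    "potential K\<^sub>0 K\<^sub>1 (\<lambda>z. cutoff ys (\<phi> z)) (cutoff_phi_grad ys)" and pq: "p < q" "0 < k"
  shows "potential K\<^sub>0 K\<^sub>1 (mix_pot (xs, ys, p, q, k)) (mix_grad (xs, ys, p, q, k))"
proof -
  let ?r = "\<lambda>z. ramp (of_rat p) (of_rat q) (of_rat k) (Im z)"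
  let ?r' = "\<lambda>z. ramp' (of_rat p) (of_rat q) (of_rat k) (Im z) *\<^sub>R \<i>"
  have ab: "(of_rat p :: real) < of_rat q" "(0 :: real) < of_rat k" using pq by (simp_all add: of_rat_less)
  have grad: "has_gradient_on ?r ?r' D"
    unfolding has_gradient_on_def
  proof (intro conjI ballI)
    fix z
    have "(Im has_derivative Im) (at z)" by (rule bounded_linear_imp_has_derivative[OF bounded_linear_Im])
    moreover have "(ramp (of_rat p) (of_rat q) (of_rat k) has_derivative (\<lambda>h. ramp' (of_rat p) (of_rat q) (of_rat k) (Im z) * h)) (at (Im z))"
      using ramp_has_derivative[OF ab, of "Im z"] by (simp add: has_field_derivative_def)
    ultimately have "(?r has_derivative (\<lambda>h. ramp' (of_rat p) (of_rat q) (of_rat k) (Im z) * Im h)) (at z)"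
      by (rule has_derivative_compose)
    then show "(?r has_derivative (\<lambda>h. ?r' z \<bullet> h)) (at z)" by (simp add: inner_complex_def)
  next
    show "continuous_on D ?r'"
      by (intro continuous_intros continuous_on_compose2[OF ramp'_continuous[OF ab, of UNIV]]) auto
  qed
  have bound: "norm (?r' z) \<le> 1 / (of_rat q - of_rat p)" for z
    using ramp'_nonneg[OF ab, of "Im z"] ramp'_le[OF ab, of "Im z"] by simp
  have "potential K\<^sub>0 K\<^sub>1 (\<lambda>z. (1 - ?r z) * cutoff xs (\<phi> z) + ?r z * cutoff ys (\<phi> z))
     (\<lambda>z. (1 - ?r z) *\<^sub>R cutoff_phi_grad xs z + ?r z *\<^sub>R cutoff_phi_grad ys z + (cutoff ys (\<phi> z) - cutoff xs (\<phi> z)) *\<^sub>R ?r' z)"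
    using ramp_range[OF ab] bound by (intro potential_mix assms(1,2) grad) auto
  then show ?thesis by (simp add: mix_pot_def mix_grad_def)
qed

lemma mix_grad_diagonal: "mix_grad (xs, xs, p, q, k) = cutoff_phi_grad xs"
  by (auto simp: mix_grad_def fun_eq_iff scaleR_left_diff_distrib)

lemma vertical_energy_cutoff_eq_0:
  assumes N: "open N" "\<And>w. w \<in> N \<Longrightarrow> cutoff xs w = c" "\<And>y. y \<in> {0<..<f x} \<Longrightarrow> \<phi> (Complex x y) \<in> N"
  shows "vertical_energy (cutoff_phi_grad xs) x = 0"
proof -
  have zero: "indicator D (Complex x y) * ennreal ((Im (cutoff_phi_grad xs (Complex x y)))\<^sup>2) = 0" for y
  proof (cases "Complex x y \<in> D")
    case True
    then have "\<phi> (Complex x y) \<in> N" using N(3) by (simp add: mem_D)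
    then show ?thesis using cutoff_grad_eq_0[OF N(1,2)] by (simp add: cutoff_phi_grad_def)
  qed simp
  show ?thesis unfolding vertical_energy_def zero by simp
qed

text \<open>Along the fibre the cut-off in use has zero gradient wherever the ramp gives it weight,
  so only the ramp contributes, between \<open>p\<close> and \<open>q + k\<close>, with slope at
  most \<open>1 / (q - p)\<close>.\<close>

lemma vertical_energy_mix_le:
  assumes x: "x \<in> base" and pq: "0 < p" "p < q" "0 < k" "of_rat q + of_rat k < f x"
    and N: "open N" "\<And>w. w \<in> N \<Longrightarrow> cutoff xs w = c" "\<And>y. 0 < y \<Longrightarrow> y \<le> of_rat q + of_rat k \<Longrightarrow> \<phi> (Complex x y) \<in> N"
    and M: "open M" "\<And>w. w \<in> M \<Longrightarrow> cutoff ys w = d" "\<And>y. of_rat p \<le> y \<Longrightarrow> y < f x \<Longrightarrow> \<phi> (Complex x y) \<in> M"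
    and cd: "\<bar>d - c\<bar> \<le> 1"
  shows "vertical_energy (mix_grad (xs, ys, p, q, k)) x
    \<le> ennreal ((of_rat q + of_rat k - of_rat p) / (of_rat q - of_rat p)\<^sup>2)"
proof -
  define a b l :: real where "a = of_rat p" and "b = of_rat q" and "l = of_rat k"
  have ab: "a < b" "0 < l" "0 < a" using pq by (simp_all add: a_def b_def l_def of_rat_less)
  have "indicator D (Complex x y) * ennreal ((Im (mix_grad (xs, ys, p, q, k) (Complex x y)))\<^sup>2)
      \<le> ennreal (1 / (b - a)\<^sup>2) * indicator {a..b + l} y" for y
  proof (cases "Complex x y \<in> D")
    case True
    then have y: "0 < y" "y < f x" by (auto simp: mem_D)
    have z1: "y \<le> b + l \<Longrightarrow> cutoff_phi_grad xs (Complex x y) = 0"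
      using cutoff_grad_eq_0[OF N(1,2)] N(3)[of y] y by (simp add: cutoff_phi_grad_def b_def l_def)
    have z2: "a \<le> y \<Longrightarrow> cutoff_phi_grad ys (Complex x y) = 0"
      using cutoff_grad_eq_0[OF M(1,2)] M(3)[of y] y by (simp add: cutoff_phi_grad_def a_def)
    have eq: "mix_grad (xs, ys, p, q, k) (Complex x y) = (1 - ramp a b l y) *\<^sub>R cutoff_phi_grad xs (Complex x y) +
       ramp a b l y *\<^sub>R cutoff_phi_grad ys (Complex x y) +
       (cutoff ys (\<phi> (Complex x y)) - cutoff xs (\<phi> (Complex x y))) *\<^sub>R (ramp' a b l y *\<^sub>R \<i>)"
      by (simp add: mix_grad_def a_def b_def l_def)
    consider "y \<le> a" "y \<le> b + l" | "a < y" "y < b + l" | "b + l \<le> y" "a \<le> y" using ab by linarith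
    then show ?thesis
    proof cases
      case 1
      then have "mix_grad (xs, ys, p, q, k) (Complex x y) = 0"
        using z1 ramp_eq_0[OF ab(1,2)] ramp'_eq_0[OF ab(1,2)] unfolding eq by simp
      then show ?thesis by simp
    next
      case 3
      then have "mix_grad (xs, ys, p, q, k) (Complex x y) = 0"
        using z2 ramp_eq_1[OF ab(1,2)] ramp'_eq_0[OF ab(1,2)] unfolding eq by simp
      then show ?thesis by simp
    next
      case 2
      have "cutoff ys (\<phi> (Complex x y)) - cutoff xs (\<phi> (Complex x y)) = d - c"
        using 2 y N(2)[OF N(3)[of y]] M(2)[OF M(3)[of y]] by (simp add: a_def b_def l_def)
      then have Im_eq: "Im (mix_grad (xs, ys, p, q, k) (Complex x y)) = (d - c) * ramp' a b l y"
        using 2 z1 z2 unfolding eq by simp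
      have "\<bar>Im (mix_grad (xs, ys, p, q, k) (Complex x y))\<bar> \<le> 1 * (1 / (b - a))"
      proof -
        have "\<bar>ramp' a b l y\<bar> \<le> 1 / (b - a)"
          using ramp'_nonneg[OF ab(1,2), of y] ramp'_le[OF ab(1,2), of y] by simp
        then have "\<bar>d - c\<bar> * \<bar>ramp' a b l y\<bar> \<le> 1 * (1 / (b - a))"
          using cd by (intro mult_mono) auto
        then show ?thesis by (simp add: Im_eq abs_mult)
      qed
      then have "\<bar>Im (mix_grad (xs, ys, p, q, k) (Complex x y))\<bar>\<^sup>2 \<le> (1 / (b - a))\<^sup>2"
        by (intro power_mono) auto
      then show ?thesis using 2 True by (simp add: power_divide ennreal_leI)
    qed
  qed simp
  then have "vertical_energy (mix_grad (xs, ys, p, q, k)) x \<le> (\<integral>\<^sup>+ y. ennreal (1 / (b - a)\<^sup>2) * indicator {a..b + l} y \<partial>lborel)"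
    unfolding vertical_energy_def by (intro nn_integral_mono)
  also have "\<dots> = ennreal (1 / (b - a)\<^sup>2) * ennreal (b + l - a)"
    using ab by (subst nn_integral_cmult_indicator) auto
  also have "\<dots> = ennreal ((b + l - a) / (b - a)\<^sup>2)"
    using ab by (simp flip: ennreal_mult)
  finally show ?thesis by (simp add: a_def b_def l_def)
qed

text \<open>The closed-up image of the fibre meets the circle only at \<open>b\<close> and
  \<open>t\<close>. If these do not lie in different arcs, the whole path avoids one of the two, and
  a cut-off can be constant along it. Otherwise the path is covered by two overlapping pieces, each
  meeting only one of the arcs, and a ramp is placed where they overlap.\<close>

lemma fibre_infimum:
  assumes x: "x \<in> base" and lim: "fibre_limit x 0 b" "fibre_limit x (f x) t" and norm: "norm b = 1" "norm t = 1"
    and K: "compact K\<^sub>0" "compact K\<^sub>1" "K\<^sub>0 \<subseteq> sphere 0 1" "K\<^sub>1 \<subseteq> sphere 0 1" "K\<^sub>0 \<inter> K\<^sub>1 = {}"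
  defines "Idx \<equiv> {i. potential K\<^sub>0 K\<^sub>1 (mix_pot i) (mix_grad i)}"
  shows "\<not> (b \<in> K\<^sub>0 \<and> t \<in> K\<^sub>1 \<or> b \<in> K\<^sub>1 \<and> t \<in> K\<^sub>0) \<Longrightarrow> \<exists>i\<in>Idx. vertical_energy (mix_grad i) x = 0"
    and "0 < \<eta> \<Longrightarrow> \<eta> < 1 \<Longrightarrow> b \<in> K\<^sub>0 \<and> t \<in> K\<^sub>1 \<or> b \<in> K\<^sub>1 \<and> t \<in> K\<^sub>0 \<Longrightarrow>
      \<exists>i\<in>Idx. vertical_energy (mix_grad i) x \<le> ennreal (1 / (f x * (1 - \<eta>)\<^sup>2))"
proof -
  have fx: "0 < f x" using pos x .
  obtain h where h: "continuous_on {0..f x} h" "h 0 = b" "h (f x) = t"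
    and hy: "\<And>y. y \<in> {0<..<f x} \<Longrightarrow> h y = \<phi> (Complex x y)"
    using fibre_path[OF x lim] by blast
  have in_ball: "\<phi> (Complex x y) \<in> ball 0 1" if "y \<in> {0<..<f x}" for y
    using that x phi_image by (auto simp: mem_D)
  have cpt: "compact (h ` {u..v})" if "0 \<le> u" "v \<le> f x" for u v
    using that by (intro compact_continuous_image continuous_on_subset[OF h(1)]) auto
  have sphere_meet: "h y \<in> sphere 0 1 \<Longrightarrow> y = 0 \<or> y = f x" if "y \<in> {0..f x}" for y
    using in_ball[of y] hy[of y] that by (cases "y = 0 \<or> y = f x") auto
  have codes: "potential K\<^sub>0 K\<^sub>1 (\<lambda>z. cutoff xs (\<phi> z)) (cutoff_phi_grad xs)"
    if "open N" "K\<^sub>0 \<subseteq> N" "\<And>w. w \<in> N \<Longrightarrow> cutoff xs w = 0" "open M" "K\<^sub>1 \<subseteq> M" "\<And>w. w \<in> M \<Longrightarrow> cutoff xs w = 1" for xs N M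
    unfolding cutoff_phi_grad_def by (rule potential_cutoff[OF that])
  have diag: "(xs, xs, 0, 1, 1) \<in> Idx" if "potential K\<^sub>0 K\<^sub>1 (\<lambda>z. cutoff xs (\<phi> z)) (cutoff_phi_grad xs)" for xs
    unfolding Idx_def using potential_mix_code[OF that that] by simp
  show "\<exists>i\<in>Idx. vertical_energy (mix_grad i) x = 0" if "\<not> (b \<in> K\<^sub>0 \<and> t \<in> K\<^sub>1 \<or> b \<in> K\<^sub>1 \<and> t \<in> K\<^sub>0)"
  proof -
    let ?C = "h ` {0..f x}"
    have C: "compact ?C" using cpt by simp
    have "b \<notin> K\<^sub>0 \<or> b \<notin> K\<^sub>1" "t \<notin> K\<^sub>0 \<or> t \<notin> K\<^sub>1" using K(5) by auto
    \<comment> \<open>Unless the ends lie in different arcs, one of the arcs contains neither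
      end.\<close>
    with that have "b \<notin> K\<^sub>1 \<and> t \<notin> K\<^sub>1 \<or> b \<notin> K\<^sub>0 \<and> t \<notin> K\<^sub>0" by argo
    then show ?thesis
    proof
      assume 1: "b \<notin> K\<^sub>1 \<and> t \<notin> K\<^sub>1"
      have "?C \<inter> K\<^sub>1 = {}" using 1 sphere_meet K(4) h(2,3) by blast
      then obtain xs N M where NM: "open N" "K\<^sub>0 \<union> ?C \<subseteq> N" "\<And>w. w \<in> N \<Longrightarrow> cutoff xs w = 0"
          "open M" "K\<^sub>1 \<subseteq> M" "\<And>w. w \<in> M \<Longrightarrow> cutoff xs w = 1"
        using cutoff_separates_compact[OF compact_Un[OF K(1) C] K(2)] K(5) by (metis Int_Un_distrib2 Un_empty)
      have "potential K\<^sub>0 K\<^sub>1 (\<lambda>z. cutoff xs (\<phi> z)) (cutoff_phi_grad xs)"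
        using NM by (intro codes[of N xs M]) auto
      moreover have "\<phi> (Complex x y) \<in> N" if "y \<in> {0<..<f x}" for y
      proof -
        have "h y \<in> ?C" using \<open>y \<in> _\<close> by auto
        then show ?thesis using hy[OF that] NM(2) by auto
      qed
      then have "vertical_energy (cutoff_phi_grad xs) x = 0"
        using NM by (intro vertical_energy_cutoff_eq_0[of N xs 0]) auto
      ultimately show ?thesis using diag mix_grad_diagonal by metis
    next
      assume 2: "b \<notin> K\<^sub>0 \<and> t \<notin> K\<^sub>0"
      have "?C \<inter> K\<^sub>0 = {}" using 2 sphere_meet K(3) h(2,3) by blast
      then obtain xs N M where NM: "open N" "K\<^sub>0 \<subseteq> N" "\<And>w. w \<in> N \<Longrightarrow> cutoff xs w = 0"
          "open M" "K\<^sub>1 \<union> ?C \<subseteq> M" "\<And>w. w \<in> M \<Longrightarrow> cutoff xs w = 1"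
        using cutoff_separates_compact[OF K(1) compact_Un[OF K(2) C]] K(5) by (metis Int_Un_distrib Int_commute Un_empty)
      have "potential K\<^sub>0 K\<^sub>1 (\<lambda>z. cutoff xs (\<phi> z)) (cutoff_phi_grad xs)"
        using NM by (intro codes[of N xs M]) auto
      moreover have "\<phi> (Complex x y) \<in> M" if "y \<in> {0<..<f x}" for y
      proof -
        have "h y \<in> ?C" using \<open>y \<in> _\<close> by auto
        then show ?thesis using hy[OF that] NM(5) by auto
      qed
      then have "vertical_energy (cutoff_phi_grad xs) x = 0"
        using NM by (intro vertical_energy_cutoff_eq_0[of M xs 1]) auto
      ultimately show ?thesis using diag mix_grad_diagonal by metis
    qed
  qed
  show "\<exists>i\<in>Idx. vertical_energy (mix_grad i) x \<le> ennreal (1 / (f x * (1 - \<eta>)\<^sup>2))"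
    if \<eta>: "0 < \<eta>" "\<eta> < 1" and bt: "b \<in> K\<^sub>0 \<and> t \<in> K\<^sub>1 \<or> b \<in> K\<^sub>1 \<and> t \<in> K\<^sub>0"
  proof -
    obtain p q k :: rat where pq: "0 < p" "p < q" "0 < k" "of_rat q + of_rat k < f x"
      and le: "(of_rat q + of_rat k - of_rat p) / (of_rat q - of_rat p)\<^sup>2 \<le> 1 / (f x * (1 - \<eta>)\<^sup>2)"
      using exists_ramp_parameters[OF fx \<eta>] by blast
    have pq': "0 < (of_rat p :: real)" "0 < (of_rat q + of_rat k :: real)"
      using pq by (auto simp: zero_less_of_rat_iff intro: add_pos_pos)
    \<comment> \<open>The pieces overlap exactly in the range of the ramp, from \<open>p\<close> to
      \<open>q + k\<close>; the lower one meets the circle only at \<open>b\<close>, the upper one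
      only at \<open>t\<close>.\<close>
    let ?B = "h ` {0..of_rat q + of_rat k}" and ?T = "h ` {of_rat p..f x}"
    have cB: "compact ?B" and cT: "compact ?T" using pq pq' by (auto intro!: cpt)
    have B_in: "\<phi> (Complex x y) \<in> ?B" if "0 < y" "y \<le> of_rat q + of_rat k" for y
      using hy[of y] that pq by (intro image_eqI[of _ _ y]) auto
    have T_in: "\<phi> (Complex x y) \<in> ?T" if "of_rat p \<le> y" "y < f x" for y
      using hy[of y] that pq' by (intro image_eqI[of _ _ y]) auto
    have B_meet: "w = b" if w: "w \<in> ?B" "w \<in> sphere 0 1" for w
    proof -
      obtain y where "w = h y" "y \<in> {0..of_rat q + of_rat k}" using w(1) by blast
      then show ?thesis using sphere_meet[of y] w(2) pq h(2) by auto
    qed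
    have T_meet: "w = t" if w: "w \<in> ?T" "w \<in> sphere 0 1" for w
    proof -
      obtain y where "w = h y" "y \<in> {of_rat p..f x}" using w(1) by blast
      then show ?thesis using sphere_meet[of y] w(2) pq' h(3) by auto
    qed
    have finish: ?thesis
      if pot: "potential K\<^sub>0 K\<^sub>1 (\<lambda>z. cutoff xs (\<phi> z)) (cutoff_phi_grad xs)"
        "potential K\<^sub>0 K\<^sub>1 (\<lambda>z. cutoff ys (\<phi> z)) (cutoff_phi_grad ys)"
        and N: "open N" "\<And>w. w \<in> N \<Longrightarrow> cutoff xs w = c" "?B \<subseteq> N"
        and M: "open M" "\<And>w. w \<in> M \<Longrightarrow> cutoff ys w = d" "?T \<subseteq> M" and cd: "\<bar>d - c\<bar> \<le> 1"
      for xs ys N M c d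
    proof -
      have "(xs, ys, p, q, k) \<in> Idx"
        unfolding Idx_def using potential_mix_code[OF pot pq(2,3)] by simp
      moreover have "vertical_energy (mix_grad (xs, ys, p, q, k)) x
          \<le> ennreal ((of_rat q + of_rat k - of_rat p) / (of_rat q - of_rat p)\<^sup>2)"
        by (rule vertical_energy_mix_le[OF x pq N(1,2) _ M(1,2) _ cd])
           (use subsetD[OF N(3) B_in] subsetD[OF M(3) T_in] in auto)
      then have "vertical_energy (mix_grad (xs, ys, p, q, k)) x \<le> ennreal (1 / (f x * (1 - \<eta>)\<^sup>2))"
        using le by (meson ennreal_leI order_trans)
      ultimately show ?thesis by blast
    qed
    from bt show ?thesis
    proof (elim disjE conjE)
      assume b: "b \<in> K\<^sub>0" "t \<in> K\<^sub>1"
      have "(K\<^sub>0 \<union> ?B) \<inter> K\<^sub>1 = {}" "K\<^sub>0 \<inter> (K\<^sub>1 \<union> ?T) = {}" using b B_meet T_meet K(3,4,5) by blast+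
      obtain xs N M where 1: "open N" "K\<^sub>0 \<union> ?B \<subseteq> N" "\<And>w. w \<in> N \<Longrightarrow> cutoff xs w = 0"
          "open M" "K\<^sub>1 \<subseteq> M" "\<And>w. w \<in> M \<Longrightarrow> cutoff xs w = 1"
        using cutoff_separates_compact[OF compact_Un[OF K(1) cB] K(2) \<open>(K\<^sub>0 \<union> ?B) \<inter> K\<^sub>1 = {}\<close>] by metis
      obtain ys N' M' where 2: "open N'" "K\<^sub>0 \<subseteq> N'" "\<And>w. w \<in> N' \<Longrightarrow> cutoff ys w = 0"
          "open M'" "K\<^sub>1 \<union> ?T \<subseteq> M'" "\<And>w. w \<in> M' \<Longrightarrow> cutoff ys w = 1"
        using cutoff_separates_compact[OF K(1) compact_Un[OF K(2) cT] \<open>K\<^sub>0 \<inter> (K\<^sub>1 \<union> ?T) = {}\<close>] by metis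
      have "potential K\<^sub>0 K\<^sub>1 (\<lambda>z. cutoff xs (\<phi> z)) (cutoff_phi_grad xs)" using 1 by (intro codes[of N xs M]) auto
      moreover have "potential K\<^sub>0 K\<^sub>1 (\<lambda>z. cutoff ys (\<phi> z)) (cutoff_phi_grad ys)" using 2 by (intro codes[of N' ys M']) auto
      ultimately show ?thesis
        using 1 2 by (intro finish[of xs ys N 0 M' 1]) auto
    next
      assume b: "b \<in> K\<^sub>1" "t \<in> K\<^sub>0"
      have "K\<^sub>0 \<inter> (K\<^sub>1 \<union> ?B) = {}" "(K\<^sub>0 \<union> ?T) \<inter> K\<^sub>1 = {}" using b B_meet T_meet K(3,4,5) by blast+
      obtain xs N M where 1: "open N" "K\<^sub>0 \<subseteq> N" "\<And>w. w \<in> N \<Longrightarrow> cutoff xs w = 0"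
          "open M" "K\<^sub>1 \<union> ?B \<subseteq> M" "\<And>w. w \<in> M \<Longrightarrow> cutoff xs w = 1"
        using cutoff_separates_compact[OF K(1) compact_Un[OF K(2) cB] \<open>K\<^sub>0 \<inter> (K\<^sub>1 \<union> ?B) = {}\<close>] by metis
      obtain ys N' M' where 2: "open N'" "K\<^sub>0 \<union> ?T \<subseteq> N'" "\<And>w. w \<in> N' \<Longrightarrow> cutoff ys w = 0"
          "open M'" "K\<^sub>1 \<subseteq> M'" "\<And>w. w \<in> M' \<Longrightarrow> cutoff ys w = 1"
        using cutoff_separates_compact[OF compact_Un[OF K(1) cT] K(2) \<open>(K\<^sub>0 \<union> ?T) \<inter> K\<^sub>1 = {}\<close>] by metis
      have "potential K\<^sub>0 K\<^sub>1 (\<lambda>z. cutoff xs (\<phi> z)) (cutoff_phi_grad xs)" using 1 by (intro codes[of N xs M]) auto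
      moreover have "potential K\<^sub>0 K\<^sub>1 (\<lambda>z. cutoff ys (\<phi> z)) (cutoff_phi_grad ys)" using 2 by (intro codes[of N' ys M']) auto
      ultimately show ?thesis
        using 1 2 by (intro finish[of xs ys M 1 N' 0]) auto
    qed
  qed
qed

end

subsection \<open>The limit\<close>

lemma compact_cis_image: "compact (cis ` {s..t})"
  by (intro compact_continuous_image continuous_intros) auto

lemma cis_images_disjoint:
  assumes "s1 \<le> t1" "t1 < s2" "t2 < s1 + 2 * pi"
  shows "cis ` {s1..t1} \<inter> cis ` {s2..t2} = {}"
proof (rule ccontr)
  assume "\<not> ?thesis"
  then obtain u v where uv: "u \<in> {s1..t1}" "v \<in> {s2..t2}" "cis v = cis u" by force
  then obtain n :: int where n: "v = u + 2 * pi * of_int n"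
    using sin_cos_eq_iff[of v u] by (auto simp: cis.ctr)
  have "s1 \<le> u" "u \<le> t1" "s2 \<le> v" "v \<le> t2" using uv by auto
  then have less: "2 * pi * 0 < 2 * pi * of_int n" "2 * pi * of_int n < 2 * pi * 1"
    using n assms by linarith+
  have "(0::real) < of_int n" "of_int n < (1::real)"
    by (rule mult_left_less_imp_less[OF less(1)], simp, rule mult_left_less_imp_less[OF less(2)], simp)
  then show False by simp
qed

lemma ennreal_le_of_scaled:
  assumes m: "0 < m" and le: "\<And>\<eta>. 0 < \<eta> \<Longrightarrow> \<eta> < 1 \<Longrightarrow> c \<le> ennreal (1 / (m * (1 - \<eta>)\<^sup>2))"
  shows "c \<le> ennreal (1 / m)"
proof (rule tendsto_lowerbound)
  have "((\<lambda>\<eta>. 1 / (m * (1 - \<eta>)\<^sup>2)) \<longlongrightarrow> 1 / (m * (1 - 0)\<^sup>2)) (at_right 0)"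
    by (intro tendsto_intros) (use m in auto)
  then show "((\<lambda>\<eta>. ennreal (1 / (m * (1 - \<eta>)\<^sup>2))) \<longlongrightarrow> ennreal (1 / m)) (at_right 0)"
    by (intro tendsto_ennrealI) simp
  have "\<forall>\<^sub>F \<eta> in at_right (0::real). \<eta> \<in> {0<..<1}"
    by (rule eventually_at_right_real) simp
  then show "\<forall>\<^sub>F \<eta> in at_right 0. c \<le> ennreal (1 / (m * (1 - \<eta>)\<^sup>2))"
    by eventually_elim (use le in auto)
qed simp

lemma vertical_segment_Re_const:
  "vertical_segment \<gamma> \<Longrightarrow> \<exists>x. \<forall>t\<in>{0<..<1}. Re (\<gamma> t) = x"
  unfolding vertical_segment_def by blast

context under_graph_map
begin

text \<open>Cauchy-Schwarz on a fibre of length \<open>f x\<close>: admissibility gives integral at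
  least 1, so the squared density has integral at least the energy of the linear ramp.\<close>

lemma fibre_square_integral_ge:
  assumes x: "x \<in> base" and [measurable]: "\<rho> \<in> borel_measurable borel"
    and adm: "1 \<le> line_integral \<rho> (vertical_fibre x (f x))"
  shows "ennreal (1 / f x) \<le> (\<integral>\<^sup>+ y. (\<rho> (Complex x y))\<^sup>2 \<partial>lborel)"
proof -
  have fx: "0 < f x" using pos x .
  have "1 \<le> (\<integral>\<^sup>+ y \<in> {0<..<f x}. \<rho> (Complex x y) \<partial>lborel)"
    using adm line_integral_vertical_fibre_le[OF fx, of \<rho> x] by (auto intro: order_trans)
  then have "1\<^sup>2 \<le> (\<integral>\<^sup>+ y \<in> {0<..<f x}. \<rho> (Complex x y) \<partial>lborel)\<^sup>2"
    by (rule power_mono) simp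
  also have "\<dots> \<le> (\<integral>\<^sup>+ y. (\<rho> (Complex x y))\<^sup>2 \<partial>lborel) * (\<integral>\<^sup>+ y. (indicator {0<..<f x} y)\<^sup>2 \<partial>lborel)"
    by (rule Cauchy_Schwarz_nn_integral) measurable
  also have "(\<integral>\<^sup>+ y. (indicator {0<..<f x} y :: ennreal)\<^sup>2 \<partial>lborel) = (\<integral>\<^sup>+ y. indicator {0<..<f x} y \<partial>lborel)"
    by (intro nn_integral_cong) (auto simp: indicator_def)
  also have "\<dots> = ennreal (f x)" using fx by simp
  finally have "1 \<le> (\<integral>\<^sup>+ y. (\<rho> (Complex x y))\<^sup>2 \<partial>lborel) * ennreal (f x)" by simp
  then have "ennreal (1 / f x) * 1 \<le> ennreal (1 / f x) * ((\<integral>\<^sup>+ y. (\<rho> (Complex x y))\<^sup>2 \<partial>lborel) * ennreal (f x))"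
    by (rule mult_left_mono) simp
  also have "\<dots> = (\<integral>\<^sup>+ y. (\<rho> (Complex x y))\<^sup>2 \<partial>lborel) * (ennreal (1 / f x) * ennreal (f x))"
    by (simp only: mult.assoc mult.commute mult.left_commute)
  also have "ennreal (1 / f x) * ennreal (f x) = 1" using fx by (simp flip: ennreal_mult)
  finally show ?thesis by simp
qed

lemma scaled_modulus_limit:
  assumes \<theta>: "\<theta>\<^sub>1 < \<theta>\<^sub>2" "\<theta>\<^sub>2 < \<theta>\<^sub>3" "\<theta>\<^sub>3 < \<theta>\<^sub>4" "\<theta>\<^sub>4 < \<theta>\<^sub>1 + 2 * pi"
    and P: "\<And>p. p \<in> P \<longleftrightarrow> (\<exists>\<zeta>\<in>cis ` {\<theta>\<^sub>1<..<\<theta>\<^sub>2}. corresponds D \<phi> p \<zeta>)"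
    and Q: "\<And>p. p \<in> Q \<longleftrightarrow> (\<exists>\<zeta>\<in>cis ` {\<theta>\<^sub>3<..<\<theta>\<^sub>4}. corresponds D \<phi> p \<zeta>)"
  defines "\<Gamma> \<equiv> connecting_curves D P Q"
  defines "\<Gamma>\<^sub>v \<equiv> {\<gamma> \<in> \<Gamma>. vertical_segment \<gamma>}"
  shows "((\<lambda>\<epsilon>. ennreal \<epsilon> * modulus (scaled_family \<epsilon> \<Gamma>)) \<longlongrightarrow> modulus \<Gamma>\<^sub>v) (at_right 0)"
proof -
  define I where "I = cis ` {\<theta>\<^sub>1<..<\<theta>\<^sub>2}"
  define J where "J = cis ` {\<theta>\<^sub>3<..<\<theta>\<^sub>4}"
  define K\<^sub>0 where "K\<^sub>0 = cis ` {\<theta>\<^sub>1..\<theta>\<^sub>2}"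
  define K\<^sub>1 where "K\<^sub>1 = cis ` {\<theta>\<^sub>3..\<theta>\<^sub>4}"
  have K: "compact K\<^sub>0" "compact K\<^sub>1" "K\<^sub>0 \<subseteq> sphere 0 1" "K\<^sub>1 \<subseteq> sphere 0 1" "K\<^sub>0 \<inter> K\<^sub>1 = {}"
  proof -
    show "K\<^sub>0 \<inter> K\<^sub>1 = {}" unfolding K\<^sub>0_def K\<^sub>1_def by (rule cis_images_disjoint) (use \<theta> in auto)
  qed (auto simp: K\<^sub>0_def K\<^sub>1_def compact_cis_image)
  have IJ: "I \<subseteq> K\<^sub>0" "J \<subseteq> K\<^sub>1" by (auto simp: I_def J_def K\<^sub>0_def K\<^sub>1_def)
  \<comment> \<open>Potentials are attached to closed arcs, as compactness requires, while the
    family of curves is defined by open ones. The difference consists of the four points that almost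
    no fibre ends at.\<close>
  have I_of_K: "z \<in> I" if "z \<in> K\<^sub>0" "z \<noteq> cis \<theta>\<^sub>1" "z \<noteq> cis \<theta>\<^sub>2" for z
    using that unfolding K\<^sub>0_def I_def by (force simp: less_le)
  have J_of_K: "z \<in> J" if "z \<in> K\<^sub>1" "z \<noteq> cis \<theta>\<^sub>3" "z \<noteq> cis \<theta>\<^sub>4" for z
    using that unfolding K\<^sub>1_def J_def by (force simp: less_le)
  define Idx where "Idx = {i. potential K\<^sub>0 K\<^sub>1 (mix_pot i) (mix_grad i)}"
  \<comment> \<open>The index set is countable and nonempty, so this enumeration has it as its
    range.\<close>
  define en where "en = from_nat_into Idx"
  have "Idx \<noteq> {}"
  proof -
    obtain xs N M where NM: "open N" "K\<^sub>0 \<subseteq> N" "\<And>w. w \<in> N \<Longrightarrow> cutoff xs w = 0"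
        "open M" "K\<^sub>1 \<subseteq> M" "\<And>w. w \<in> M \<Longrightarrow> cutoff xs w = 1"
      using cutoff_separates_compact[OF K(1,2,5)] by metis
    have "potential K\<^sub>0 K\<^sub>1 (\<lambda>z. cutoff xs (\<phi> z)) (cutoff_phi_grad xs)"
      unfolding cutoff_phi_grad_def by (rule potential_cutoff[OF NM])
    from potential_mix_code[OF this this, of 0 1 1] have "(xs, xs, 0, 1, 1) \<in> Idx" by (simp add: Idx_def)
    then show ?thesis by blast
  qed
  then have en: "range en = Idx" unfolding en_def by (simp add: range_from_nat_into)
  have pot: "potential K\<^sub>0 K\<^sub>1 (mix_pot (en n)) (mix_grad (en n))" for n
    using en by (auto simp: Idx_def)
  define Inf_energy where "Inf_energy x = (INF n. vertical_energy (mix_grad (en n)) x)" for x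
  have Inf_le: "Inf_energy x \<le> vertical_energy (mix_grad i) x" if "i \<in> Idx" for i x
  proof -
    obtain n where "i = en n" using \<open>i \<in> Idx\<close> en by blast
    then show ?thesis
      unfolding Inf_energy_def using INF_lower[of n UNIV "\<lambda>n. vertical_energy (mix_grad (en n)) x"] by simp
  qed
  have rect: "locally_rectifiable \<gamma>" "\<gamma> ` {0<..<1} \<subseteq> D" if "\<gamma> \<in> \<Gamma>" for \<gamma>
    using that by (auto simp: \<Gamma>_def connecting_curves_def)
  have lower: "modulus \<Gamma>\<^sub>v \<le> ennreal \<epsilon> * modulus (scaled_family \<epsilon> \<Gamma>)" if "0 < \<epsilon>" for \<epsilon>
  proof (rule modulus_vertical_le_scaled[OF that])
    show "\<Gamma>\<^sub>v \<subseteq> \<Gamma>" by (auto simp: \<Gamma>\<^sub>v_def)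
    show "locally_rectifiable \<gamma> \<and> (\<exists>x. \<forall>t\<in>{0<..<1}. Re (\<gamma> t) = x)" if "\<gamma> \<in> \<Gamma>\<^sub>v" for \<gamma>
      using that rect vertical_segment_Re_const by (simp add: \<Gamma>\<^sub>v_def)
  qed
  \<comment> \<open>Each curve of the family attains the value 0 at one parameter and 1 at another,
    so every potential provides an admissible gradient.\<close>
  have upper: "ennreal \<epsilon> * modulus (scaled_family \<epsilon> \<Gamma>) \<le>
      ennreal (\<epsilon>\<^sup>2) * (\<integral>\<^sup>+ z \<in> D. ennreal ((Re (g z))\<^sup>2) \<partial>lborel) + (\<integral>\<^sup>+ x. vertical_energy g x \<partial>lborel)"
    if \<epsilon>: "0 < \<epsilon>" "\<epsilon> \<le> 1" and u: "potential K\<^sub>0 K\<^sub>1 u g" for \<epsilon> u g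
    unfolding nn_integral_vertical_energy[OF potential_energy_finite(1)[OF u]]
  proof (rule modulus_scaled_family_le[OF \<epsilon> open_D])
    have grad: "has_gradient_on u g D" using u by (simp add: potential_def)
    then show "(u has_derivative (\<lambda>h. g z \<bullet> h)) (at z)" if "z \<in> D" for z
      using that by (rule has_gradient_onD)
    show "continuous_on D g" using grad by (simp add: has_gradient_on_def)
    obtain N where N: "open N" "K\<^sub>0 \<subseteq> N" "\<And>z. z \<in> D \<Longrightarrow> \<phi> z \<in> N \<Longrightarrow> u z = 0"
      using u unfolding potential_def by blast
    obtain M where M: "open M" "K\<^sub>1 \<subseteq> M" "\<And>z. z \<in> D \<Longrightarrow> \<phi> z \<in> M \<Longrightarrow> u z = 1"
      using u unfolding potential_def by blast
    fix \<gamma> assume \<gamma>: "\<gamma> \<in> \<Gamma>"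
    have "\<exists>s t. 0 < s \<and> s < t \<and> t < 1 \<and>
      (\<phi> (\<gamma> s) \<in> N \<and> \<phi> (\<gamma> t) \<in> M \<or> \<phi> (\<gamma> s) \<in> M \<and> \<phi> (\<gamma> t) \<in> N)"
    proof (rule connecting_curves_image[OF open_D connected_D _ \<gamma>[unfolded \<Gamma>_def], where I=I and J=J])
      show "\<phi> ` D \<subseteq> ball 0 1" using phi_image by simp
      show "\<exists>\<zeta>\<in>I. corresponds D \<phi> p \<zeta>" if "p \<in> P" for p using that P by (simp add: I_def)
      show "\<exists>\<zeta>\<in>J. corresponds D \<phi> p \<zeta>" if "p \<in> Q" for p using that Q by (simp add: J_def)
    qed (use IJ K N M in auto)
    then obtain s t where st: "0 < s" "s < t" "t < 1"
      and NM: "\<phi> (\<gamma> s) \<in> N \<and> \<phi> (\<gamma> t) \<in> M \<or> \<phi> (\<gamma> s) \<in> M \<and> \<phi> (\<gamma> t) \<in> N" by blast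
    have "s \<in> {0<..<1}" "t \<in> {0<..<1}" using st by auto
    then have "\<gamma> s \<in> D" "\<gamma> t \<in> D" using rect(2)[OF \<gamma>] by blast+
    then have "1 \<le> \<bar>u (\<gamma> t) - u (\<gamma> s)\<bar>" using NM N(3) M(3) by auto
    then show "locally_rectifiable \<gamma> \<and> \<gamma> ` {0<..<1} \<subseteq> D \<and>
        (\<exists>s t. 0 < s \<and> s < t \<and> t < 1 \<and> 1 \<le> \<bar>u (\<gamma> t) - u (\<gamma> s)\<bar>)"
      using rect[OF \<gamma>] st by blast
  qed
  \<comment> \<open>The comparison is made with each admissible density separately, fibre by fibre:
    where the infimum is 0 nothing is to be shown, elsewhere the fibre belongs to
    \<open>\<Gamma>\<^sub>v\<close> and the density costs at least \<open>1 / f x\<close> on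
    it.\<close>
  have Inf_bound: "(\<integral>\<^sup>+ x. Inf_energy x \<partial>lborel) \<le> modulus \<Gamma>\<^sub>v"
    unfolding modulus_def
  proof (rule INF_greatest)
    fix \<rho> assume adm: "\<rho> \<in> admissible \<Gamma>\<^sub>v"
    then have [measurable]: "\<rho> \<in> borel_measurable borel" by (simp add: admissible_def)
    have "AE x in lborel. x \<in> base \<longrightarrow> \<not> fibre_limit x 0 (cis \<theta>) \<and> \<not> fibre_limit x (f x) (cis \<theta>)" for \<theta>
      by (rule AE_fibre_limit_ne) simp
    from this[of \<theta>\<^sub>1] this[of \<theta>\<^sub>2] this[of \<theta>\<^sub>3] this[of \<theta>\<^sub>4] AE_accumulated AE_fibre_energy_finite
    have "AE x in lborel. Inf_energy x \<le> (\<integral>\<^sup>+ y. (\<rho> (Complex x y))\<^sup>2 \<partial>lborel)"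
    proof eventually_elim
      case (elim x)
      show ?case
      proof (cases "x \<in> base")
        case False
        then have "indicator D (Complex x y) = (0 :: ennreal)" for y by (simp add: mem_D)
        then have "vertical_energy g x = 0" for g by (simp add: vertical_energy_def)
        then have "Inf_energy x = 0" by (simp add: Inf_energy_def)
        then show ?thesis by simp
      next
        case x: True
        obtain b where b: "fibre_limit x 0 b" "norm b = 1"
          using fibre_limit_exists[OF x, of 0] elim by blast
        obtain t where t: "fibre_limit x (f x) t" "norm t = 1"
          using fibre_limit_exists[OF x, of "f x"] elim by blast
        have ne: "b \<notin> {cis \<theta>\<^sub>1, cis \<theta>\<^sub>2, cis \<theta>\<^sub>3, cis \<theta>\<^sub>4}" "t \<notin> {cis \<theta>\<^sub>1, cis \<theta>\<^sub>2, cis \<theta>\<^sub>3, cis \<theta>\<^sub>4}"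
          using elim x b t by auto
        note inf = fibre_infimum[OF x b(1) t(1) b(2) t(2) K]
        show ?thesis
        proof (cases "b \<in> K\<^sub>0 \<and> t \<in> K\<^sub>1 \<or> b \<in> K\<^sub>1 \<and> t \<in> K\<^sub>0")
          case False
          then obtain i where "i \<in> Idx" "vertical_energy (mix_grad i) x = 0"
            using inf(1) unfolding Idx_def by blast
          then have "Inf_energy x \<le> 0" using Inf_le by metis
          then show ?thesis by (rule order_trans) simp
        next
          case True
          have "vertical_fibre x (f x) \<in> \<Gamma>\<^sub>v"
          proof (cases "b \<in> K\<^sub>0 \<and> t \<in> K\<^sub>1")
            case True
            then have "b \<in> I" "t \<in> J" using ne I_of_K J_of_K by auto
            then show ?thesis
              using vertical_fibre_connects[OF x _ _ b(1) t(1) b(2) t(2), of P Q] elim P Q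
              unfolding \<Gamma>\<^sub>v_def \<Gamma>_def I_def J_def by blast
          next
            case False
            with True have "b \<in> J" "t \<in> I" using ne I_of_K J_of_K by auto
            then show ?thesis
              using vertical_fibre_connects[OF x _ _ b(1) t(1) b(2) t(2), of Q P] elim P Q
              unfolding \<Gamma>\<^sub>v_def \<Gamma>_def I_def J_def by blast
          qed
          then have "1 \<le> line_integral \<rho> (vertical_fibre x (f x))"
            using adm by (simp add: admissible_def)
          then have ge: "ennreal (1 / f x) \<le> (\<integral>\<^sup>+ y. (\<rho> (Complex x y))\<^sup>2 \<partial>lborel)"
            by (intro fibre_square_integral_ge[OF x]) auto
          have "Inf_energy x \<le> ennreal (1 / f x)"
          proof (rule ennreal_le_of_scaled)
            show "0 < f x" using pos x .
            fix \<eta> :: real assume \<eta>: "0 < \<eta>" "\<eta> < 1"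
            obtain i where "i \<in> Idx" "vertical_energy (mix_grad i) x \<le> ennreal (1 / (f x * (1 - \<eta>)\<^sup>2))"
              using inf(2)[OF \<eta> True] unfolding Idx_def by blast
            then show "Inf_energy x \<le> ennreal (1 / (f x * (1 - \<eta>)\<^sup>2))" using Inf_le order_trans by blast
          qed
          then show ?thesis using ge by (rule order_trans)
        qed
      qed
    qed
    then have "(\<integral>\<^sup>+ x. Inf_energy x \<partial>lborel) \<le> (\<integral>\<^sup>+ x. \<integral>\<^sup>+ y. (\<rho> (Complex x y))\<^sup>2 \<partial>lborel \<partial>lborel)"
      by (rule nn_integral_mono_AE)
    also have "\<dots> = (\<integral>\<^sup>+ z. (\<rho> z)\<^sup>2 \<partial>lborel)"
      by (rule nn_integral_complex_iterated[symmetric]) measurable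
    finally show "(\<integral>\<^sup>+ x. Inf_energy x \<partial>lborel) \<le> (\<integral>\<^sup>+ z. (\<rho> z)\<^sup>2 \<partial>lborel)" .
  qed
  have ev01: "\<forall>\<^sub>F \<epsilon> in at_right (0::real). \<epsilon> \<in> {0<..<1}"
    by (rule eventually_at_right_real) simp
  show ?thesis
  proof (rule order_tendstoI)
    fix a assume a: "a < modulus \<Gamma>\<^sub>v"
    show "\<forall>\<^sub>F \<epsilon> in at_right 0. a < ennreal \<epsilon> * modulus (scaled_family \<epsilon> \<Gamma>)"
      using ev01 by eventually_elim (use a lower in \<open>auto intro: less_le_trans\<close>)
  next
    fix a assume a: "modulus \<Gamma>\<^sub>v < a"
    \<comment> \<open>One \<open>d\<close> is spent on the distance of the chosen potential from the
      infimum, the other on its horizontal energy times \<epsilon> squared.\<close>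
    obtain d where d: "0 < d" "modulus \<Gamma>\<^sub>v + ennreal d + ennreal d \<le> a"
    proof -
      obtain m where m: "modulus \<Gamma>\<^sub>v = ennreal m" "0 \<le> m" using a by (cases "modulus \<Gamma>\<^sub>v") auto
      show thesis
      proof (cases a)
        case (real r)
        then have "m < r" using a m by (simp add: ennreal_less_iff)
        then show thesis using m real by (intro that[of "(r - m) / 2"]) (auto simp flip: ennreal_plus)
      next
        case top
        then show thesis by (intro that[of 1]) auto
      qed
    qed
    obtain u g where u: "potential K\<^sub>0 K\<^sub>1 u g"
      and g: "(\<integral>\<^sup>+ x. vertical_energy g x \<partial>lborel) \<le> (\<integral>\<^sup>+ x. Inf_energy x \<partial>lborel) + ennreal d"
      unfolding Inf_energy_def
      by (rule potential_near_infimum[where u="\<lambda>n. mix_pot (en n)" and g="\<lambda>n. mix_grad (en n)", OF pot d(1)])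
    define R where "R = (\<integral>\<^sup>+ z \<in> D. ennreal ((Re (g z))\<^sup>2) \<partial>lborel)"
    have R: "R < \<infinity>" unfolding R_def by (rule potential_energy_finite(3)[OF u])
    then obtain R' where R': "R = ennreal R'" "0 \<le> R'" by (cases R) auto
    have g_le: "(\<integral>\<^sup>+ x. vertical_energy g x \<partial>lborel) \<le> modulus \<Gamma>\<^sub>v + ennreal d"
      using g Inf_bound by (meson add_right_mono order_trans)
    have "((\<lambda>\<epsilon>. \<epsilon>\<^sup>2 * R') \<longlongrightarrow> 0\<^sup>2 * R') (at_right 0)" by (intro tendsto_intros)
    then have "\<forall>\<^sub>F \<epsilon> in at_right 0. \<epsilon>\<^sup>2 * R' < d" using d(1) by (simp add: order_tendsto_iff)
    with ev01 show "\<forall>\<^sub>F \<epsilon> in at_right 0. ennreal \<epsilon> * modulus (scaled_family \<epsilon> \<Gamma>) < a"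
    proof eventually_elim
      case (elim \<epsilon>)
      have "modulus \<Gamma>\<^sub>v < top" using a top_greatest by (rule less_le_trans)
      then have fin: "modulus \<Gamma>\<^sub>v + ennreal d \<noteq> \<infinity>" by simp
      have "ennreal \<epsilon> * modulus (scaled_family \<epsilon> \<Gamma>) \<le> ennreal (\<epsilon>\<^sup>2) * R + (\<integral>\<^sup>+ x. vertical_energy g x \<partial>lborel)"
        unfolding R_def using elim by (intro upper[OF _ _ u]) auto
      also have "\<dots> \<le> ennreal (\<epsilon>\<^sup>2 * R') + (modulus \<Gamma>\<^sub>v + ennreal d)"
        using g_le R' by (intro add_mono) (auto simp: ennreal_mult)
      also have "\<dots> < ennreal d + (modulus \<Gamma>\<^sub>v + ennreal d)"
        unfolding add.commute[of _ "modulus \<Gamma>\<^sub>v + ennreal d"] ennreal_add_left_cancel_less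
        using elim R'(2) fin by (simp add: ennreal_less_iff)
      also have "\<dots> \<le> a" using d(2) by (simp add: ac_simps)
      finally show ?case .
    qed
  qed
qed

end

theorem theorem1p1:
  fixes A B :: ereal
    and f :: "real \<Rightarrow> real"
    and D :: "complex set"
    and \<phi> :: "complex \<Rightarrow> complex"
    and a b c d :: prime_end
    and \<Gamma> \<Gamma>\<^sub>v :: "(real \<Rightarrow> complex) set"
  assumes "A < B"
    and "\<And>x. x \<in> ereal_interval A B \<Longrightarrow> 0 < f x"
    and "lower_semicontinuous_on (ereal_interval A B) f"
    and "D = under_graph A B f"
    and "emeasure lborel D < \<infinity>"
    and "riemann_map D \<phi>"
    and "ccw_prime_ends D \<phi> a b c d"
    and "\<Gamma> = connecting_curves D (prime_end_arc D \<phi> a b) (prime_end_arc D \<phi> c d)"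
    and "\<Gamma>\<^sub>v = {\<gamma> \<in> \<Gamma>. vertical_segment \<gamma>}"
  shows "((\<lambda>\<epsilon>. ennreal \<epsilon> * modulus (scaled_family \<epsilon> \<Gamma>)) \<longlongrightarrow> modulus \<Gamma>\<^sub>v) (at_right 0)"
proof -
  interpret under_graph_map A B f D \<phi>
    using assms(2-6) by unfold_locales auto
  obtain \<theta>\<^sub>1 \<theta>\<^sub>2 \<theta>\<^sub>3 \<theta>\<^sub>4 where \<theta>: "\<theta>\<^sub>1 < \<theta>\<^sub>2" "\<theta>\<^sub>2 < \<theta>\<^sub>3" "\<theta>\<^sub>3 < \<theta>\<^sub>4" "\<theta>\<^sub>4 < \<theta>\<^sub>1 + 2 * pi"
    and corr: "corresponds D \<phi> a (cis \<theta>\<^sub>1)" "corresponds D \<phi> b (cis \<theta>\<^sub>2)"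
      "corresponds D \<phi> c (cis \<theta>\<^sub>3)" "corresponds D \<phi> d (cis \<theta>\<^sub>4)"
    using assms(7) unfolding ccw_prime_ends_def by blast
  \<comment> \<open>In angular coordinates each arc becomes the image of an interval shorter than a
    full turn.\<close>
  have "p \<in> prime_end_arc D \<phi> a b \<longleftrightarrow> (\<exists>\<zeta>\<in>cis ` {\<theta>\<^sub>1<..<\<theta>\<^sub>2}. corresponds D \<phi> p \<zeta>)" for p
    using \<theta> by (intro prime_end_arc_cis corr) auto
  moreover have "p \<in> prime_end_arc D \<phi> c d \<longleftrightarrow> (\<exists>\<zeta>\<in>cis ` {\<theta>\<^sub>3<..<\<theta>\<^sub>4}. corresponds D \<phi> p \<zeta>)" for p
    using \<theta> by (intro prime_end_arc_cis corr) auto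
  ultimately show ?thesis
    using scaled_modulus_limit[OF \<theta>] unfolding assms(8,9) by blast
qed

end
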